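(* Let $n\ge2$, let $X$ be a dendrite, and let $\gamma: X \to \mathbb{R}^n$ be a generalized path (i.e. a continuous map). (i) If $A$ is a subcontinuum of $X$, then $\mathsf{len}(\gamma|_A) \leq \mathsf{len}(\gamma)$. Moreover, $\mathsf{len}(\gamma|_A) = \mathsf{len}(\gamma)$ if and only if $\gamma$ is constant on each component of $X \setminus A$. (ii) If $A,B$ are subcontinua of $X$ with $A \cup B = X$, then $$\mathsf{len}(\gamma) \leq \mathsf{len}(\gamma|_A) + \mathsf{len}(\gamma|_B).$$
   Context: A continuum is a nonempty compact connected metric space. A dendrite is a locally connected metric continuum which contains no simple closed curve (every subcontinuum of a dendrite is again a dendrite). A generalized path is a continuous map $\gamma: X\to\mathbb{R}^n$ where $X$ is a locally connected metric continuum. Definition of $\mathsf{len}=\mathsf{len}_n$. For a unit vector $u\in \mathbb{S}^{n-1}$, $x\in[0,1]$, $\mu\in(0,1]$ and $j\in\mathbb{Z}$ put $S_j^{x,u,\mu}=\{z\in\mathbb{R}^n: \mu(j+x)\le\langle z,u\rangle\le\mu(j+1+x)\}$, and for $A\subset\mathbb{R}^n$ put $\|A\|_u=\mathrm{diam}\{\langle z,u\rangle: z\in A\}$. Given a generalized path $\gamma:X\to\mathbb{R}^n$, let $C_0,C_1,C_2,\ldots$ (a finite or infinite list) enumerate all connected components $C$ of the sets $\gamma^{-1}(S_j^{x,u,\mu})$, $j\in\mathbb{Z}$, for which $\|\gamma(C)\|_u>0$, ordered so that $\|\gamma(C_k)\|_u\ge\|\gamma(C_{k+1})\|_u$ for all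 $k$ (this is possible, since for each $\varepsilon>0$ only finitely many such components have $\|\gamma(C)\|_u\ge\varepsilon$). Put $L^{x,u,\mu}(\gamma)=\sum_{k\ge0}2^{-k}\|\gamma(C_k)\|_u$ (missing terms count as $0$), and $$\mathsf{len}(\gamma)=\int_0^1\int_{\mathbb{S}^{n-1}}\int_0^1 L^{x,u,\mu}(\gamma)\,dx\,d\sigma(u)\,d\mu,$$ where $\sigma$ is the rotation-invariant probability measure on $\mathbb{S}^{n-1}$. (Replacing $u$ by $-u$ does not change the integral over $x$, so equivalently one integrates over $(n-1)$-dimensional real projective space; for $n=2$, identifying $\mathbb{R}^2$ with $\mathbb{C}$, one may take $u=ie^{t\pi i}$ and integrate $dt$ over $t\in[0,1]$.) *)

theory Defs
  imports "HOL-Analysis.Analysis" "HOL-Library.Extended_Nat"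
begin

subsection \<open>Continua and dendrites\<close>

definition continuum :: "'a::metric_space set \<Rightarrow> bool" where
  "continuum X \<longleftrightarrow> X \<noteq> {} \<and> compact X \<and> connected X"

definition subcontinuum :: "'a::metric_space set \<Rightarrow> 'a set \<Rightarrow> bool" where
  "subcontinuum A X \<longleftrightarrow> A \<subseteq> X \<and> continuum A"

definition simple_closed_curve :: "'a::metric_space set \<Rightarrow> bool" where
  "simple_closed_curve S \<longleftrightarrow> S homeomorphic sphere (0::complex) 1"

definition dendrite :: "'a::metric_space set \<Rightarrow> bool" where
  "dendrite X \<longleftrightarrow> continuum X \<and> locally connected X \<and>
     \<not> (\<exists>S\<subseteq>X. simple_closed_curve S)"


subsection \<open>The rotation-invariant probability measure on the unit sphere\<close>

text \<open>
  Realised as the image of the uniform distribution on the unit ball under radial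
  projection. It is a measure on the Borel sets of the ambient space that is concentrated
  on the unit sphere; the lemmas below establish its characterising properties.
\<close>

definition sphere_measure :: "'a::euclidean_space measure" where
  "sphere_measure = distr (uniform_measure lborel (cball 0 1)) borel sgn"

lemma emeasure_lborel_unit_cball:
  "emeasure lborel (cball (0::'a::euclidean_space) 1) \<noteq> 0"
  "emeasure lborel (cball (0::'a::euclidean_space) 1) \<noteq> \<infinity>"
  using order.strict_implies_not_eq[OF unit_ball_vol_pos[of "real DIM('a)"]]
  by (simp_all add: emeasure_cball)

lemma translation_invariant_eq_lborel:
  fixes \<nu> :: "'a::euclidean_space measure"
  assumes sets_\<nu> [measurable_cong]: "sets \<nu> = sets borel" and fin: "sigma_finite_measure \<nu>"
    and inv: "\<And>t. distr \<nu> borel (\<lambda>x. x + t) = \<nu>"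
    and ball: "emeasure \<nu> (cball 0 1) = emeasure lborel (cball (0::'a) 1)"
  shows "\<nu> = lborel"
proof (rule measure_eqI)
  show "sets \<nu> = sets lborel" by (simp add: sets_\<nu>)
next
  fix A assume "A \<in> sets \<nu>"
  hence A [measurable]: "A \<in> sets borel" by (simp add: sets_\<nu>)
  interpret nu: sigma_finite_measure \<nu> by (rule fin)
  interpret P: pair_sigma_finite \<nu> "lborel :: 'a measure" ..
  define B where "B = cball (0::'a) 1"
  have B [measurable]: "B \<in> sets borel" by (simp add: B_def)
  have shift_nu: "(\<integral>\<^sup>+x. f (x + t) \<partial>\<nu>) = (\<integral>\<^sup>+x. f x \<partial>\<nu>)"
    if [measurable]: "f \<in> borel_measurable borel" for f :: "'a \<Rightarrow> ennreal" and t
  proof -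
    have "(\<integral>\<^sup>+x. f x \<partial>\<nu>) = (\<integral>\<^sup>+x. f x \<partial>distr \<nu> borel (\<lambda>x. x + t))" by (simp add: inv)
    also have "\<dots> = (\<integral>\<^sup>+x. f (x + t) \<partial>\<nu>)" by (subst nn_integral_distr) auto
    finally show ?thesis ..
  qed
  have shift_leb: "(\<integral>\<^sup>+x. f (t + x) \<partial>lborel) = (\<integral>\<^sup>+x. f x \<partial>lborel)"
    if [measurable]: "f \<in> borel_measurable borel" for f :: "'a \<Rightarrow> ennreal" and t
  proof -
    have "(\<integral>\<^sup>+x. f x \<partial>lborel) = (\<integral>\<^sup>+x. f x \<partial>distr lborel borel ((+) t))"
      by (simp add: lborel_distr_plus)
    also have "\<dots> = (\<integral>\<^sup>+x. f (t + x) \<partial>lborel)" by (subst nn_integral_distr) auto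
    finally show ?thesis ..
  qed
  have "emeasure \<nu> A * emeasure lborel B
      = (\<integral>\<^sup>+y. (\<integral>\<^sup>+x. indicator A x \<partial>\<nu>) * indicator B y \<partial>lborel)"
    using \<open>A \<in> sets \<nu>\<close> by (simp add: nn_integral_cmult)
  also have "\<dots> = (\<integral>\<^sup>+y. (\<integral>\<^sup>+x. indicator A (x + y) \<partial>\<nu>) * indicator B y \<partial>lborel)"
    by (intro nn_integral_cong arg_cong2[where f="(*)"] refl shift_nu[symmetric]) auto
  also have "\<dots> = (\<integral>\<^sup>+y. (\<integral>\<^sup>+x. indicator A (x + y) * indicator B y \<partial>\<nu>) \<partial>lborel)"
    by (intro nn_integral_cong nn_integral_multc[symmetric]) measurable
  also have "\<dots> = (\<integral>\<^sup>+x. (\<integral>\<^sup>+y. indicator A (x + y) * indicator B y \<partial>lborel) \<partial>\<nu>)"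
    by (rule P.Fubini') measurable
  also have "\<dots> = (\<integral>\<^sup>+x. (\<integral>\<^sup>+y. indicator A y * indicator B (y - x) \<partial>lborel) \<partial>\<nu>)"
  proof (rule nn_integral_cong)
    fix x
    show "(\<integral>\<^sup>+y. indicator A (x + y) * indicator B y \<partial>lborel)
        = (\<integral>\<^sup>+y. indicator A y * indicator B (y - x) \<partial>(lborel :: 'a measure) :: ennreal)"
      using shift_leb[of "\<lambda>y. indicator A y * indicator B (y - x)" x] by simp
  qed
  also have "\<dots> = (\<integral>\<^sup>+y. (\<integral>\<^sup>+x. indicator A y * indicator B (y - x) \<partial>\<nu>) \<partial>lborel)"
    by (rule P.Fubini'[symmetric]) measurable
  also have "\<dots> = (\<integral>\<^sup>+y. indicator A y * emeasure \<nu> B \<partial>lborel)"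
  proof (rule nn_integral_cong)
    fix y
    have "(\<integral>\<^sup>+x. indicator B (y - x) \<partial>\<nu>) = (\<integral>\<^sup>+x. indicator B (y - (x + y)) \<partial>\<nu>)"
      by (rule shift_nu[symmetric]) measurable
    also have "\<dots> = (\<integral>\<^sup>+x. indicator B x \<partial>\<nu>)"
      by (intro nn_integral_cong) (auto simp: B_def indicator_def)
    also have "\<dots> = emeasure \<nu> B" by (simp add: sets_\<nu>)
    finally show "(\<integral>\<^sup>+x. indicator A y * indicator B (y - x) \<partial>\<nu>) = indicator A y * emeasure \<nu> B"
      by (subst nn_integral_cmult) auto
  qed
  also have "\<dots> = emeasure lborel A * emeasure \<nu> B"
    by (subst nn_integral_multc) auto
  finally have "emeasure \<nu> A * emeasure lborel B = emeasure lborel A * emeasure lborel B"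
    using ball by (simp add: B_def)
  moreover have "emeasure lborel B \<noteq> 0" "emeasure lborel B \<noteq> \<infinity>"
    unfolding B_def by (rule emeasure_lborel_unit_cball)+
  ultimately show "emeasure \<nu> A = emeasure lborel A"
    by (metis ennreal_mult_cancel_left infinity_ennreal_def mult.commute top.not_eq_extremum)
qed

lemma lborel_distr_orthogonal:
  fixes T :: "'a::euclidean_space \<Rightarrow> 'a"
  assumes T: "orthogonal_transformation T"
  shows "distr lborel borel T = lborel"
proof (rule translation_invariant_eq_lborel)
  have lin: "linear T" using T by (simp add: orthogonal_transformation_linear)
  have nrm: "norm (T x) = norm x" for x using T by (rule orthogonal_transformation_norm)
  have [measurable]: "T \<in> borel \<rightarrow>\<^sub>M borel"
    using lin by (intro borel_measurable_continuous_onI linear_continuous_on linear_linear[THEN iffD2])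
  have pre: "emeasure (distr lborel borel T) (cball 0 r) = emeasure lborel (cball (0::'a) r)" for r
    by (subst emeasure_distr) (auto intro!: arg_cong[where f="emeasure lborel"] simp: nrm)
  show "sets (distr lborel borel T) = sets borel" by simp
  show "emeasure (distr lborel borel T) (cball 0 1) = emeasure lborel (cball (0::'a) 1)" by (rule pre)
  show "sigma_finite_measure (distr lborel borel T)"
  proof
    have "(\<Union>n. cball (0::'a) (real n)) = UNIV"
      by (auto simp: real_arch_simple)
    then show "\<exists>A. countable A \<and> A \<subseteq> sets (distr lborel borel T) \<and>
      \<Union> A = space (distr lborel borel T) \<and> (\<forall>a\<in>A. emeasure (distr lborel borel T) a \<noteq> \<infinity>)"
      by (intro exI[of _ "range (\<lambda>n::nat. cball (0::'a) (real n))"]) (auto simp: pre emeasure_cball)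
  qed
  show "distr (distr lborel borel T) borel (\<lambda>x. x + t) = distr lborel borel T" for t
  proof -
    obtain s where s: "T s = t"
      using orthogonal_transformation_surj[OF T] by (metis surjD)
    have "distr (distr lborel borel T) borel (\<lambda>x. x + t) = distr lborel borel (\<lambda>x. T x + t)"
      by (subst distr_distr) (auto simp: o_def)
    also have "(\<lambda>x. T x + t) = T \<circ> ((+) s)"
      using s lin by (auto simp: linear_add fun_eq_iff)
    also have "distr lborel borel (T \<circ> (+) s) = distr (distr lborel borel ((+) s)) borel T"
      by (subst distr_distr) auto
    finally show ?thesis by (simp add: lborel_distr_plus)
  qed
qed

lemma sets_sphere_measure [simp, measurable_cong]: "sets sphere_measure = sets borel"
  by (simp add: sphere_measure_def)

lemma sgn_measurable [measurable]: "sgn \<in> borel \<rightarrow>\<^sub>M (borel :: 'a::euclidean_space measure)"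
  unfolding sgn_div_norm[abs_def] by measurable

lemma emeasure_sphere_measure_UNIV: "emeasure sphere_measure (UNIV :: 'a::euclidean_space set) = 1"
  unfolding sphere_measure_def
  using emeasure_lborel_unit_cball[where ?'a = 'a]
  by (subst emeasure_distr) (auto simp: less_top intro!: ennreal_divide_self)

lemma emeasure_sphere_measure_sphere:
  "emeasure sphere_measure (sphere (0::'a::euclidean_space) 1) = 1"
proof -
  have "emeasure lborel (cball 0 1 \<inter> sgn -` sphere (0::'a) 1) = emeasure lborel (cball (0::'a) 1 - {0})"
    by (intro arg_cong[where f="emeasure lborel"]) (auto simp: norm_sgn)
  also have "\<dots> = emeasure lborel (cball (0::'a) 1)"
    by (subst emeasure_Diff_null_set) auto
  finally have *: "emeasure lborel (cball 0 1 \<inter> sgn -` sphere (0::'a) 1) = emeasure lborel (cball (0::'a) 1)" .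
  have "sgn -` sphere (0::'a) 1 \<in> sets borel"
    by (rule measurable_sets_borel[OF sgn_measurable]) auto
  then show ?thesis
    unfolding sphere_measure_def using emeasure_lborel_unit_cball[where ?'a = 'a]
    by (subst emeasure_distr) (auto simp: * less_top intro!: ennreal_divide_self)
qed

lemma sphere_measure_rotation_invariant:
  fixes T :: "'a::euclidean_space \<Rightarrow> 'a"
  assumes T: "orthogonal_transformation T"
  shows "distr sphere_measure borel T = sphere_measure"
proof (rule measure_eqI)
  show "sets (distr sphere_measure borel T) = sets sphere_measure" by simp
next
  fix A assume "A \<in> sets (distr sphere_measure borel T)"
  hence A [measurable]: "A \<in> sets borel" by simp
  have lin: "linear T" using T by (simp add: orthogonal_transformation_linear)
  have nrm: "norm (T x) = norm x" for x using T by (rule orthogonal_transformation_norm)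
  have mT [measurable]: "T \<in> borel \<rightarrow>\<^sub>M borel"
    using lin by (intro borel_measurable_continuous_onI linear_continuous_on linear_linear[THEN iffD2])
  have Tsgn: "T (sgn x) = sgn (T x)" for x
    by (simp add: sgn_div_norm nrm linear_cmul[OF lin])
  have TA: "T -` A \<in> sets borel" using measurable_sets_borel[OF mT A] .
  have sA: "sgn -` A \<in> sets borel" "sgn -` T -` A \<in> sets borel"
    using measurable_sets_borel[OF sgn_measurable] A TA by blast+
  have "emeasure lborel (cball 0 1 \<inter> sgn -` T -` A) = emeasure lborel (T -` (cball 0 1 \<inter> sgn -` A))"
    by (intro arg_cong[where f="emeasure lborel"]) (auto simp: nrm Tsgn)
  also have "\<dots> = emeasure (distr lborel borel T) (cball 0 1 \<inter> sgn -` A)"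
    using sA by (subst emeasure_distr) auto
  also have "\<dots> = emeasure lborel (cball 0 1 \<inter> sgn -` A)"
    by (simp add: lborel_distr_orthogonal[OF T])
  finally show "emeasure (distr sphere_measure borel T) A = emeasure sphere_measure A"
    unfolding sphere_measure_def using sA TA
    by (simp add: emeasure_distr)
qed


subsection \<open>The length of a generalized path\<close>

definition slab :: "real \<Rightarrow> 'b::real_inner \<Rightarrow> real \<Rightarrow> int \<Rightarrow> 'b set" where
  "slab x u \<mu> j = {z. \<mu> * (of_int j + x) \<le> z \<bullet> u \<and> z \<bullet> u \<le> \<mu> * (of_int j + 1 + x)}"

definition width :: "'b::real_inner \<Rightarrow> 'b set \<Rightarrow> real" where
  "width u A = diameter ((\<lambda>z. z \<bullet> u) ` A)"

text \<open>
  No component of positive width can occur for two different values of \<open>j\<close>, as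
  distinct slabs meet at most in a hyperplane orthogonal to \<open>u\<close>; hence
  collecting the components in a set loses no multiplicities.
\<close>

definition pieces ::
    "'a::metric_space set \<Rightarrow> ('a \<Rightarrow> 'b::real_inner) \<Rightarrow> real \<Rightarrow> 'b \<Rightarrow> real \<Rightarrow> 'a set set" where
  "pieces X \<gamma> x u \<mu> =
     {C. \<exists>j. C \<in> components (X \<inter> \<gamma> -` slab x u \<mu> j) \<and> width u (\<gamma> ` C) > 0}"

text \<open>
  A finite (\<open>N < \<infinity>\<close>) or infinite (\<open>N = \<infinity>\<close>) list \<open>C 0, C 1, \<dots>\<close> enumerating
  the pieces without repetition in order of non-increasing width.
\<close>

definition sorted_enumeration ::
    "'a::metric_space set \<Rightarrow> ('a \<Rightarrow> 'b::real_inner) \<Rightarrow> real \<Rightarrow> 'b \<Rightarrow> real \<Rightarrow>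
     enat \<Rightarrow> (nat \<Rightarrow> 'a set) \<Rightarrow> bool" where
  "sorted_enumeration X \<gamma> x u \<mu> N C \<longleftrightarrow>
     bij_betw C {k. enat k < N} (pieces X \<gamma> x u \<mu>) \<and>
     (\<forall>k. enat (Suc k) < N \<longrightarrow> width u (\<gamma> ` C (Suc k)) \<le> width u (\<gamma> ` C k))"

text \<open>The value does not depend on which sorted enumeration is chosen.\<close>

definition weighted_width ::
    "'a::metric_space set \<Rightarrow> ('a \<Rightarrow> 'b::real_inner) \<Rightarrow> real \<Rightarrow> 'b \<Rightarrow> real \<Rightarrow> real" where
  "weighted_width X \<gamma> x u \<mu> =
     (let (N, C) = SOME (N, C). sorted_enumeration X \<gamma> x u \<mu> N C
      in \<Sum>k. if enat k < N then (1/2) ^ k * width u (\<gamma> ` C k) else 0)"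

text \<open>
  The length of \<open>\<gamma>\<close> restricted to \<open>X\<close>. The integrand is nonnegative, so the integrals are
  taken in the extended nonnegative reals.
\<close>

definition len :: "'a::metric_space set \<Rightarrow> ('a \<Rightarrow> 'b::euclidean_space) \<Rightarrow> ennreal" where
  "len X \<gamma> =
     (\<integral>\<^sup>+\<mu>\<in>{0<..1}. (\<integral>\<^sup>+u\<in>sphere 0 1. (\<integral>\<^sup>+x\<in>{0..1}.
        ennreal (weighted_width X \<gamma> x u \<mu>) \<partial>lborel) \<partial>sphere_measure) \<partial>lborel)"

end

(*
In a dendrite the intersection of two subcontinua is connected: otherwise arcs running close to
each of them would form a simple closed curve. Hence every piece of the path over a subcontinuum A
is the intersection of A with exactly one piece over X, which is at least as wide. Since the sorted
sum with weights 2^-k is the largest one over all injective enumerations, the integrand is monotone.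
If X = A Un B, a piece of X splits into its traces on A and B, whose widths add up to at least its
own, and subadditivity follows in the same way.

A component D of X - A has exactly one boundary point a. If the path is constant on all such D, the
pieces over A have the same images as those over X. If it takes a value at z in D different from
that at a, then for almost every direction u and all small mu some slab lies strictly between both
values, and it contributes a piece inside D; an additional piece strictly increases the integrand.
*)
theory Submission
  imports Defs
begin

subsection \<open>Arcs in locally connected compact metric spaces\<close>

lemma connected_imp_chain:
  fixes K :: "'a::metric_space set"
  assumes "connected K" "a \<in> K" "b \<in> K" "\<delta> > 0"
  obtains d m where "d 0 = a" "\<And>i. i \<ge> m \<Longrightarrow> d i = b" "\<And>i. d i \<in> K"
    "\<And>i. dist (d i) (d (Suc i)) < \<delta>"
proof -
  define r where "r = {(s,t). s \<in> K \<and> t \<in> K \<and> dist s t < \<delta>}"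
  have symr: "sym r" unfolding r_def sym_def by (auto simp: dist_commute)
  have "(a, b) \<in> r\<^sup>*"
  proof (rule connected_equivalence_relation[OF \<open>connected K\<close> \<open>a \<in> K\<close> \<open>b \<in> K\<close>])
    show "(x, y) \<in> r\<^sup>* \<Longrightarrow> (y, x) \<in> r\<^sup>*" for x y
      using symr by (meson sym_rtrancl symD)
    show "(x, y) \<in> r\<^sup>* \<Longrightarrow> (y, z) \<in> r\<^sup>* \<Longrightarrow> (x, z) \<in> r\<^sup>*" for x y z
      by (rule rtrancl_trans)
    fix s assume "s \<in> K"
    show "\<exists>T. openin (top_of_set K) T \<and> s \<in> T \<and> (\<forall>x\<in>T. (s, x) \<in> r\<^sup>*)"
    proof (intro exI conjI ballI)
      show "openin (top_of_set K) (K \<inter> ball s \<delta>)" by (simp add: openin_open_Int)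
      show "s \<in> K \<inter> ball s \<delta>" using \<open>s \<in> K\<close> \<open>\<delta> > 0\<close> by simp
      show "(s, x) \<in> r\<^sup>*" if "x \<in> K \<inter> ball s \<delta>" for x
        using that \<open>s \<in> K\<close> by (intro r_into_rtrancl) (simp add: r_def)
    qed
  qed
  then obtain m f where f: "f 0 = a" "f m = b" "\<forall>i<m. (f i, f (Suc i)) \<in> r"
    by (metis rtrancl_imp_relpow relpow_fun_conv)
  show ?thesis
  proof (rule that[of "\<lambda>i. if i \<le> m then f i else b" m])
    show "(if i \<le> m then f i else b) \<in> K" for i
    proof (cases "i < m")
      case True thus ?thesis using f(3) unfolding r_def by auto
    next
      case False thus ?thesis using f(2) \<open>b \<in> K\<close> by (auto simp: not_less)
    qed
    show "dist (if i \<le> m then f i else b) (if Suc i \<le> m then f (Suc i) else b) < \<delta>" for i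
    proof (cases "i < m")
      case True thus ?thesis using f(3) unfolding r_def by auto
    next
      case False thus ?thesis using f(2) \<open>\<delta> > 0\<close> by auto
    qed
  qed (use f in auto)
qed

lemma compact_locally_connected_uniform:
  fixes X :: "'a::metric_space set"
  assumes X: "compact X" "locally connected X" and e: "\<epsilon> > 0"
  obtains \<delta> where "\<delta> > 0"
    "\<And>a b. a \<in> X \<Longrightarrow> b \<in> X \<Longrightarrow> dist a b < \<delta> \<Longrightarrow>
       \<exists>K. connected K \<and> K \<subseteq> X \<and> a \<in> K \<and> b \<in> K \<and> K \<subseteq> ball a \<epsilon>"
proof -
  define G where "G = {T. open T \<and> (\<exists>K. connected K \<and> K \<subseteq> X \<and> X \<inter> T \<subseteq> K \<and> (\<forall>s\<in>K. \<forall>t\<in>K. dist s t < \<epsilon>))}"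
  have cov: "X \<subseteq> \<Union>G"
  proof
    fix x assume x: "x \<in> X"
    have "openin (top_of_set X) (X \<inter> ball x (\<epsilon>/2))" "x \<in> X \<inter> ball x (\<epsilon>/2)"
      using x e by (auto simp: openin_open_Int)
    then obtain U where U: "openin (top_of_set X) U" "connected U" "x \<in> U" "U \<subseteq> X \<inter> ball x (\<epsilon>/2)"
      using X(2) unfolding locally_connected by meson
    then obtain T where T: "open T" "U = X \<inter> T" by (auto simp: openin_open)
    have "dist s t < \<epsilon>" if "s \<in> U" "t \<in> U" for s t
    proof -
      have "dist x s < \<epsilon>/2" "dist x t < \<epsilon>/2" using that U(4) by auto
      thus ?thesis by metric
    qed
    hence "T \<in> G" unfolding G_def using T U by blast
    thus "x \<in> \<Union>G" using T U by blast
  qed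
  obtain \<delta> where d: "\<delta> > 0" "\<And>x. x \<in> X \<Longrightarrow> \<exists>T\<in>G. ball x \<delta> \<subseteq> T"
    by (rule Heine_Borel_lemma[OF X(1) cov]) (auto simp: G_def)
  show ?thesis
  proof (rule that[OF d(1)])
    fix a b assume ab: "a \<in> X" "b \<in> X" "dist a b < \<delta>"
    obtain T where T: "T \<in> G" "ball a \<delta> \<subseteq> T" using d(2) ab by blast
    then obtain K where K: "connected K" "K \<subseteq> X" "X \<inter> T \<subseteq> K" "\<forall>s\<in>K. \<forall>t\<in>K. dist s t < \<epsilon>"
      unfolding G_def by blast
    have "a \<in> K" "b \<in> K" using ab T K d(1) by (auto simp: subset_iff)
    thus "\<exists>K. connected K \<and> K \<subseteq> X \<and> a \<in> K \<and> b \<in> K \<and> K \<subseteq> ball a \<epsilon>"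
      using K by (intro exI[of _ K]) auto
  qed
qed

text \<open>One refinement step: \<open>c\<close> lists the values of a step function on a grid of mesh \<open>1/N\<close>;
  every step is replaced by \<open>M\<close> smaller ones.\<close>

lemma chain_refinement:
  fixes X :: "'a::metric_space set"
  assumes uc: "\<And>a b. a \<in> X \<Longrightarrow> b \<in> X \<Longrightarrow> dist a b < \<delta> \<Longrightarrow>
       \<exists>K. connected K \<and> K \<subseteq> X \<and> a \<in> K \<and> b \<in> K \<and> K \<subseteq> ball a \<epsilon>"
    and c: "\<And>i. c i \<in> X" "\<And>i. i \<ge> N \<Longrightarrow> c i = y" "\<And>i. dist (c i) (c (Suc i)) < \<delta>"
    and d': "\<delta>' > 0"
  obtains M c' where "M > 0" "c' 0 = c 0" "\<And>i. c' i \<in> X" "\<And>i. i \<ge> N * M \<Longrightarrow> c' i = y"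
    "\<And>i. dist (c' i) (c' (Suc i)) < \<delta>'" "\<And>k. dist (c' k) (c (k div M)) < \<epsilon>"
proof -
  have "\<exists>d m. d 0 = c i \<and> (\<forall>j\<ge>m. d j = c (Suc i)) \<and> (\<forall>j. d j \<in> X \<inter> ball (c i) \<epsilon>) \<and>
      (\<forall>j. dist (d j) (d (Suc j)) < \<delta>')" for i
  proof -
    obtain K where K: "connected K" "K \<subseteq> X" "c i \<in> K" "c (Suc i) \<in> K" "K \<subseteq> ball (c i) \<epsilon>"
      using uc[OF c(1) c(1) c(3)] by blast
    show ?thesis
      by (rule connected_imp_chain[OF K(1,3,4) d']) (use K in blast)
  qed
  then obtain d m where dm: "\<And>i. d i 0 = c i" "\<And>i j. j \<ge> m i \<Longrightarrow> d i j = c (Suc i)"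
    "\<And>i j. d i j \<in> X \<inter> ball (c i) \<epsilon>" "\<And>i j. dist (d i j) (d i (Suc j)) < \<delta>'" by metis
  have e: "\<epsilon> > 0" using dm(3)[of 0 0] by (auto simp: dm(1))
  define D where "D i j = (if i < N then d i j else y)" for i j
  define M where "M = Suc (Max (insert 0 (m ` {..<N})))"
  have M: "m i \<le> M" if "i < N" for i
  proof -
    have "m i \<le> Max (insert 0 (m ` {..<N}))" using that by (intro Max_ge) auto
    thus ?thesis by (simp add: M_def)
  qed
  have D0: "D i 0 = c i" for i using dm(1) c(2) by (simp add: D_def)
  have DM: "D i M = c (Suc i)" for i using dm(2) M c(2) by (simp add: D_def)
  have DX: "D i j \<in> X" for i j using dm(3) c(1)[of N] c(2)[of N] by (auto simp: D_def)
  have Db: "dist (D i j) (c i) < \<epsilon>" for i j using dm(3)[of i j] c(2) e by (auto simp: D_def dist_commute)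
  have Dd: "dist (D i j) (D i (Suc j)) < \<delta>'" for i j using dm(4) d' by (auto simp: D_def)
  show ?thesis
  proof (rule that[of M "\<lambda>k. D (k div M) (k mod M)"])
    show M0: "M > 0" by (simp add: M_def)
    show "D (0 div M) (0 mod M) = c 0" by (simp add: D0)
    show "D (i div M) (i mod M) \<in> X" for i by (rule DX)
    show "D (i div M) (i mod M) = y" if "i \<ge> N * M" for i
    proof -
      have "i div M \<ge> N" using that M0 by (simp add: less_eq_div_iff_mult_less_eq)
      thus ?thesis by (simp add: D_def)
    qed
    show "dist (D (k div M) (k mod M)) (c (k div M)) < \<epsilon>" for k by (rule Db)
    show "dist (D (i div M) (i mod M)) (D (Suc i div M) (Suc i mod M)) < \<delta>'" for i
    proof (cases "Suc (i mod M) = M")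
      case True
      hence "Suc i mod M = 0" "Suc i div M = Suc (i div M)" by (auto simp: mod_Suc div_Suc)
      thus ?thesis using Dd[of "i div M" "i mod M"] True by (simp add: D0 DM)
    next
      case False
      hence "Suc i mod M = Suc (i mod M)" "Suc i div M = i div M" by (auto simp: mod_Suc div_Suc)
      thus ?thesis using Dd[of "i div M" "i mod M"] by simp
    qed
  qed
qed

lemma compact_locally_connected_small_path:
  fixes X :: "'a::metric_space set"
  assumes X: "compact X" "locally connected X" and e: "\<epsilon> > 0"
  obtains \<delta> where "\<delta> > 0"
    "\<And>a b. a \<in> X \<Longrightarrow> b \<in> X \<Longrightarrow> dist a b < \<delta> \<Longrightarrow>
       \<exists>g. path g \<and> path_image g \<subseteq> X \<inter> ball a \<epsilon> \<and> pathstart g = a \<and> pathfinish g = b"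
proof -
  define E where "E n = \<epsilon> / 4 * (1/2)^n" for n :: nat
  have E0: "E n > 0" for n using e by (simp add: E_def)
  have E_Suc: "2 * E (Suc n) = E n" for n by (simp add: E_def)
  have "\<exists>\<delta>>0. \<delta> \<le> E n \<and> (\<forall>a b. a \<in> X \<longrightarrow> b \<in> X \<longrightarrow> dist a b < \<delta> \<longrightarrow>
       (\<exists>K. connected K \<and> K \<subseteq> X \<and> a \<in> K \<and> b \<in> K \<and> K \<subseteq> ball a (E n)))" for n
  proof -
    obtain d where "d > 0" "\<And>a b. a \<in> X \<Longrightarrow> b \<in> X \<Longrightarrow> dist a b < d \<Longrightarrow>
       \<exists>K. connected K \<and> K \<subseteq> X \<and> a \<in> K \<and> b \<in> K \<and> K \<subseteq> ball a (E n)"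
      using compact_locally_connected_uniform[OF X E0[of n]] by metis
    thus ?thesis using E0[of n] by (intro exI[of _ "min d (E n)"]) auto
  qed
  then obtain \<delta> where d: "\<And>n. \<delta> n > 0" "\<And>n. \<delta> n \<le> E n"
     "\<And>n a b. a \<in> X \<Longrightarrow> b \<in> X \<Longrightarrow> dist a b < \<delta> n \<Longrightarrow>
       \<exists>K. connected K \<and> K \<subseteq> X \<and> a \<in> K \<and> b \<in> K \<and> K \<subseteq> ball a (E n)" by metis
  show ?thesis
  proof (rule that[of "\<delta> 0"])
    show "\<delta> 0 > 0" by (rule d)
    fix a b assume ab: "a \<in> X" "b \<in> X" "dist a b < \<delta> 0"
    define P where "P n s \<longleftrightarrow> (case s of (N::nat, c::nat \<Rightarrow> 'a) \<Rightarrow> N > 0 \<and> c 0 = a \<and> (\<forall>i. c i \<in> X) \<and>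
        (\<forall>i\<ge>N. c i = b) \<and> (\<forall>i. dist (c i) (c (Suc i)) < \<delta> n) \<and> (n = 0 \<longrightarrow> range c \<subseteq> {a,b}))" for n s
    define Q where "Q n s s' \<longleftrightarrow> (case (s, s') of ((N::nat, c::nat \<Rightarrow> 'a), (N'::nat, c'::nat \<Rightarrow> 'a)) \<Rightarrow>
        (\<exists>M. N' = N * M \<and> M > 0 \<and> (\<forall>k. dist (c' k) (c (k div M)) < E n)))" for n s s'
    have "\<exists>f. \<forall>n. P n (f n) \<and> Q n (f n) (f (Suc n))"
    proof (rule dependent_nat_choice)
      show "\<exists>s. P 0 s"
        using ab d(1)[of 0]
        by (intro exI[of _ "(1, \<lambda>i. if i = 0 then a else b)"]) (auto simp: P_def)
      fix s n assume "P n s"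
      then obtain N c where s: "s = (N, c)" and *: "N > 0" "c 0 = a" "\<And>i. c i \<in> X"
        "\<And>i. i \<ge> N \<Longrightarrow> c i = b" "\<And>i. dist (c i) (c (Suc i)) < \<delta> n"
        by (cases s) (auto simp: P_def)
      show "\<exists>s'. P (Suc n) s' \<and> Q n s s'"
      proof (rule chain_refinement[of X "\<delta> n" "E n" c N b "\<delta> (Suc n)"])
        fix M c'
        assume "M > 0" "c' 0 = c 0" "\<And>i. c' i \<in> X" "\<And>i. i \<ge> N * M \<Longrightarrow> c' i = b"
          "\<And>i. dist (c' i) (c' (Suc i)) < \<delta> (Suc n)" "\<And>k. dist (c' k) (c (k div M)) < E n"
        thus "\<exists>s'. P (Suc n) s' \<and> Q n s s'" using * s
          by (intro exI[of _ "(N * M, c')"]) (auto simp: P_def Q_def)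
      qed (use * d in blast)+
    qed
    then obtain f where f: "\<And>n. P n (f n)" "\<And>n. Q n (f n) (f (Suc n))" by blast
    define N where "N n = fst (f n)" for n
    define c where "c n = snd (f n)" for n
    have Nc: "N n > 0" "c n 0 = a" "c n i \<in> X" "i \<ge> N n \<Longrightarrow> c n i = b"
      "dist (c n i) (c n (Suc i)) < \<delta> n" for n i
      using f(1)[of n] by (auto simp: P_def N_def c_def split: prod.splits)
    have c00: "range (c 0) \<subseteq> {a, b}"
      using f(1)[of 0] by (auto simp: P_def N_def c_def split: prod.splits)
    have ref: "\<exists>M. N (Suc n) = N n * M \<and> M > 0 \<and> (\<forall>k. dist (c (Suc n) k) (c n (k div M)) < E n)" for n
      using f(2)[of n] by (auto simp: Q_def N_def c_def split: prod.splits)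
    define h where "h n t = c n (nat \<lfloor>t * N n\<rfloor>)" for n and t :: real
    have hX: "h n t \<in> X" for n t by (simp add: h_def Nc)
    have step: "dist (h (Suc n) t) (h n t) < E n" for n t
    proof -
      obtain M where M: "N (Suc n) = N n * M" "M > 0" "\<And>k. dist (c (Suc n) k) (c n (k div M)) < E n"
        using ref by blast
      have "\<lfloor>t * N n\<rfloor> = \<lfloor>t * N (Suc n)\<rfloor> div int M"
        using M floor_divide_real_eq_div[of "int M" "t * N (Suc n)"] by (simp add: mult.assoc[symmetric])
      hence "nat \<lfloor>t * N n\<rfloor> = nat \<lfloor>t * N (Suc n)\<rfloor> div M"
        using M(2) by (metis nat_div_as_int nat_div_distrib' nat_int zdiv_int of_nat_0_le_iff) 
      thus ?thesis using M(3) by (simp add: h_def)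
    qed
    have far: "dist (h (n + m) t) (h n t) \<le> 2 * E n - 2 * E (n + m)" for n m t
    proof (induction m)
      case (Suc m)
      have "dist (h (n + Suc m) t) (h n t) \<le> dist (h (Suc (n+m)) t) (h (n+m) t) + dist (h (n+m) t) (h n t)"
        by (simp add: dist_triangle)
      thus ?case using Suc step[of "n+m" t] E_Suc[of "n+m"] by simp
    qed simp
    have Elim: "(\<lambda>n. 2 * E n) \<longlonglongrightarrow> 0"
    proof -
      have "(\<lambda>n. 2 * (\<epsilon> / 4 * (1/2)^n)) \<longlonglongrightarrow> 2 * (\<epsilon>/4 * 0)"
        by (intro tendsto_intros LIMSEQ_power_zero) simp
      thus ?thesis by (simp add: E_def)
    qed
    have "\<exists>l\<in>X. (\<lambda>n. h n t) \<longlonglongrightarrow> l" for t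
    proof -
      have "Cauchy (\<lambda>n. h n t)"
      proof (rule metric_CauchyI)
        fix e :: real assume "e > 0"
        then obtain n where n: "2 * E n < e / 2"
          using order_tendstoD(2)[OF Elim, of "e/2"] by (auto simp: eventually_sequentially)
        have "dist (h k t) (h n t) < e / 2" if "k \<ge> n" for k
          using far[of n "k - n" t] that n E0[of k] by simp
        hence "dist (h k t) (h l t) < e" if "k \<ge> n" "l \<ge> n" for k l
          using that by (metis dist_triangle_half_l)
        thus "\<exists>M. \<forall>m\<ge>M. \<forall>n\<ge>M. dist (h m t) (h n t) < e" by blast
      qed
      from completeE[OF compact_imp_complete[OF X(1)] _ this] hX show ?thesis by metis
    qed
    then obtain g where g: "\<And>t. g t \<in> X" "\<And>t. (\<lambda>n. h n t) \<longlonglongrightarrow> g t" by metis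
    have close: "dist (g t) (h n t) \<le> 2 * E n" for n t
    proof (rule tendsto_upperbound)
      show "(\<lambda>m. dist (h m t) (h n t)) \<longlonglongrightarrow> dist (g t) (h n t)" by (intro tendsto_intros g)
      show "\<forall>\<^sub>F m in sequentially. dist (h m t) (h n t) \<le> 2 * E n"
        unfolding eventually_sequentially
      proof (intro exI[of _ n] allI impI)
        fix m assume "n \<le> m"
        thus "dist (h m t) (h n t) \<le> 2 * E n" using far[of n "m - n" t] E0[of m] by simp
      qed
    qed simp
    have hs: "dist (h n s) (h n t) \<le> E n" if "\<bar>s - t\<bar> * N n < 1" for n and s t :: real
    proof -
      have *: "dist (h n s) (h n t) \<le> E n" if "s \<le> t" "(t - s) * N n < 1" for s t :: real
      proof -
        have "s * N n \<le> t * N n" using that by (simp add: mult_right_mono)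
        hence a: "\<lfloor>s * N n\<rfloor> \<le> \<lfloor>t * N n\<rfloor>" by (rule floor_mono)
        have "t * N n < s * N n + 1" using that by (simp add: algebra_simps)
        hence b: "\<lfloor>t * N n\<rfloor> \<le> \<lfloor>s * N n\<rfloor> + 1" by linarith
        have "nat \<lfloor>t * N n\<rfloor> = nat \<lfloor>s * N n\<rfloor> \<or> nat \<lfloor>t * N n\<rfloor> = Suc (nat \<lfloor>s * N n\<rfloor>)"
          using a b by linarith
        thus ?thesis using Nc(5)[of n "nat \<lfloor>s * N n\<rfloor>"] d(2)[of n] E0[of n] by (auto simp: h_def)
      qed
      show ?thesis using *[of s t] *[of t s] that by (cases "s \<le> t") (auto simp: dist_commute)
    qed
    have "continuous_on UNIV g"
      unfolding continuous_on_iff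
    proof (intro ballI allI impI)
      fix t e :: real assume "e > 0"
      then obtain n where n: "2 * E n < e / 3"
        using order_tendstoD(2)[OF Elim, of "e/3"] by (auto simp: eventually_sequentially)
      show "\<exists>d>0. \<forall>s\<in>UNIV. dist s t < d \<longrightarrow> dist (g s) (g t) < e"
      proof (intro exI conjI ballI impI)
        show "1 / real (N n) > 0" using Nc(1) by simp
        fix s assume "dist s t < 1 / real (N n)"
        hence "\<bar>s - t\<bar> * N n < 1" using Nc(1)[of n] by (simp add: dist_real_def field_simps)
        hence "dist (h n s) (h n t) \<le> E n" by (rule hs)
        moreover have "dist (g s) (g t) \<le> dist (g s) (h n s) + dist (h n s) (h n t) + dist (g t) (h n t)"
          using dist_triangle[of "g s" "g t" "h n s"] dist_triangle[of "h n s" "g t" "h n t"]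
          by (simp add: dist_commute)
        ultimately show "dist (g s) (g t) < e" using close[of s n] close[of t n] n E0[of n] by linarith
      qed
    qed
    moreover have "g 0 = a"
    proof (rule LIMSEQ_unique)
      show "(\<lambda>n. h n 0) \<longlonglongrightarrow> g 0" by (rule g)
      show "(\<lambda>n. h n 0) \<longlonglongrightarrow> a" by (simp add: h_def Nc)
    qed
    moreover have "g 1 = b"
    proof (rule LIMSEQ_unique)
      show "(\<lambda>n. h n 1) \<longlonglongrightarrow> g 1" by (rule g)
      show "(\<lambda>n. h n 1) \<longlonglongrightarrow> b" by (simp add: h_def Nc)
    qed
    moreover have "dist a (g t) < \<epsilon>" for t
    proof -
      have "h 0 t \<in> {a, b}" using c00 by (auto simp: h_def)
      hence "dist a (h 0 t) \<le> E 0" using ab(3) d(2)[of 0] E0[of 0] by auto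
      moreover have "dist a (g t) \<le> dist a (h 0 t) + dist (g t) (h 0 t)"
        using dist_triangle[of a "g t" "h 0 t"] by (simp add: dist_commute)
      ultimately show ?thesis using close[of t 0] e by (simp add: E_def)
    qed
    ultimately show "\<exists>g. path g \<and> path_image g \<subseteq> X \<inter> ball a \<epsilon> \<and> pathstart g = a \<and> pathfinish g = b"
      using g(1) by (intro exI[of _ g])
        (auto simp: path_def path_image_def pathstart_def pathfinish_def intro: continuous_on_subset)
  qed
qed

lemma locally_connected_open_imp_path_connected:
  fixes X :: "'a::metric_space set"
  assumes X: "compact X" "locally connected X"
    and V: "openin (top_of_set X) V" "connected V"
  shows "path_connected V"
  unfolding path_connected_component
proof (intro ballI)
  fix p q assume pq: "p \<in> V" "q \<in> V"
  show "path_component V p q"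
  proof (rule connected_equivalence_relation[OF V(2) pq])
    fix a assume a: "a \<in> V"
    obtain e where e: "e > 0" "ball a e \<inter> X \<subseteq> V"
      using V(1) a by (meson openin_contains_ball)
    obtain \<delta> where d: "\<delta> > 0" "\<And>a b. a \<in> X \<Longrightarrow> b \<in> X \<Longrightarrow> dist a b < \<delta> \<Longrightarrow>
       \<exists>g. path g \<and> path_image g \<subseteq> X \<inter> ball a e \<and> pathstart g = a \<and> pathfinish g = b"
      using compact_locally_connected_small_path[OF X e(1)] by metis
    have VX: "V \<subseteq> X" using V(1) by (rule openin_imp_subset)
    show "\<exists>T. openin (top_of_set V) T \<and> a \<in> T \<and> (\<forall>x\<in>T. path_component V a x)"
    proof (intro exI conjI ballI)
      show "openin (top_of_set V) (V \<inter> ball a \<delta>)" by (simp add: openin_open_Int)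
      show "a \<in> V \<inter> ball a \<delta>" using a d(1) by simp
      fix x assume "x \<in> V \<inter> ball a \<delta>"
      then obtain g where "path g" "path_image g \<subseteq> X \<inter> ball a e" "pathstart g = a" "pathfinish g = x"
        using d(2)[OF subsetD[OF VX a] subsetD[OF VX IntD1]] by (metis IntD2 mem_ball)
      thus "path_component V a x" unfolding path_component_def using e(2) by blast
    qed
  qed (auto intro: path_component_sym path_component_trans)
qed

text \<open>The Kuratowski embedding; it carries the library theorem \<open>path_contains_arc\<close> from Banach spaces
  over to metric spaces.\<close>

lemma isometric_embedding_bcontfun:
  obtains e :: "'a::metric_space \<Rightarrow> ('a \<Rightarrow>\<^sub>C real)" where "\<And>x y. dist (e x) (e y) = dist x y"
proof -
  fix o' :: 'a
  define k where "k x y = dist x y - dist o' y" for x y :: 'a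
  have bc: "k x \<in> bcontfun" for x
  proof -
    have "\<bar>k x y\<bar> \<le> dist x o'" for y
      unfolding k_def using dist_triangle[of x y o'] dist_triangle[of o' y x] by (auto simp: dist_commute)
    hence "bounded (range (k x))" by (auto intro!: boundedI[of _ "dist x o'"])
    moreover have "continuous_on UNIV (k x)" unfolding k_def by (intro continuous_intros)
    ultimately show ?thesis by (simp add: bcontfun_def)
  qed
  have ap: "apply_bcontfun (Bcontfun (k x)) = k x" for x by (simp add: Bcontfun_inverse bc)
  show ?thesis
  proof (rule that[of "\<lambda>x. Bcontfun (k x)"])
    fix x y
    show "dist (Bcontfun (k x)) (Bcontfun (k y)) = dist x y"
    proof (rule antisym)
      show "dist (Bcontfun (k x)) (Bcontfun (k y)) \<le> dist x y"
      proof (rule dist_bound)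
        fix z show "dist (apply_bcontfun (Bcontfun (k x)) z) (apply_bcontfun (Bcontfun (k y)) z) \<le> dist x y"
          unfolding ap k_def dist_real_def
          using dist_triangle[of x z y] dist_triangle[of y z x] by (auto simp: dist_commute)
      qed
      have "dist x y = dist (apply_bcontfun (Bcontfun (k x)) y) (apply_bcontfun (Bcontfun (k y)) y)"
        unfolding ap k_def dist_real_def by simp
      thus "dist x y \<le> dist (Bcontfun (k x)) (Bcontfun (k y))" using dist_bounded by metis
    qed
  qed
qed

lemma path_contains_arc_metric:
  fixes p :: "real \<Rightarrow> 'a::metric_space"
  assumes "path p" "pathstart p \<noteq> pathfinish p"
  obtains q where "arc q" "path_image q \<subseteq> path_image p"
    "pathstart q = pathstart p" "pathfinish q = pathfinish p"
proof -
  obtain e :: "'a \<Rightarrow> ('a \<Rightarrow>\<^sub>C real)" where e: "\<And>x y. dist (e x) (e y) = dist x y"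
    using isometric_embedding_bcontfun by blast
  have inj: "inj e" by (rule injI) (metis e dist_eq_0_iff)
  have ce: "continuous_on S e" for S by (auto simp: continuous_on_iff e)
  have ci: "continuous_on (e ` S) (inv e)" for S
    by (auto simp: continuous_on_iff e inv_f_f[OF inj])
  have "path (e \<circ> p)" using assms ce by (intro path_continuous_image) auto
  moreover have "pathstart (e \<circ> p) = e (pathstart p)" "pathfinish (e \<circ> p) = e (pathfinish p)"
    by (auto simp: pathstart_compose pathfinish_compose)
  moreover have "e (pathstart p) \<noteq> e (pathfinish p)" using assms(2) inj by (meson injD)
  ultimately obtain q where q: "arc q" "path_image q \<subseteq> path_image (e \<circ> p)"
    "pathstart q = e (pathstart p)" "pathfinish q = e (pathfinish p)"
    using path_contains_arc[of "e \<circ> p" "e (pathstart p)" "e (pathfinish p)"] by metis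
  have sub: "path_image q \<subseteq> e ` path_image p" using q(2) by (simp add: path_image_compose)
  show ?thesis
  proof (rule that[of "inv e \<circ> q"])
    have c: "continuous_on (path_image q) (inv e)" using ci sub continuous_on_subset by blast
    have "inj_on (inv e) (path_image q)"
      using sub by (metis (no_types, lifting) image_mono inj_on_inv_into inj_on_subset subset_UNIV)
    thus "arc (inv e \<circ> q)" using q(1) c unfolding arc_def
      by (auto simp: path_image_def intro!: comp_inj_on path_continuous_image)
    show "path_image (inv e \<circ> q) \<subseteq> path_image p"
      using sub by (auto simp: path_image_compose inv_f_f[OF inj])
  qed (auto simp: pathstart_compose pathfinish_compose q inv_f_f[OF inj])
qed


subsection \<open>Dendrites are hereditarily unicoherent\<close>

lemma dendriteD:
  assumes "dendrite X"
  shows "X \<noteq> {}" "compact X" "closed X" "connected X" "locally connected X"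
    "\<And>S. S \<subseteq> X \<Longrightarrow> \<not> simple_closed_curve S"
  using assms by (auto simp: dendrite_def continuum_def compact_imp_closed)

lemma subcontinuumD:
  assumes "subcontinuum A X"
  shows "A \<subseteq> X" "A \<noteq> {}" "compact A" "closed A" "connected A"
  using assms by (auto simp: subcontinuum_def continuum_def compact_imp_closed)

lemma arc_in_open_connected:
  fixes X :: "'a::metric_space set"
  assumes X: "compact X" "locally connected X"
    and V: "openin (top_of_set X) V" "connected V" and pq: "p \<in> V" "q \<in> V" "p \<noteq> q"
  obtains g where "arc g" "path_image g \<subseteq> V" "pathstart g = p" "pathfinish g = q"
proof -
  have "path_connected V" by (rule locally_connected_open_imp_path_connected[OF X V])
  then obtain h where h: "path h" "path_image h \<subseteq> V" "pathstart h = p" "pathfinish h = q"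
    using pq unfolding path_connected_def by blast
  obtain g where "arc g" "path_image g \<subseteq> path_image h" "pathstart g = pathstart h" "pathfinish g = pathfinish h"
    by (rule path_contains_arc_metric[of h]) (use h pq in auto)
  thus ?thesis using that[of g] h by auto
qed

lemma connected_open_neighbourhood:
  fixes X :: "'a::metric_space set"
  assumes "locally connected X" "A \<subseteq> X" "connected A" "A \<noteq> {}" "e > 0"
  obtains U where "openin (top_of_set X) U" "connected U" "A \<subseteq> U" "\<And>x. x \<in> U \<Longrightarrow> infdist x A < e"
proof -
  define W where "W = X \<inter> {x. infdist x A < e}"
  have "open {x. infdist x A < e}"
    by (intro open_Collect_less continuous_intros)
  hence W: "openin (top_of_set X) W" unfolding W_def by (simp add: openin_open_Int)
  obtain a where a: "a \<in> A" using assms(4) by blast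
  have AW: "A \<subseteq> W" using assms by (auto simp: W_def)
  show ?thesis
  proof (rule that[of "connected_component_set W a"])
    show "openin (top_of_set X) (connected_component_set W a)"
      by (rule locally_connected_2[OF assms(1) W]) (use a AW in blast)
    show "A \<subseteq> connected_component_set W a"
      by (rule connected_component_maximal[OF a assms(3) AW])
    show "infdist x A < e" if "x \<in> connected_component_set W a" for x
      using that connected_component_subset[of W a] by (auto simp: W_def)
  qed simp
qed

lemma arc_linepath_reparam:
  assumes g: "arc g" and st: "s \<in> {0..1}" "t \<in> {0..1}" "s \<noteq> t"
  shows "arc (g \<circ> linepath s t)" "path_image (g \<circ> linepath s t) \<subseteq> path_image g"
proof -
  have *: "linepath s t ` {0..1} \<subseteq> {0..1}"
    using st by (auto simp: linepath_image_01 closed_segment_eq_real_ivl)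
  have "continuous_on {0..1} g" "inj_on g {0..1}" using g by (auto simp: arc_def path_def)
  moreover have "inj_on (linepath s t) {0..1}"
    using st(3) arc_imp_inj_on arc_linepath by blast
  ultimately show "arc (g \<circ> linepath s t)"
    using * unfolding arc_def path_def
    by (intro conjI continuous_on_compose comp_inj_on)
       (auto intro: continuous_on_subset inj_on_subset continuous_on_linepath)
  show "path_image (g \<circ> linepath s t) \<subseteq> path_image g"
    using * by (auto simp: path_image_def image_comp[symmetric])
qed

text \<open>The curve follows \<open>\<alpha>\<close> from its last point in \<open>P\<close> on \<open>\<beta>\<close> to its next point on \<open>\<beta>\<close> and returns
  along \<open>\<beta>\<close>.\<close>

lemma simple_closed_curve_in_two_arcs:
  fixes \<alpha> \<beta> :: "real \<Rightarrow> 'a::metric_space"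
  assumes arcs: "arc \<alpha>" "arc \<beta>"
    and ends: "pathstart \<alpha> \<in> path_image \<beta>" "pathfinish \<alpha> \<in> path_image \<beta>"
    and PQ: "open P" "open Q" "P \<inter> Q = {}" "pathstart \<alpha> \<in> P" "pathfinish \<alpha> \<in> Q"
    and meet: "path_image \<alpha> \<inter> path_image \<beta> \<subseteq> P \<union> Q"
  obtains S where "simple_closed_curve S" "S \<subseteq> path_image \<alpha> \<union> path_image \<beta>"
proof -
  define K where "K = path_image \<beta>"
  have K: "closed K" unfolding K_def using arcs by (simp add: closed_path_image arc_imp_path)
  have ca: "continuous_on {0..1} \<alpha>" using arcs by (simp add: arc_def path_def)
  have inj: "inj_on \<alpha> {0..1}" using arcs by (simp add: arc_def)
  have PQK: "\<alpha> t \<in> K \<Longrightarrow> t \<in> {0..1} \<Longrightarrow> \<alpha> t \<in> P \<longleftrightarrow> \<alpha> t \<notin> Q" for t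
    using meet PQ(3) unfolding K_def path_image_def by blast
  define TP where "TP = {0..1} \<inter> \<alpha> -` (K - Q)"
  have TPc: "closed TP" unfolding TP_def
    by (intro continuous_closed_preimage ca) (auto intro: closed_Diff K PQ)
  have TPb: "bdd_above TP" by (rule bdd_above.I[of _ 1]) (auto simp: TP_def)
  have T0: "0 \<in> TP" using ends PQ by (auto simp: TP_def K_def pathstart_def)
  define s0 where "s0 = Sup TP"
  have s0: "s0 \<in> TP" unfolding s0_def using TPc TPb T0 closed_contains_Sup by blast
  define TQ where "TQ = {s0..1} \<inter> \<alpha> -` (K - P)"
  have s01: "0 \<le> s0" "s0 \<le> 1" using s0 by (auto simp: TP_def)
  have TQc: "closed TQ" unfolding TQ_def
    by (intro continuous_closed_preimage continuous_on_subset[OF ca])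
       (auto intro: closed_Diff K PQ s01 simp: s01 order_trans[OF s01(1)])
  have TQb: "bdd_below TQ" by (rule bdd_below.I[of _ s0]) (auto simp: TQ_def)
  have T1: "1 \<in> TQ" using ends PQ s01 by (auto simp: TQ_def K_def pathfinish_def)
  define s1 where "s1 = Inf TQ"
  have s1: "s1 \<in> TQ" unfolding s1_def using TQc TQb T1 closed_contains_Inf by blast
  have s1b: "s0 \<le> s1" "s1 \<le> 1" using s1 by (auto simp: TQ_def)
  have "\<alpha> s0 \<in> P" "\<alpha> s1 \<notin> P" using s0 s1 s01 PQK[of s0] by (auto simp: TP_def TQ_def)
  hence "s0 \<noteq> s1" by auto
  have gap: "\<alpha> t \<notin> K" if "s0 < t" "t < s1" for t
  proof
    assume t: "\<alpha> t \<in> K"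
    have t01: "t \<in> {0..1}" using that s01 s1b by auto
    show False
    proof (cases "\<alpha> t \<in> P")
      case True
      hence "t \<in> TP" using t t01 PQK[of t] by (auto simp: TP_def)
      hence "t \<le> s0" unfolding s0_def using TPb by (rule cSup_upper)
      thus False using that by simp
    next
      case False
      hence "t \<in> TQ" using t t01 that by (auto simp: TQ_def)
      hence "s1 \<le> t" unfolding s1_def using TQb by (rule cInf_lower)
      thus False using that by simp
    qed
  qed
  have "\<alpha> s0 \<in> K" "\<alpha> s1 \<in> K" using s0 s1 by (auto simp: TP_def TQ_def)
  then obtain r0 r1 where r: "r0 \<in> {0..1}" "r1 \<in> {0..1}" "\<beta> r0 = \<alpha> s0" "\<beta> r1 = \<alpha> s1"
    unfolding K_def path_image_def by (metis imageE)
  have "\<alpha> s0 \<noteq> \<alpha> s1" using inj \<open>s0 \<noteq> s1\<close> s01 s1b by (auto dest: inj_onD)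
  hence "r0 \<noteq> r1" using r by auto
  define a where "a = \<alpha> \<circ> linepath s0 s1"
  define b where "b = \<beta> \<circ> linepath r1 r0"
  have "s0 \<in> {0..1}" "s1 \<in> {0..1}" using s01 s1b by auto
  hence aa: "arc a" "path_image a \<subseteq> path_image \<alpha>"
    unfolding a_def using arc_linepath_reparam[OF arcs(1)] \<open>s0 \<noteq> s1\<close> by blast+
  have ab: "arc b" "path_image b \<subseteq> K"
    unfolding b_def K_def using arc_linepath_reparam[OF arcs(2) r(2,1)] \<open>r0 \<noteq> r1\<close> by blast+
  have ia: "path_image a = \<alpha> ` {s0..s1}"
    unfolding a_def path_image_compose path_image_linepath using s1b by (simp add: closed_segment_eq_real_ivl)
  have se: "pathstart a = \<alpha> s0" "pathfinish a = \<alpha> s1" "pathstart b = \<beta> r1" "pathfinish b = \<beta> r0"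
    by (simp_all add: a_def b_def pathstart_compose pathfinish_compose)
  have "simple_path (a +++ b)"
  proof (rule simple_path_join_loop[OF aa(1) ab(1)])
    show "pathfinish a = pathstart b" "pathfinish b = pathstart a"
      by (simp_all add: se r)
    show "path_image a \<inter> path_image b \<subseteq> {pathstart a, pathstart b}"
    proof
      fix x assume x: "x \<in> path_image a \<inter> path_image b"
      then obtain t where t: "t \<in> {s0..s1}" "x = \<alpha> t" using ia by auto
      have "x \<in> K" using x ab(2) by blast
      hence "t = s0 \<or> t = s1" using gap[of t] t by force
      thus "x \<in> {pathstart a, pathstart b}" using t by (auto simp: se r)
    qed
  qed
  hence "path_image (a +++ b) homeomorphic sphere (0::complex) 1"
    by (rule homeomorphic_simple_path_image_circle) (simp_all add: se r)
  thus ?thesis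
    using that[of "path_image (a +++ b)"] aa(2) ab(2) path_image_join_subset[of a b]
    unfolding simple_closed_curve_def K_def by blast
qed

lemma dendrite_unicoherent:
  fixes X :: "'a::metric_space set"
  assumes X: "dendrite X" and A: "subcontinuum A X" and B: "subcontinuum B X"
  shows "connected (A \<inter> B)"
proof (rule ccontr)
  note dX = dendriteD[OF X] and dA = subcontinuumD[OF A] and dB = subcontinuumD[OF B]
  assume "\<not> connected (A \<inter> B)"
  moreover have AB: "closed (A \<inter> B)" using dA dB by auto
  ultimately obtain P Q where PQ: "closed P" "closed Q" "P \<noteq> {}" "Q \<noteq> {}" "P \<union> Q = A \<inter> B" "P \<inter> Q = {}"
    by (auto simp: connected_closed_set)
  obtain P' Q' where PQ': "open P'" "open Q'" "P \<subseteq> P'" "Q \<subseteq> Q'" "P' \<inter> Q' = {}"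
    using t4_space[OF PQ(1,2,6)] by blast
  define R where "R = X - (P' \<union> Q')"
  have R: "compact R" unfolding R_def using dX(2) PQ' by (intro compact_diff) auto
  have pos: "infdist x A + infdist x B > 0" if "x \<in> R" for x
  proof -
    have "x \<notin> A \<inter> B" using that PQ PQ' by (auto simp: R_def)
    hence "infdist x A \<noteq> 0 \<or> infdist x B \<noteq> 0"
      using dA dB by (metis IntI closure_closed in_closure_iff_infdist_zero)
    thus ?thesis using infdist_nonneg[of x A] infdist_nonneg[of x B] by linarith
  qed
  obtain e where e: "e > 0" "\<And>x. x \<in> R \<Longrightarrow> infdist x A + infdist x B \<ge> 2 * e"
  proof (cases "R = {}")
    case True thus ?thesis using that[of 1] by simp
  next
    case False
    have "continuous_on R (\<lambda>x. infdist x A + infdist x B)" by (intro continuous_intros)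
    then obtain z where "z \<in> R" "\<And>x. x \<in> R \<Longrightarrow> infdist z A + infdist z B \<le> infdist x A + infdist x B"
      using continuous_attains_inf[OF R False] by blast
    note z = this
    show ?thesis
    proof (rule that[of "(infdist z A + infdist z B) / 2"])
      show "(infdist z A + infdist z B) / 2 > 0" using pos[OF z(1)] by simp
      show "2 * ((infdist z A + infdist z B) / 2) \<le> infdist x A + infdist x B" if "x \<in> R" for x
        using z(2)[OF that] by simp
    qed
  qed
  obtain U where U: "openin (top_of_set X) U" "connected U" "A \<subseteq> U" "\<And>x. x \<in> U \<Longrightarrow> infdist x A < e"
    using connected_open_neighbourhood[OF dX(5) dA(1,5,2) e(1)] by metis
  obtain V where V: "openin (top_of_set X) V" "connected V" "B \<subseteq> V" "\<And>x. x \<in> V \<Longrightarrow> infdist x B < e"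
    using connected_open_neighbourhood[OF dX(5) dB(1,5,2) e(1)] by metis
  have UV: "U \<inter> V \<subseteq> P' \<union> Q'"
  proof
    fix x assume x: "x \<in> U \<inter> V"
    hence "infdist x A + infdist x B < 2 * e" using U(4)[of x] V(4)[of x] by auto
    hence "x \<notin> R" using e(2)[of x] by linarith
    moreover have "x \<in> X" using x U(1) openin_imp_subset by blast
    ultimately show "x \<in> P' \<union> Q'" by (auto simp: R_def)
  qed
  obtain p q where pq: "p \<in> P" "q \<in> Q" using PQ by blast
  have ne: "p \<noteq> q" using pq PQ by blast
  have pqAB: "p \<in> A" "p \<in> B" "q \<in> A" "q \<in> B" using pq PQ by blast+
  obtain \<alpha> where \<alpha>: "arc \<alpha>" "path_image \<alpha> \<subseteq> U" "pathstart \<alpha> = p" "pathfinish \<alpha> = q"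
    by (rule arc_in_open_connected[OF dX(2,5) U(1,2), of p q]) (use pqAB U(3) ne in blast)+
  obtain \<beta> where \<beta>: "arc \<beta>" "path_image \<beta> \<subseteq> V" "pathstart \<beta> = p" "pathfinish \<beta> = q"
    by (rule arc_in_open_connected[OF dX(2,5) V(1,2), of p q]) (use pqAB V(3) ne in blast)+
  obtain S where S: "simple_closed_curve S" "S \<subseteq> path_image \<alpha> \<union> path_image \<beta>"
  proof (rule simple_closed_curve_in_two_arcs[OF \<alpha>(1) \<beta>(1) _ _ PQ'(1,2,5)])
    show "pathstart \<alpha> \<in> path_image \<beta>" "pathfinish \<alpha> \<in> path_image \<beta>"
      using \<alpha> \<beta> by (metis pathstart_in_path_image, metis pathfinish_in_path_image)
    show "pathstart \<alpha> \<in> P'" "pathfinish \<alpha> \<in> Q'" using \<alpha> pq PQ' by auto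
    show "path_image \<alpha> \<inter> path_image \<beta> \<subseteq> P' \<union> Q'" using UV \<alpha> \<beta> by blast
  qed
  moreover have "U \<subseteq> X" "V \<subseteq> X" using U V openin_imp_subset by blast+
  ultimately show False using dX(6)[of S] \<alpha>(2) \<beta>(2) by blast
qed

lemma dendrite_connected_Int_open:
  fixes X :: "'a::metric_space set"
  assumes X: "dendrite X" and A: "subcontinuum A X"
    and W: "openin (top_of_set X) W" "connected W"
  shows "connected (W \<inter> A)"
  unfolding connected_iff_connected_component
proof (intro ballI)
  fix a b assume ab: "a \<in> W \<inter> A" "b \<in> W \<inter> A"
  have "path_connected W"
    using dendriteD[OF X] W by (intro locally_connected_open_imp_path_connected)
  then obtain h where h: "path h" "path_image h \<subseteq> W" "pathstart h = a" "pathfinish h = b"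
    using ab unfolding path_connected_def by blast
  have "path_image h \<subseteq> X" using h W openin_imp_subset by blast
  hence "subcontinuum (path_image h) X"
    using h by (auto simp: subcontinuum_def continuum_def connected_path_image compact_path_image)
  hence "connected (path_image h \<inter> A)" using dendrite_unicoherent[OF X _ A] by blast
  moreover have "a \<in> path_image h" "b \<in> path_image h" using h by auto
  ultimately show "connected_component (W \<inter> A) a b"
    unfolding connected_component_def using ab h by blast
qed

lemma dendrite_subcontinuum:
  fixes X :: "'a::metric_space set"
  assumes X: "dendrite X" and A: "subcontinuum A X"
  shows "dendrite A"
proof -
  note dX = dendriteD[OF X] and dA = subcontinuumD[OF A]
  have "locally connected A"
    unfolding locally_connected
  proof (intro allI impI, elim conjE)
    fix v x assume v: "openin (top_of_set A) v" "x \<in> v"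
    then obtain T where T: "open T" "v = A \<inter> T" by (auto simp: openin_open)
    have "openin (top_of_set X) (X \<inter> T)" "x \<in> X \<inter> T"
      using T v dA(1) by (auto simp: openin_open_Int)
    then obtain U where U: "openin (top_of_set X) U" "connected U" "x \<in> U" "U \<subseteq> X \<inter> T"
      using dX(5) unfolding locally_connected by meson
    have "connected (U \<inter> A)" by (rule dendrite_connected_Int_open[OF X A U(1,2)])
    moreover have "openin (top_of_set A) (U \<inter> A)"
      using U(1) dA(1) by (auto simp: openin_open)
    ultimately show "\<exists>u. openin (top_of_set A) u \<and> connected u \<and> x \<in> u \<and> u \<subseteq> v"
      using U T v by (intro exI[of _ "U \<inter> A"]) auto
  qed
  thus ?thesis using A dX(6) dA(1) unfolding dendrite_def subcontinuum_def by blast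
qed

lemma connected_subset_interval_eq:
  fixes T :: "real set"
  assumes "connected T" "T \<subseteq> {a..b}" "a \<in> T" "b \<in> T"
  shows "T = {a..b}"
  using assms connected_contains_Icc[of T a b] by blast

lemma dendrite_arc_hull:
  fixes X :: "'a::metric_space set"
  assumes X: "dendrite X" and pq: "p \<in> X" "q \<in> X"
  obtains g where "path g" "path_image g \<subseteq> X" "pathstart g = p" "pathfinish g = q"
    "\<And>C. subcontinuum C X \<Longrightarrow> p \<in> C \<Longrightarrow> q \<in> C \<Longrightarrow> path_image g \<subseteq> C"
proof (cases "p = q")
  case True
  show ?thesis
  proof (rule that[of "\<lambda>_. p"])
    show "path (\<lambda>_. p)" by (simp add: path_def)
  qed (use True pq in \<open>simp_all add: path_image_def pathstart_def pathfinish_def\<close>)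
next
  case False
  note dX = dendriteD[OF X]
  obtain g where g: "arc g" "path_image g \<subseteq> X" "pathstart g = p" "pathfinish g = q"
    using arc_in_open_connected[OF dX(2,5) openin_subtopology_self dX(4) pq False] by metis
  show ?thesis
  proof (rule that[OF _ g(2-4)])
    show "path g" using g by (simp add: arc_imp_path)
    fix C assume C: "subcontinuum C X" "p \<in> C" "q \<in> C"
    have "subcontinuum (path_image g) X"
      using g by (auto simp: subcontinuum_def continuum_def connected_path_image compact_path_image arc_imp_path)
    hence con: "connected (path_image g \<inter> C)" by (rule dendrite_unicoherent[OF X _ C(1)])
    obtain h where h: "homeomorphism {0..1} (path_image g) g h"
      using homeomorphism_arc[OF g(1)] by blast
    have "connected (h ` (path_image g \<inter> C))"
      using h con by (auto intro!: connected_continuous_image intro: continuous_on_subset simp: homeomorphism_def)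
    moreover have "h ` (path_image g \<inter> C) \<subseteq> {0..1}" using h by (auto simp: homeomorphism_def)
    moreover have "h p = 0" "h q = 1" using h g(3,4)
      by (auto simp: homeomorphism_def pathstart_def pathfinish_def)
    moreover have "p \<in> path_image g \<inter> C" "q \<in> path_image g \<inter> C"
      using g C by auto
    ultimately have "h ` (path_image g \<inter> C) = {0..1}"
      by (intro connected_subset_interval_eq) (metis image_eqI)+
    hence "g ` h ` (path_image g \<inter> C) = path_image g" by (simp add: path_image_def)
    moreover have "g ` h ` (path_image g \<inter> C) \<subseteq> C" using h by (auto simp: homeomorphism_def)
    ultimately show "path_image g \<subseteq> C" by simp
  qed
qed

lemma components_complement_closure_subset:
  fixes X :: "'a::metric_space set"
  assumes "closed X" "D \<in> components (X - A)"
  shows "closure D \<subseteq> D \<union> A"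
proof
  fix x assume x: "x \<in> closure D"
  have D: "connected D" "D \<noteq> {}" "D \<subseteq> X - A"
    using in_components_connected[OF assms(2)] in_components_nonempty[OF assms(2)] in_components_subset[OF assms(2)] by auto
  have "closure D \<subseteq> X" using closure_minimal[OF _ assms(1)] D(3) by blast
  show "x \<in> D \<union> A"
  proof (rule ccontr)
    assume nx: "x \<notin> D \<union> A"
    have "connected (insert x D)"
      by (rule connected_intermediate_closure[OF D(1)]) (use x closure_subset in auto)
    moreover have "insert x D \<subseteq> X - A" using x nx D \<open>closure D \<subseteq> X\<close> by blast
    ultimately have "insert x D \<subseteq> D"
      using components_maximal[OF assms(2)] D(2) by blast
    thus False using nx by blast
  qed
qed

lemma dendrite_complement_component:
  fixes X :: "'a::metric_space set"
  assumes X: "dendrite X" and A: "subcontinuum A X" and D: "D \<in> components (X - A)"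
  obtains a where "a \<in> A" "closure D = insert a D" "openin (top_of_set X) D"
proof -
  note dX = dendriteD[OF X] and dA = subcontinuumD[OF A]
  have D': "connected D" "D \<noteq> {}" "D \<subseteq> X - A"
    using in_components_connected[OF D] in_components_nonempty[OF D] in_components_subset[OF D] by auto
  have "openin (top_of_set X) (X - A)" using dA by (intro openin_diff closed_subset) auto
  hence oD: "openin (top_of_set X) D"
    using D dX(5) locally_connected_open_component by blast
  have sub: "closure D \<subseteq> D \<union> A" by (rule components_complement_closure_subset[OF dX(3) D])
  have "closure D \<inter> A \<noteq> {}"
  proof
    assume "closure D \<inter> A = {}"
    hence "closed D" using sub by (auto simp: closure_subset_eq[symmetric])
    hence "closedin (top_of_set X) D" using D' by (auto intro: closed_subset)
    hence "D = X" using connected_clopen[THEN iffD1, OF dX(4)] oD D' by blast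
    thus False using D' dA by blast
  qed
  then obtain a where a: "a \<in> closure D" "a \<in> A" by blast
  have "b = a" if b: "b \<in> closure D" "b \<in> A" for b
  proof (rule ccontr)
    assume "b \<noteq> a"
    define r where "r = dist a b / 3"
    have r: "r > 0" using \<open>b \<noteq> a\<close> by (simp add: r_def)
    have ex: "\<exists>N y. connected N \<and> N \<subseteq> X \<and> N \<subseteq> ball c r \<and> c \<in> N \<and> y \<in> N \<and> y \<in> D" if "c \<in> A" "c \<in> closure D" for c
    proof -
      have "openin (top_of_set X) (X \<inter> ball c r)" "c \<in> X \<inter> ball c r"
        using that r dA(1) by (auto simp: openin_open_Int)
      then obtain U where U: "openin (top_of_set X) U" "connected U" "c \<in> U" "U \<subseteq> X \<inter> ball c r"
        using dX(5) unfolding locally_connected by meson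
      obtain T where T: "open T" "U = X \<inter> T" using U(1) by (auto simp: openin_open)
      have "D \<inter> T \<noteq> {}" using that(2) T U(3) by (auto simp: closure_iff_nhds_not_empty)
      then obtain y where "y \<in> D" "y \<in> T" by blast
      thus ?thesis using U T D' by blast
    qed
    obtain N y where N: "connected N" "N \<subseteq> X" "N \<subseteq> ball a r" "a \<in> N" "y \<in> N" "y \<in> D" using ex a by metis
    obtain M z where M: "connected M" "M \<subseteq> X" "M \<subseteq> ball b r" "b \<in> M" "z \<in> M" "z \<in> D" using ex b by metis
    have "path_connected D"
      by (rule locally_connected_open_imp_path_connected[OF dX(2,5) oD D'(1)])
    then obtain h where h: "path h" "path_image h \<subseteq> D" "pathstart h = y" "pathfinish h = z"
      using N M unfolding path_connected_def by blast
    define K where "K = closure N \<union> path_image h \<union> closure M"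
    have cl: "closure N \<subseteq> X" "closure M \<subseteq> X" using N M dX(3) by (auto intro: closure_minimal[THEN subsetD])
    have yz: "y \<in> closure N" "z \<in> closure M" using N M closure_subset by blast+
    have yz': "y \<in> path_image h" "z \<in> path_image h" using h by auto
    have "connected (closure N \<union> path_image h)"
      using N h yz yz' by (intro connected_Un connected_imp_connected_closure connected_path_image) auto
    hence cK: "connected K" unfolding K_def
      using M(1) yz yz' by (intro connected_Un[of "closure N \<union> path_image h"] connected_imp_connected_closure) auto
    have KX: "K \<subseteq> X" unfolding K_def using cl h D' by blast
    have "closed K" unfolding K_def using h by (intro closed_Un closed_path_image closed_closure)
    hence "compact K" using KX dX(2) closed_Int_compact by (metis inf.absorb1)
    hence "subcontinuum K X" using KX cK yz by (auto simp: subcontinuum_def continuum_def K_def)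
    hence con: "connected (K \<inter> A)" by (rule dendrite_unicoherent[OF X _ A])
    have bN: "closure N \<subseteq> cball a r" "closure M \<subseteq> cball b r"
      using N(3) M(3) ball_subset_cball by (meson closed_cball closure_minimal order_trans)+
    have disj: "closure N \<inter> closure M = {}"
    proof -
      have "cball a r \<inter> cball b r = {}"
      proof (rule ccontr)
        assume "cball a r \<inter> cball b r \<noteq> {}"
        then obtain x where "dist a x \<le> r" "dist b x \<le> r" by auto
        hence "dist a b \<le> 2 * r" using dist_triangle[of a b x] by (simp add: dist_commute)
        thus False using r by (simp add: r_def)
      qed
      thus ?thesis using bN by blast
    qed
    have "K \<inter> A \<subseteq> closure N \<union> closure M" unfolding K_def using h D' by blast
    moreover have "a \<in> closure N \<inter> (K \<inter> A)" "b \<in> closure M \<inter> (K \<inter> A)"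
      using a b N M closure_subset[of N] closure_subset[of M] by (auto simp: K_def)
    ultimately show False
      using con disj unfolding connected_closed
      by (metis (no_types, lifting) closed_closure empty_iff inf_bot_left)
  qed
  hence "closure D \<inter> A = {a}" using a by blast
  hence "closure D = insert a D" using sub closure_subset[of D] by blast
  thus ?thesis using that a oD by blast
qed


subsection \<open>Sums of sorted weights\<close>

lemma sum_antimono_le_initial:
  fixes w :: "nat \<Rightarrow> real"
  assumes "antimono w" "\<And>k. 0 \<le> w k" "finite I" "card I \<le> m"
  shows "sum w I \<le> sum w {..<m}"
  using assms(3,4)
proof (induction m arbitrary: I)
  case 0 thus ?case by simp
next
  case (Suc m)
  show ?case
  proof (cases "card I \<le> m")
    case True
    hence "sum w I \<le> sum w {..<m}" using Suc by blast
    thus ?thesis using assms(2)[of m] by simp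
  next
    case False
    hence c: "card I = Suc m" using Suc by simp
    hence ne: "I \<noteq> {}" by auto
    define M where "M = Max I"
    have M: "M \<in> I" unfolding M_def using ne Suc.prems by simp
    have "I \<subseteq> {..M}" unfolding M_def using Suc.prems by auto
    hence "card I \<le> card {..M}" by (intro card_mono) auto
    hence "m \<le> M" unfolding c card_atMost by simp
    hence "w M \<le> w m" by (rule antimonoD[OF assms(1)])
    moreover have "sum w (I - {M}) \<le> sum w {..<m}" 
      using Suc.prems c M by (intro Suc.IH) auto
    moreover have "sum w I = w M + sum w (I - {M})"
      using Suc.prems(1) M by (rule sum.remove)
    ultimately show ?thesis by simp
  qed
qed

lemma abel_sum_nonneg:
  fixes b d :: "nat \<Rightarrow> real"
  assumes "antimono b" "\<And>k. 0 \<le> b k" "\<And>m. 0 \<le> (\<Sum>k<m. d k)"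
  shows "0 \<le> (\<Sum>k<M. b k * d k)"
proof -
  have "b M * (\<Sum>k<M. d k) \<le> (\<Sum>k<M. b k * d k)"
  proof (induction M)
    case (Suc M)
    have "b (Suc M) * (\<Sum>k<Suc M. d k) \<le> b M * (\<Sum>k<Suc M. d k)"
      using assms(1,3) by (intro mult_right_mono) (auto simp: antimonoD simp del: sum.lessThan_Suc)
    also have "\<dots> = b M * (\<Sum>k<M. d k) + b M * d M" by (simp add: algebra_simps)
    finally show ?case using Suc by simp
  qed simp
  moreover have "0 \<le> b M * (\<Sum>k<M. d k)" using assms by simp
  ultimately show ?thesis by linarith
qed

lemma weighted_rearrangement:
  fixes w :: "nat \<Rightarrow> real"
  assumes w: "antimono w" "\<And>k. 0 \<le> w k" and S: "inj_on i S" "S \<subseteq> {..<M}"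
  shows "(\<Sum>k\<in>S. (1/2)^k * w (i k)) \<le> (\<Sum>k<M. (1/2)^k * w k)"
proof -
  define d where "d k = w k - (if k \<in> S then w (i k) else 0)" for k
  have "0 \<le> (\<Sum>k<m. d k)" for m
  proof -
    have "(\<Sum>k<m. if k \<in> S then w (i k) else 0) = (\<Sum>k\<in>S \<inter> {..<m}. w (i k))"
      by (subst sum.inter_restrict[symmetric]) (auto simp: Int_commute)
    also have "\<dots> = sum w (i ` (S \<inter> {..<m}))"
      using S by (subst sum.reindex) (auto intro: inj_on_subset)
    also have "\<dots> \<le> sum w {..<m}"
    proof (rule sum_antimono_le_initial[OF w])
      have "card (i ` (S \<inter> {..<m})) \<le> card (S \<inter> {..<m})" by (intro card_image_le) auto
      also have "\<dots> \<le> card {..<m}" by (intro card_mono) auto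
      finally show "card (i ` (S \<inter> {..<m})) \<le> m" by simp
    qed auto
    finally show ?thesis by (simp add: d_def sum_subtractf)
  qed
  hence "0 \<le> (\<Sum>k<M. (1/2)^k * d k)"
    by (intro abel_sum_nonneg) (auto simp: antimono_def power_decreasing)
  also have "\<dots> = (\<Sum>k<M. (1/2)^k * w k) - (\<Sum>k<M. if k \<in> S then (1/2)^k * w (i k) else 0)"
    unfolding d_def by (subst sum_subtractf[symmetric]) (auto intro!: sum.cong simp: algebra_simps)
  also have "(\<Sum>k<M. if k \<in> S then (1/2)^k * w (i k) else 0) = (\<Sum>k\<in>S. (1/2)^k * w (i k))"
    using S(2) by (subst sum.inter_restrict[symmetric]) (auto intro!: sum.cong)
  finally show ?thesis by simp
qed

text \<open>The rank below breaks ties between equal weights by an injection of \<open>P\<close> into the naturals.\<close>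

lemma antimono_enumeration_exists:
  fixes w :: "'i \<Rightarrow> real"
  assumes pos: "\<And>c. c \<in> P \<Longrightarrow> w c > 0"
    and fin: "\<And>e. e > 0 \<Longrightarrow> finite {c \<in> P. w c \<ge> e}"
  obtains N C where "bij_betw C {k. enat k < N} P"
    "\<And>k. enat (Suc k) < N \<Longrightarrow> w (C (Suc k)) \<le> w (C k)"
proof -
  have "P = (\<Union>n::nat. {c \<in> P. w c \<ge> 1 / Suc n})"
  proof (intro equalityI subsetI)
    fix c assume c: "c \<in> P"
    obtain n where "inverse (real (Suc n)) < w c" using reals_Archimedean[OF pos[OF c]] by blast
    thus "c \<in> (\<Union>n::nat. {c \<in> P. w c \<ge> 1 / Suc n})" using c by (auto simp: inverse_eq_divide intro: less_imp_le)
  qed auto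
  moreover have "countable (\<Union>n::nat. {c \<in> P. w c \<ge> 1 / Suc n})"
  proof (rule countable_UN)
    show "countable {c \<in> P. w c \<ge> 1 / Suc n}" for n
      by (rule countable_finite[OF fin]) simp
  qed simp
  ultimately have cP: "countable P" by simp
  define g where "g = to_nat_on P"
  have g: "inj_on g P" unfolding g_def using cP by (rule inj_on_to_nat_on)
  define pre where "pre c = {d \<in> P. w d > w c \<or> (w d = w c \<and> g d < g c)}" for c
  define r where "r c = card (pre c)" for c
  have fpre: "finite (pre c)" if "c \<in> P" for c
    by (rule finite_subset[OF _ fin[OF pos[OF that]]]) (auto simp: pre_def)
  have rmono: "r c < r d" if "c \<in> P" "d \<in> P" "w c > w d \<or> (w c = w d \<and> g c < g d)" for c d
    unfolding r_def
  proof (rule psubset_card_mono[OF fpre[OF that(2)]])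
    have "c \<in> pre d" "c \<notin> pre c" "pre c \<subseteq> pre d" using that by (auto simp: pre_def)
    thus "pre c \<subset> pre d" by blast
  qed
  have rinj: "inj_on r P"
  proof (rule inj_onI, rule ccontr)
    fix c d assume cd: "c \<in> P" "d \<in> P" "r c = r d" "c \<noteq> d"
    hence "g c \<noteq> g d" using g by (auto dest: inj_onD)
    hence "(w c > w d \<or> (w c = w d \<and> g c < g d)) \<or> (w d > w c \<or> (w d = w c \<and> g d < g c))" by force
    thus False using rmono[of c d] rmono[of d c] cd by auto
  qed
  have rw: "w d \<le> w c" if "c \<in> P" "d \<in> P" "r c < r d" for c d
    using rmono[of d c] that by force
  have "\<exists>N h. bij_betw h {k. enat k < N} (r ` P) \<and> (\<forall>k. enat (Suc k) < N \<longrightarrow> h k < h (Suc k))"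
  proof (cases "finite P")
    case True
    then obtain h where h: "bij_betw h {..<card (r ` P)} (r ` P)" "strict_mono_on {..<card (r ` P)} h"
      using ex_bij_betw_strict_mono_card[of "r ` P"] by auto
    show ?thesis
      by (rule exI[of _ "enat (card (r ` P))"], rule exI[of _ h])
        (use h in \<open>auto simp: lessThan_def strict_mono_on_def\<close>)
  next
    case False
    hence "infinite (r ` P)" using rinj finite_imageD by blast
    thus ?thesis
      using bij_enumerate[of "r ` P"] enumerate_step[of "r ` P"]
      by (intro exI[of _ \<infinity>] exI[of _ "enumerate (r ` P)"]) auto
  qed
  then obtain N h where h: "bij_betw h {k. enat k < N} (r ` P)"
    "\<And>k. enat (Suc k) < N \<Longrightarrow> h k < h (Suc k)" by blast
  have bi: "bij_betw (the_inv_into P r) (r ` P) P"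
    using rinj by (simp add: bij_betw_the_inv_into inj_on_imp_bij_betw)
  have b: "bij_betw (the_inv_into P r \<circ> h) {k. enat k < N} P"
    using h(1) bi by (rule bij_betw_trans)
  show ?thesis
  proof (rule that[OF b])
    fix k assume k: "enat (Suc k) < N"
    hence k': "enat k < N" by (metis Suc_ile_eq order_less_imp_le)
    have hk: "h k \<in> r ` P" "h (Suc k) \<in> r ` P" using h(1) k k' by (auto simp: bij_betw_def)
    then obtain c d where cd: "c \<in> P" "d \<in> P" "h k = r c" "h (Suc k) = r d" by auto
    thus "w ((the_inv_into P r \<circ> h) (Suc k)) \<le> w ((the_inv_into P r \<circ> h) k)"
      using rw[of c d] h(2)[OF k] rinj by (simp add: the_inv_into_f_f)
  qed
qed

definition finitely_many_wide_pieces ::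
    "'a::metric_space set \<Rightarrow> ('a \<Rightarrow> 'b::real_inner) \<Rightarrow> real \<Rightarrow> 'b \<Rightarrow> real \<Rightarrow> bool" where
  "finitely_many_wide_pieces X \<gamma> x u \<mu> \<longleftrightarrow>
     (\<forall>\<epsilon>>0. finite {C \<in> pieces X \<gamma> x u \<mu>. \<epsilon> \<le> width u (\<gamma> ` C)})"

lemma pieces_width_pos: "C \<in> pieces X \<gamma> x u \<mu> \<Longrightarrow> 0 < width u (\<gamma> ` C)"
  by (auto simp: pieces_def)

lemma weighted_width_eq_suminf:
  assumes "finitely_many_wide_pieces X \<gamma> x u \<mu>"
  obtains N C w where "bij_betw C {k. enat k < N} (pieces X \<gamma> x u \<mu>)"
    "\<And>k. w k = (if enat k < N then width u (\<gamma> ` C k) else 0)"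
    "antimono w" "\<And>k. 0 \<le> w k" "w \<longlonglongrightarrow> 0"
    "summable (\<lambda>k. (1/2)^k * w k)" "weighted_width X \<gamma> x u \<mu> = (\<Sum>k. (1/2)^k * w k)"
proof -
  have fin: "e > 0 \<Longrightarrow> finite {C \<in> pieces X \<gamma> x u \<mu>. width u (\<gamma> ` C) \<ge> e}" for e
    using assms by (simp add: finitely_many_wide_pieces_def)
  have "\<exists>N C. sorted_enumeration X \<gamma> x u \<mu> N C"
    by (rule antimono_enumeration_exists[OF pieces_width_pos fin]) (auto simp: sorted_enumeration_def)
  hence ex: "\<exists>p. case p of (N, C) \<Rightarrow> sorted_enumeration X \<gamma> x u \<mu> N C" by auto
  define p where "p = (SOME (N, C). sorted_enumeration X \<gamma> x u \<mu> N C)"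
  obtain N C where NC: "p = (N, C)" by (cases p)
  have se: "sorted_enumeration X \<gamma> x u \<mu> N C"
    using someI_ex[OF ex] NC unfolding p_def by simp
  define w where "w k = (if enat k < N then width u (\<gamma> ` C k) else 0)" for k
  have Cp: "C k \<in> pieces X \<gamma> x u \<mu>" if "enat k < N" for k
    using se that by (auto simp: sorted_enumeration_def bij_betw_def)
  have w0: "0 \<le> w k" for k
    using pieces_width_pos[OF Cp[of k]] by (simp add: w_def less_imp_le)
  have anti: "antimono w"
    unfolding antimono_iff_le_Suc
  proof
    fix k
    show "w (Suc k) \<le> w k"
    proof (cases "enat (Suc k) < N")
      case True
      hence "enat k < N" by (metis Suc_ile_eq order_less_imp_le)
      thus ?thesis using se True by (simp add: w_def sorted_enumeration_def)
    next
      case False thus ?thesis using w0[of k] by (simp add: w_def)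
    qed
  qed
  have lim: "w \<longlonglongrightarrow> 0"
  proof (rule LIMSEQ_I)
    fix e :: real assume e: "e > 0"
    have "finite {k. e \<le> w k}"
    proof (rule finite_subset)
      show "{k. e \<le> w k} \<subseteq> {k \<in> {k. enat k < N}. C k \<in> {D \<in> pieces X \<gamma> x u \<mu>. e \<le> width u (\<gamma> ` D)}}"
        using e Cp by (auto simp: w_def split: if_splits)
      show "finite {k \<in> {k. enat k < N}. C k \<in> {D \<in> pieces X \<gamma> x u \<mu>. e \<le> width u (\<gamma> ` D)}}"
      proof (rule finite_imageD[where f = C])
        show "inj_on C {k \<in> {k. enat k < N}. C k \<in> {D \<in> pieces X \<gamma> x u \<mu>. e \<le> width u (\<gamma> ` D)}}"
          using se by (auto simp: sorted_enumeration_def bij_betw_def intro: inj_on_subset)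
      qed (rule finite_subset[OF _ fin[OF e]], auto)
    qed
    then obtain n where "{k. e \<le> w k} \<subseteq> {..<n}" using finite_nat_bounded by blast
    hence n: "e \<le> w k \<Longrightarrow> k < n" for k by auto
    show "\<exists>no. \<forall>k\<ge>no. norm (w k - 0) < e"
      using n w0 by (intro exI[of _ n]) (auto simp: not_less[symmetric])
  qed
  have sm: "summable (\<lambda>k. (1/2)^k * w k)"
  proof (rule summable_comparison_test)
    show "summable (\<lambda>k. (1/2)^k * w 0)" by (intro summable_mult2 summable_geometric) simp
    show "\<exists>N. \<forall>n\<ge>N. norm ((1/2)^n * w n) \<le> (1/2)^n * w 0"
      using w0 antimonoD[OF anti, of 0] by (auto intro!: mult_left_mono)
  qed
  have "weighted_width X \<gamma> x u \<mu> = (\<Sum>k. (1/2)^k * w k)"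
    unfolding weighted_width_def p_def[symmetric] NC Let_def prod.case
    by (intro suminf_cong) (simp add: w_def)
  thus ?thesis using that[of C N w] se anti w0 lim sm by (auto simp: w_def sorted_enumeration_def)
qed

lemma weighted_sum_le_weighted_width:
  assumes fin: "finitely_many_wide_pieces X \<gamma> x u \<mu>"
    and c: "finite S" "inj_on c S" "c ` S \<subseteq> pieces X \<gamma> x u \<mu>"
  shows "(\<Sum>k\<in>S. (1/2)^k * width u (\<gamma> ` c k)) \<le> weighted_width X \<gamma> x u \<mu>"
proof -
  obtain N C w where C: "bij_betw C {k. enat k < N} (pieces X \<gamma> x u \<mu>)"
    and w: "\<And>k. w k = (if enat k < N then width u (\<gamma> ` C k) else 0)"
      "antimono w" "\<And>k. 0 \<le> w k" "w \<longlonglongrightarrow> 0"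
    and sm: "summable (\<lambda>k. (1/2)^k * w k)"
    and ww: "weighted_width X \<gamma> x u \<mu> = (\<Sum>k. (1/2)^k * w k)"
    by (rule weighted_width_eq_suminf[OF fin]) (rule that; assumption)
  define i where "i k = inv_into {k. enat k < N} C (c k)" for k
  have i: "enat (i k) < N" "C (i k) = c k" if "k \<in> S" for k
  proof -
    have "c k \<in> C ` {k. enat k < N}" using c that C by (auto simp: bij_betw_def)
    from inv_into_into[OF this] f_inv_into_f[OF this]
    show "enat (i k) < N" "C (i k) = c k" by (simp_all add: i_def)
  qed
  have "inj_on i S" using c(2) i(2) by (metis inj_on_def)
  moreover obtain M where "S \<subseteq> {..<M}" using c(1) finite_nat_bounded by blast
  ultimately have "(\<Sum>k\<in>S. (1/2)^k * w (i k)) \<le> (\<Sum>k<M. (1/2)^k * w k)"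
    using w(2,3) by (intro weighted_rearrangement) auto
  also have "\<dots> \<le> (\<Sum>k. (1/2)^k * w k)" using sm w(3) by (intro sum_le_suminf) auto
  finally show ?thesis using i w(1) by (simp add: ww)
qed

lemma weighted_width_leI:
  assumes fin: "finitely_many_wide_pieces X \<gamma> x u \<mu>"
    and le: "\<And>M c. inj_on c {..<M} \<Longrightarrow> c ` {..<M} \<subseteq> pieces X \<gamma> x u \<mu> \<Longrightarrow>
      (\<Sum>k<M. (1/2)^k * width u (\<gamma> ` c k)) \<le> b"
  shows "weighted_width X \<gamma> x u \<mu> \<le> b"
proof -
  obtain N C w where C: "bij_betw C {k. enat k < N} (pieces X \<gamma> x u \<mu>)"
    and w: "\<And>k. w k = (if enat k < N then width u (\<gamma> ` C k) else 0)"
      "antimono w" "\<And>k. 0 \<le> w k" "w \<longlonglongrightarrow> 0"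
    and sm: "summable (\<lambda>k. (1/2)^k * w k)"
    and ww: "weighted_width X \<gamma> x u \<mu> = (\<Sum>k. (1/2)^k * w k)"
    by (rule weighted_width_eq_suminf[OF fin]) (rule that; assumption)
  have "(\<Sum>k<M. (1/2)^k * w k) \<le> b" for M
  proof -
    obtain m where m: "{k. enat k < N} \<inter> {..<M} = {..<m}"
    proof (cases N)
      case (enat n)
      hence "{k. enat k < N} \<inter> {..<M} = {..<min n M}" by auto
      thus ?thesis by (rule that)
    next
      case infinity
      hence "{k. enat k < N} \<inter> {..<M} = {..<M}" by auto
      thus ?thesis by (rule that)
    qed
    have "(\<Sum>k<M. (1/2)^k * w k) = (\<Sum>k<m. (1/2)^k * width u (\<gamma> ` C k))"
      unfolding m[symmetric] by (intro sum.mono_neutral_cong_right) (auto simp: w(1))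
    also have "\<dots> \<le> b"
    proof (rule le)
      have "{..<m} \<subseteq> {k. enat k < N}" using m by blast
      thus "inj_on C {..<m}" "C ` {..<m} \<subseteq> pieces X \<gamma> x u \<mu>"
        using C by (auto simp: bij_betw_def intro: inj_on_subset)
    qed
    finally show ?thesis .
  qed
  thus ?thesis unfolding ww using sm by (intro suminf_le_const)
qed

lemma weighted_width_nonneg:
  assumes "finitely_many_wide_pieces X \<gamma> x u \<mu>"
  shows "0 \<le> weighted_width X \<gamma> x u \<mu>"
  using weighted_sum_le_weighted_width[OF assms, of "{}"] by simp

lemma weighted_width_mono:
  assumes finA: "finitely_many_wide_pieces A \<gamma> x u \<mu>" and finX: "finitely_many_wide_pieces X \<gamma> x u \<mu>"
    and \<phi>: "inj_on \<phi> (pieces A \<gamma> x u \<mu>)" "\<phi> ` pieces A \<gamma> x u \<mu> \<subseteq> pieces X \<gamma> x u \<mu>"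
      "\<And>C. C \<in> pieces A \<gamma> x u \<mu> \<Longrightarrow> width u (\<gamma> ` C) \<le> width u (\<gamma> ` \<phi> C)"
  shows "weighted_width A \<gamma> x u \<mu> \<le> weighted_width X \<gamma> x u \<mu>"
proof (rule weighted_width_leI[OF finA])
  fix M :: nat and c
  define S where "S = {..<M}"
  assume "inj_on c {..<M}" "c ` {..<M} \<subseteq> pieces A \<gamma> x u \<mu>"
  hence c: "finite S" "inj_on c S" "c ` S \<subseteq> pieces A \<gamma> x u \<mu>" by (simp_all add: S_def)
  have "(\<Sum>k\<in>S. (1/2)^k * width u (\<gamma> ` c k)) \<le> (\<Sum>k\<in>S. (1/2)^k * width u (\<gamma> ` (\<phi> \<circ> c) k))"
    using c(3) by (intro sum_mono mult_left_mono) (auto intro!: \<phi>(3))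
  also have "\<dots> \<le> weighted_width X \<gamma> x u \<mu>"
  proof (rule weighted_sum_le_weighted_width[OF finX c(1)])
    show "inj_on (\<phi> \<circ> c) S" 
      using c(2,3) \<phi>(1) by (intro comp_inj_on) (auto intro: inj_on_subset)
    show "(\<phi> \<circ> c) ` S \<subseteq> pieces X \<gamma> x u \<mu>" using c(3) \<phi>(2) by auto
  qed
  finally show "(\<Sum>k<M. (1/2)^k * width u (\<gamma> ` c k)) \<le> weighted_width X \<gamma> x u \<mu>"
    by (simp add: S_def)
qed

text \<open>The extra piece \<open>E\<close> is inserted at a position \<open>m\<close> where the remaining pieces of \<open>A\<close> are so
  narrow that their total weight \<open>2 w m\<close> is less than the width of \<open>E\<close>.\<close>

lemma weighted_width_strict_mono:
  assumes finA: "finitely_many_wide_pieces A \<gamma> x u \<mu>" and finX: "finitely_many_wide_pieces X \<gamma> x u \<mu>"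
    and \<phi>: "inj_on \<phi> (pieces A \<gamma> x u \<mu>)" "\<phi> ` pieces A \<gamma> x u \<mu> \<subseteq> pieces X \<gamma> x u \<mu>"
      "\<And>C. C \<in> pieces A \<gamma> x u \<mu> \<Longrightarrow> width u (\<gamma> ` C) \<le> width u (\<gamma> ` \<phi> C)"
    and E: "E \<in> pieces X \<gamma> x u \<mu>" "E \<notin> \<phi> ` pieces A \<gamma> x u \<mu>"
  shows "weighted_width A \<gamma> x u \<mu> < weighted_width X \<gamma> x u \<mu>"
proof -
  obtain N C w where C: "bij_betw C {k. enat k < N} (pieces A \<gamma> x u \<mu>)"
    and w: "\<And>k. w k = (if enat k < N then width u (\<gamma> ` C k) else 0)"
      "antimono w" "\<And>k. 0 \<le> w k" "w \<longlonglongrightarrow> 0"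
    and sm: "summable (\<lambda>k. (1/2)^k * w k)"
    and ww: "weighted_width A \<gamma> x u \<mu> = (\<Sum>k. (1/2)^k * w k)"
    by (rule weighted_width_eq_suminf[OF finA]) (rule that; assumption)
  define v where "v = width u (\<gamma> ` E)"
  have v: "v > 0" using pieces_width_pos[OF E(1)] by (simp add: v_def)
  have Cp: "enat k < N \<Longrightarrow> C k \<in> pieces A \<gamma> x u \<mu>" for k using C by (auto simp: bij_betw_def)
  obtain m where m: "enat m \<le> N" "2 * w m < v"
  proof (cases N)
    case (enat n)
    thus ?thesis using that[of n] v by (simp add: w(1))
  next
    case infinity
    obtain m where "w m < v / 2"
      using order_tendstoD(2)[OF w(4), of "v/2"] v by (auto simp: eventually_sequentially)
    thus ?thesis using that[of m] infinity by simp
  qed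
  define c where "c k = (if k < m then \<phi> (C k) else E)" for k
  have Nm: "k < m \<Longrightarrow> enat k < N" for k using m(1) by (metis enat_ord_simps(2) less_le_trans)
  have "(\<Sum>k\<in>{..m}. (1/2)^k * width u (\<gamma> ` c k)) \<le> weighted_width X \<gamma> x u \<mu>"
  proof (rule weighted_sum_le_weighted_width[OF finX])
    have C\<phi>: "inj_on (\<lambda>k. \<phi> (C k)) {k. enat k < N}"
      using comp_inj_on[of C "{k. enat k < N}" \<phi>] C \<phi>(1) by (auto simp: bij_betw_def o_def)
    show "inj_on c {..m}"
    proof (rule inj_onI)
      fix k l assume kl: "k \<in> {..m}" "l \<in> {..m}" "c k = c l"
      have "\<phi> (C j) \<noteq> E" if "j < m" for j using E(2) Cp[OF Nm[OF that]] by auto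
      thus "k = l" using kl C\<phi> Nm unfolding c_def
        by (auto dest: inj_onD split: if_splits)
    qed
    show "c ` {..m} \<subseteq> pieces X \<gamma> x u \<mu>" using E(1) \<phi>(2) Cp Nm by (auto simp: c_def)
  qed simp
  also have "(\<Sum>k\<in>{..m}. (1/2)^k * width u (\<gamma> ` c k)) = (\<Sum>k<m. (1/2)^k * width u (\<gamma> ` c k)) + (1/2)^m * v"
    by (simp add: lessThan_Suc_atMost[symmetric] c_def v_def)
  finally have 1: "(\<Sum>k<m. (1/2)^k * width u (\<gamma> ` c k)) + (1/2)^m * v \<le> weighted_width X \<gamma> x u \<mu>" .
  have 2: "(\<Sum>k<m. (1/2)^k * w k) \<le> (\<Sum>k<m. (1/2)^k * width u (\<gamma> ` c k))"
    using Nm \<phi>(3)[OF Cp] by (intro sum_mono mult_left_mono) (auto simp: w(1) c_def)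
  have "weighted_width A \<gamma> x u \<mu> = (\<Sum>k. (1/2)^(k + m) * w (k + m)) + (\<Sum>k<m. (1/2)^k * w k)"
    unfolding ww by (rule suminf_split_initial_segment[OF sm])
  moreover have "(\<Sum>k. (1/2)^(k + m) * w (k + m)) \<le> (\<Sum>k. (1/2)^k * ((1/2)^m * w m))"
  proof (rule suminf_le)
    show "(1/2)^(k + m) * w (k + m) \<le> (1/2)^k * ((1/2)^m * w m)" for k
      using antimonoD[OF w(2), of m "k + m"] by (simp add: power_add mult_left_mono mult.assoc)
    show "summable (\<lambda>k. (1/2)^(k + m) * w (k + m))" using sm by (rule summable_ignore_initial_segment)
    show "summable (\<lambda>k. (1/2)^k * ((1/2)^m * w m))" by (intro summable_mult2 summable_geometric) simp
  qed
  moreover have "(\<Sum>k. (1/2)^k * ((1/2)^m * w m)) = (1/2)^m * (2 * w m)"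
    by (subst suminf_mult2[symmetric]) (auto simp: suminf_geometric summable_geometric)
  moreover have "(1/2)^m * (2 * w m) < (1/2)^m * v" using m(2) by (intro mult_strict_left_mono) auto
  ultimately show ?thesis using 1 2 by linarith
qed


subsection \<open>Pieces of a path on a dendrite\<close>

lemma mem_slab_iff: "z \<in> slab x u \<mu> j \<longleftrightarrow> \<mu> * (of_int j + x) \<le> z \<bullet> u \<and> z \<bullet> u \<le> \<mu> * (of_int j + 1 + x)"
  by (simp add: slab_def)

definition slab_interior :: "real \<Rightarrow> 'b::real_inner \<Rightarrow> real \<Rightarrow> int \<Rightarrow> 'b set" where
  "slab_interior x u \<mu> j = {z. \<mu> * (of_int j + x) < z \<bullet> u \<and> z \<bullet> u < \<mu> * (of_int j + 1 + x)}"

lemma slab_interior_subset: "slab_interior x u \<mu> j \<subseteq> slab x u \<mu> j"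
  by (auto simp: slab_def slab_interior_def)

lemma open_slab_interior: "open (slab_interior x u \<mu> j)"
  unfolding slab_interior_def by (intro open_Collect_conj open_Collect_less continuous_intros)

lemma closed_slab: "closed (slab x u \<mu> j)"
  unfolding slab_def by (intro closed_Collect_conj closed_Collect_le continuous_intros)

lemma slab_ge_imp_index_le:
  fixes u :: "'b::real_inner"
  assumes "\<mu> > 0" "z \<in> slab x u \<mu> i" "z' \<in> slab x u \<mu> j" "z' \<bullet> u < z \<bullet> u"
  shows "j \<le> i"
proof -
  have "\<mu> * (of_int j + x) < \<mu> * (of_int i + 1 + x)"
    using assms(2,3,4) by (simp add: mem_slab_iff)
  hence "of_int j + x < of_int i + 1 + x" using assms(1) by (simp add: mult_less_cancel_left)
  thus ?thesis by linarith
qed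

lemma slab_index_unique:
  fixes u :: "'b::real_inner"
  assumes "\<mu> > 0" "z \<in> slab x u \<mu> i" "z \<in> slab x u \<mu> j" "z' \<in> slab x u \<mu> i" "z' \<in> slab x u \<mu> j"
    "z \<bullet> u \<noteq> z' \<bullet> u"
  shows "i = j"
  using slab_ge_imp_index_le[OF assms(1,2,5)] slab_ge_imp_index_le[OF assms(1,3,4)]
    slab_ge_imp_index_le[OF assms(1,4,3)] slab_ge_imp_index_le[OF assms(1,5,2)] assms(6) by linarith

lemma slab_interior_index_unique:
  fixes u :: "'b::real_inner"
  assumes "\<mu> > 0" "z \<in> slab_interior x u \<mu> i" "z \<in> slab x u \<mu> j"
  shows "i = j"
proof -
  have "\<mu> * (of_int j + x) < \<mu> * (of_int i + 1 + x)" "\<mu> * (of_int i + x) < \<mu> * (of_int j + 1 + x)"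
    using assms(2,3) by (simp_all add: mem_slab_iff slab_interior_def)
  hence "of_int j + x < of_int i + 1 + x" "of_int i + x < of_int j + 1 + x"
    using assms(1) by (simp_all add: mult_less_cancel_left)
  thus ?thesis by linarith
qed

lemma width_empty [simp]: "width u {} = 0"
  by (simp add: width_def)

lemma abs_inner_diff_le_width:
  assumes "compact S" "p \<in> S" "q \<in> S"
  shows "\<bar>p \<bullet> u - q \<bullet> u\<bar> \<le> width u S"
proof -
  have "compact ((\<lambda>z. z \<bullet> u) ` S)" using assms(1) by (intro compact_continuous_image continuous_intros)
  hence "bounded ((\<lambda>z. z \<bullet> u) ` S)" by (rule compact_imp_bounded)
  from diameter_bounded_bound[OF this imageI[OF assms(2)] imageI[OF assms(3)]]
  show ?thesis by (simp add: width_def dist_real_def)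
qed

lemma width_attained:
  assumes "compact S" "S \<noteq> {}"
  obtains p q where "p \<in> S" "q \<in> S" "q \<bullet> u - p \<bullet> u = width u S"
proof -
  have "compact ((\<lambda>z. z \<bullet> u) ` S)" using assms(1) by (intro compact_continuous_image continuous_intros)
  then obtain a b where ab: "a \<in> (\<lambda>z. z \<bullet> u) ` S" "b \<in> (\<lambda>z. z \<bullet> u) ` S" "dist a b = diameter ((\<lambda>z. z \<bullet> u) ` S)"
    using diameter_compact_attained assms(2) by blast
  then obtain p q where pq: "p \<in> S" "q \<in> S" "\<bar>p \<bullet> u - q \<bullet> u\<bar> = width u S"
    by (auto simp: width_def dist_real_def)
  show ?thesis
    by (cases "p \<bullet> u \<le> q \<bullet> u") (use pq that[of p q] that[of q p] in auto)
qed

lemma width_leI: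
  assumes "compact S" "0 \<le> b" "\<And>p q. p \<in> S \<Longrightarrow> q \<in> S \<Longrightarrow> q \<bullet> u - p \<bullet> u \<le> b"
  shows "width u S \<le> b"
proof (cases "S = {}")
  case False
  then obtain p q where "p \<in> S" "q \<in> S" "q \<bullet> u - p \<bullet> u = width u S"
    using width_attained[OF assms(1)] by metis
  thus ?thesis using assms(3) by fastforce
qed (use assms in simp)

lemma width_nonneg:
  assumes "compact S"
  shows "0 \<le> width u S"
proof (cases "S = {}")
  case False
  then obtain p where "p \<in> S" by blast
  from abs_inner_diff_le_width[OF assms this this] show ?thesis by simp
qed simp

lemma width_mono:
  assumes "compact S" "compact T" "S \<subseteq> T"
  shows "width u S \<le> width u T"
  using assms(3) abs_inner_diff_le_width[OF assms(2)]
  by (intro width_leI[OF assms(1)] width_nonneg[OF assms(2)]) (meson abs_le_D1 subsetD)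

lemma width_Un_le:
  assumes "compact S" "compact T" "z \<in> S" "z \<in> T"
  shows "width u (S \<union> T) \<le> width u S + width u T"
proof (rule width_leI)
  show "compact (S \<union> T)" using assms by blast
  show "0 \<le> width u S + width u T" using width_nonneg[of _ u] assms by (simp add: add_nonneg_nonneg)
  fix p q assume "p \<in> S \<union> T" "q \<in> S \<union> T"
  thus "q \<bullet> u - p \<bullet> u \<le> width u S + width u T"
    using abs_inner_diff_le_width[OF assms(1), of p q u] abs_inner_diff_le_width[OF assms(2), of p q u]
      abs_inner_diff_le_width[OF assms(1), of p z u] abs_inner_diff_le_width[OF assms(2), of z q u]
      abs_inner_diff_le_width[OF assms(2), of p z u] abs_inner_diff_le_width[OF assms(1), of z q u]
      width_nonneg[OF assms(1), of u] width_nonneg[OF assms(2), of u] assms(3,4)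
    by (elim UnE) auto
qed

lemma subcontinuum_component_slab:
  fixes X :: "'a::metric_space set" and \<gamma> :: "'a \<Rightarrow> 'b::real_inner"
  assumes "compact X" "continuous_on X \<gamma>" "C \<in> components (X \<inter> \<gamma> -` slab x u \<mu> j)"
  shows "subcontinuum C X"
proof -
  have "closed (X \<inter> \<gamma> -` slab x u \<mu> j)"
    using assms by (intro continuous_closed_preimage compact_imp_closed closed_slab)
  hence "closed C" using assms(3) by (rule closed_components)
  moreover have "C \<subseteq> X" using in_components_subset[OF assms(3)] by blast
  ultimately have "compact C" using assms(1) by (metis compact_Int_closed inf.absorb2)
  thus ?thesis
    using in_components_nonempty[OF assms(3)] in_components_connected[OF assms(3)] in_components_subset[OF assms(3)]
    by (auto simp: subcontinuum_def continuum_def)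
qed

lemma piecesE:
  assumes "C \<in> pieces X \<gamma> x u \<mu>"
  obtains j where "C \<in> components (X \<inter> \<gamma> -` slab x u \<mu> j)" "0 < width u (\<gamma> ` C)"
  using assms by (auto simp: pieces_def)

lemma compact_image_subcontinuum:
  assumes "continuous_on X \<gamma>" "subcontinuum C X"
  shows "compact (\<gamma> ` C)" "\<gamma> ` C \<noteq> {}"
  using assms subcontinuumD[of C X] by (auto intro: compact_continuous_image continuous_on_subset)

lemma piece_slab_index_unique:
  fixes \<gamma> :: "'a \<Rightarrow> 'b::real_inner"
  assumes "\<mu> > 0" "compact (\<gamma> ` T)" "0 < width u (\<gamma> ` T)"
    "T \<subseteq> \<gamma> -` slab x u \<mu> i" "T \<subseteq> \<gamma> -` slab x u \<mu> j"
  shows "i = j"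
proof -
  have "\<gamma> ` T \<noteq> {}" using assms(3) by (metis less_irrefl width_empty)
  then obtain p q where "p \<in> \<gamma> ` T" "q \<in> \<gamma> ` T" "q \<bullet> u - p \<bullet> u = width u (\<gamma> ` T)"
    using width_attained[OF assms(2)] by metis
  thus ?thesis using assms(3,4,5) by (intro slab_index_unique[OF assms(1), of p x u i j q]) auto
qed

lemma pieces_eqI:
  fixes X :: "'a::metric_space set" and \<gamma> :: "'a \<Rightarrow> 'b::real_inner"
  assumes "\<mu> > 0" "C \<in> pieces X \<gamma> x u \<mu>" "C' \<in> pieces X \<gamma> x u \<mu>"
    "compact (\<gamma> ` T)" "0 < width u (\<gamma> ` T)" "T \<subseteq> C" "T \<subseteq> C'"
  shows "C = C'"
proof -
  obtain i where i: "C \<in> components (X \<inter> \<gamma> -` slab x u \<mu> i)" using assms(2) by (rule piecesE)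
  obtain j where j: "C' \<in> components (X \<inter> \<gamma> -` slab x u \<mu> j)" using assms(3) by (rule piecesE)
  have "i = j"
    using assms(6,7) in_components_subset[OF i] in_components_subset[OF j]
    by (intro piece_slab_index_unique[OF assms(1,4,5)]) auto
  moreover have "T \<noteq> {}" using assms(5) by (metis image_empty less_irrefl width_empty)
  ultimately show ?thesis using i j components_eq[OF i, of C'] assms(6,7) by blast
qed

lemma connected_image_value:
  fixes \<gamma> :: "'a::metric_space \<Rightarrow> 'b::real_inner"
  assumes "connected C" "continuous_on C \<gamma>" "p \<in> C" "q \<in> C" "\<gamma> p \<bullet> u \<le> v" "v \<le> \<gamma> q \<bullet> u"
  obtains z where "z \<in> C" "\<gamma> z \<bullet> u = v"
proof -
  have "connected ((\<lambda>z. \<gamma> z \<bullet> u) ` C)"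
    using assms by (intro connected_continuous_image continuous_intros)
  from connected_contains_Icc[OF this imageI[OF assms(3)] imageI[OF assms(4)]]
  have "v \<in> (\<lambda>z. \<gamma> z \<bullet> u) ` C" using assms(5,6) by auto
  thus ?thesis using that by blast
qed

lemma slab_component_neighbourhood:
  fixes X :: "'a::metric_space set" and \<gamma> :: "'a \<Rightarrow> 'b::real_inner"
  assumes X: "locally connected X" and \<gamma>: "continuous_on X \<gamma>"
    and C: "C \<in> components (X \<inter> \<gamma> -` slab x u \<mu> j)" and p: "p \<in> C" "\<gamma> p \<in> slab_interior x u \<mu> j"
    and e: "e > 0"
  obtains W where "openin (top_of_set X) W" "connected W" "p \<in> W" "W \<subseteq> C"
    "\<And>z. z \<in> W \<Longrightarrow> \<gamma> z \<in> slab_interior x u \<mu> j \<and> \<bar>\<gamma> z \<bullet> u - \<gamma> p \<bullet> u\<bar> < e"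
proof -
  define O' where "O' = slab_interior x u \<mu> j \<inter> {y. \<bar>y \<bullet> u - \<gamma> p \<bullet> u\<bar> < e}"
  have "open O'" unfolding O'_def
    by (intro open_Int open_slab_interior open_Collect_less continuous_intros)
  hence "openin (top_of_set X) (X \<inter> \<gamma> -` O')"
    using \<gamma> by (simp add: continuous_openin_preimage_gen)
  moreover have "p \<in> X \<inter> \<gamma> -` O'"
    using p e in_components_subset[OF C] by (auto simp: O'_def)
  ultimately obtain W where W: "openin (top_of_set X) W" "connected W" "p \<in> W" "W \<subseteq> X \<inter> \<gamma> -` O'"
    using X unfolding locally_connected by meson
  have "W \<subseteq> X \<inter> \<gamma> -` slab x u \<mu> j"
    using W(4) slab_interior_subset[of x u \<mu> j] by (auto simp: O'_def)
  hence "W \<subseteq> C" using components_maximal[OF C W(2)] p W(3) by blast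
  thus ?thesis using that[OF W(1-3)] W(4) by (auto simp: O'_def)
qed

lemma finitely_many_wide_pieces_locally_connected:
  fixes X :: "'a::metric_space set" and \<gamma> :: "'a \<Rightarrow> 'b::real_inner"
  assumes X: "compact X" "locally connected X" and \<gamma>: "continuous_on X \<gamma>" and \<mu>: "\<mu> > 0"
  shows "finitely_many_wide_pieces X \<gamma> x u \<mu>"
  unfolding finitely_many_wide_pieces_def
proof (intro allI impI, rule ccontr)
  fix e :: real assume e: "e > 0"
  define Q where "Q = {C \<in> pieces X \<gamma> x u \<mu>. e \<le> width u (\<gamma> ` C)}"
  assume "infinite {C \<in> pieces X \<gamma> x u \<mu>. e \<le> width u (\<gamma> ` C)}"
  hence inf: "infinite Q" by (simp add: Q_def)
  have "\<exists>j p. C \<in> components (X \<inter> \<gamma> -` slab x u \<mu> j) \<and> p \<in> C \<and>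
      \<mu> * (of_int j + x) + e/2 \<le> \<gamma> p \<bullet> u \<and> \<gamma> p \<bullet> u \<le> \<mu> * (of_int j + 1 + x) - e/2" if "C \<in> Q" for C
  proof -
    obtain j where j: "C \<in> components (X \<inter> \<gamma> -` slab x u \<mu> j)"
      using \<open>C \<in> Q\<close> unfolding Q_def by (auto elim: piecesE)
    have w: "e \<le> width u (\<gamma> ` C)" using \<open>C \<in> Q\<close> by (simp add: Q_def)
    note sc = subcontinuum_component_slab[OF X(1) \<gamma> j]
    obtain p q where pq: "p \<in> C" "q \<in> C" "\<gamma> q \<bullet> u - \<gamma> p \<bullet> u = width u (\<gamma> ` C)"
      using width_attained[OF compact_image_subcontinuum[OF \<gamma> sc]] by blast
    have sl: "\<gamma> p \<in> slab x u \<mu> j" "\<gamma> q \<in> slab x u \<mu> j" using pq in_components_subset[OF j] by auto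
    have "continuous_on C \<gamma>" using \<gamma> subcontinuumD(1)[OF sc] by (rule continuous_on_subset)
    from connected_image_value[OF subcontinuumD(5)[OF sc] this pq(1,2), of u "(\<gamma> p \<bullet> u + \<gamma> q \<bullet> u) / 2"]
    obtain z where "z \<in> C" "\<gamma> z \<bullet> u = (\<gamma> p \<bullet> u + \<gamma> q \<bullet> u) / 2"
      using pq(3) w e by auto
    thus ?thesis using sl pq(3) w j by (intro exI[of _ j] exI[of _ z]) (auto simp: mem_slab_iff field_simps)
  qed
  then obtain j p where jp: "\<And>C. C \<in> Q \<Longrightarrow> C \<in> components (X \<inter> \<gamma> -` slab x u \<mu> (j C))"
    "\<And>C. C \<in> Q \<Longrightarrow> p C \<in> C"
    "\<And>C. C \<in> Q \<Longrightarrow> \<mu> * (of_int (j C) + x) + e/2 \<le> \<gamma> (p C) \<bullet> u"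
    "\<And>C. C \<in> Q \<Longrightarrow> \<gamma> (p C) \<bullet> u \<le> \<mu> * (of_int (j C) + 1 + x) - e/2" by metis
  have pint: "\<gamma> (p C) \<in> slab_interior x u \<mu> (j C)" if "C \<in> Q" for C
    using jp(3,4)[OF that] e by (auto simp: slab_interior_def)
  have eqI: "C = C'" if "C \<in> Q" "C' \<in> Q" "z \<in> C" "z \<in> C'" "\<gamma> z \<in> slab_interior x u \<mu> (j C)" for C C' z
  proof -
    have "\<gamma> z \<in> slab x u \<mu> (j C')" using in_components_subset[OF jp(1)[OF that(2)]] that(4) by auto
    hence "j C = j C'" using slab_interior_index_unique[OF \<mu> that(5)] by simp
    thus ?thesis using components_eq[OF jp(1)[OF that(1)], of C'] jp(1)[OF that(2)] that(3,4) by auto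
  qed
  have injp: "inj_on p Q"
    by (rule inj_onI) (metis eqI jp(2) pint)
  have "infinite (p ` Q)" using inf injp finite_imageD by blast
  moreover have "p ` Q \<subseteq> X" using jp(1,2) in_components_subset by fastforce
  ultimately obtain l where l: "l \<in> X" "l islimpt (p ` Q)"
    using X(1) compact_eq_Bolzano_Weierstrass by blast
  define O' where "O' = {y. \<bar>y \<bullet> u - \<gamma> l \<bullet> u\<bar> < e/4}"
  have "open O'" unfolding O'_def by (intro open_Collect_less continuous_intros)
  hence "openin (top_of_set X) (X \<inter> \<gamma> -` O')"
    using \<gamma> by (simp add: continuous_openin_preimage_gen)
  moreover have "l \<in> X \<inter> \<gamma> -` O'" using l e by (auto simp: O'_def)
  ultimately obtain W where W: "openin (top_of_set X) W" "connected W" "l \<in> W" "W \<subseteq> X \<inter> \<gamma> -` O'"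
    using X(2) unfolding locally_connected by meson
  obtain T where T: "open T" "W = X \<inter> T" using W(1) by (auto simp: openin_open)
  have WC: "W \<subseteq> C \<and> \<gamma> l \<in> slab_interior x u \<mu> (j C)" if C: "C \<in> Q" "p C \<in> W" for C
  proof -
    have "\<gamma> z \<in> slab_interior x u \<mu> (j C)" if "z \<in> W" for z
    proof -
      have "\<bar>\<gamma> z \<bullet> u - \<gamma> l \<bullet> u\<bar> < e/4" "\<bar>\<gamma> (p C) \<bullet> u - \<gamma> l \<bullet> u\<bar> < e/4"
        using W(4) that C(2) by (auto simp: O'_def)
      thus ?thesis using jp(3,4)[OF C(1)] unfolding slab_interior_def by (simp only: mem_Collect_eq) arith
    qed
    moreover from this have "W \<subseteq> C"
      using W(2,4) C jp(2)[OF C(1)] slab_interior_subset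
      by (intro components_maximal[OF jp(1)[OF C(1)]]) blast+
    ultimately show ?thesis using W(3) by blast
  qed
  have "l \<in> T" using W(3) T by blast
  then obtain y where y: "y \<in> p ` Q" "y \<in> T" "y \<noteq> l" using l(2) T(1) unfolding islimpt_def by blast
  have lT: "l \<in> T - {y}" "open (T - {y})" using \<open>l \<in> T\<close> y(3) T(1) by (auto intro: open_delete)
  obtain y' where "y' \<in> p ` Q" "y' \<in> T - {y}" using islimptE[OF l(2) lT] by metis
  hence y': "y' \<in> p ` Q" "y' \<in> T" "y' \<noteq> y" by auto
  obtain C C' where C: "C \<in> Q" "C' \<in> Q" "y = p C" "y' = p C'" using y y' by blast
  have "y \<in> W" "y' \<in> W" using y y' T \<open>p ` Q \<subseteq> X\<close> by auto
  hence "W \<subseteq> C" "W \<subseteq> C'" "\<gamma> l \<in> slab_interior x u \<mu> (j C)" using WC C by blast+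
  hence "C = C'" using eqI[OF C(1,2), of l] W(3) by blast
  thus False using C y' by blast
qed

lemma slab_component_Int:
  fixes X :: "'a::metric_space set" and \<gamma> :: "'a \<Rightarrow> 'b::real_inner"
  assumes X: "dendrite X" and A: "subcontinuum A X" and \<gamma>: "continuous_on X \<gamma>"
    and C: "C \<in> components (X \<inter> \<gamma> -` slab x u \<mu> j)" and ne: "C \<inter> A \<noteq> {}"
  shows "C \<inter> A \<in> components (A \<inter> \<gamma> -` slab x u \<mu> j)"
proof -
  note dX = dendriteD[OF X] and dA = subcontinuumD[OF A]
  have "subcontinuum C X" by (rule subcontinuum_component_slab[OF dX(2) \<gamma> C])
  hence con: "connected (C \<inter> A)" by (rule dendrite_unicoherent[OF X _ A])
  have sub: "C \<inter> A \<subseteq> A \<inter> \<gamma> -` slab x u \<mu> j" using in_components_subset[OF C] by auto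
  obtain C0 where C0: "C0 \<in> components (A \<inter> \<gamma> -` slab x u \<mu> j)" "C \<inter> A \<subseteq> C0"
    using exists_component_superset[OF sub _ con] sub ne by blast
  have "C0 \<subseteq> C"
    using in_components_connected[OF C0(1)] in_components_subset[OF C0(1)] C0(2) ne dA(1)
    by (intro components_maximal[OF C]) auto
  hence "C0 = C \<inter> A" using C0 in_components_subset[OF C0(1)] by blast
  thus ?thesis using C0 by simp
qed

lemma piece_Int:
  fixes X :: "'a::metric_space set" and \<gamma> :: "'a \<Rightarrow> 'b::real_inner"
  assumes X: "dendrite X" and A: "subcontinuum A X" and \<gamma>: "continuous_on X \<gamma>"
    and C: "C \<in> pieces X \<gamma> x u \<mu>" and w: "0 < width u (\<gamma> ` (C \<inter> A))"
  shows "C \<inter> A \<in> pieces A \<gamma> x u \<mu>"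
proof -
  obtain j where "C \<in> components (X \<inter> \<gamma> -` slab x u \<mu> j)" using C by (rule piecesE)
  moreover have "C \<inter> A \<noteq> {}" using w by (metis image_empty less_irrefl width_empty)
  ultimately show ?thesis using slab_component_Int[OF X A \<gamma>] w unfolding pieces_def by blast
qed

lemma compact_image_piece_Int:
  fixes X :: "'a::metric_space set" and \<gamma> :: "'a \<Rightarrow> 'b::real_inner"
  assumes "compact X" "continuous_on X \<gamma>" "C \<in> pieces X \<gamma> x u \<mu>" "subcontinuum A X"
  shows "compact (\<gamma> ` (C \<inter> A))" "compact (\<gamma> ` C)" "connected C" "compact C"
proof -
  obtain j where "C \<in> components (X \<inter> \<gamma> -` slab x u \<mu> j)" using assms(3) by (rule piecesE)
  from subcontinuum_component_slab[OF assms(1,2) this] have sc: "subcontinuum C X" .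
  show "connected C" "compact C" using subcontinuumD[OF sc] by auto
  thus "compact (\<gamma> ` (C \<inter> A))" "compact (\<gamma> ` C)"
    using subcontinuumD[OF assms(4)] subcontinuumD(1)[OF sc] assms(2)
    by (auto intro!: compact_continuous_image compact_Int intro: continuous_on_subset)
qed

lemma piece_subset_piece:
  fixes X :: "'a::metric_space set" and \<gamma> :: "'a \<Rightarrow> 'b::real_inner"
  assumes X: "dendrite X" and A: "subcontinuum A X" and \<gamma>: "continuous_on X \<gamma>" and \<mu>: "\<mu> > 0"
    and C: "C \<in> pieces A \<gamma> x u \<mu>"
  obtains C' where "C' \<in> pieces X \<gamma> x u \<mu>" "C' \<inter> A = C" "width u (\<gamma> ` C) \<le> width u (\<gamma> ` C')"
proof -
  note dX = dendriteD[OF X] and dA = subcontinuumD[OF A]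
  have \<gamma>A: "continuous_on A \<gamma>" using \<gamma> dA(1) by (rule continuous_on_subset)
  obtain j where j: "C \<in> components (A \<inter> \<gamma> -` slab x u \<mu> j)" and w: "0 < width u (\<gamma> ` C)"
    using C by (rule piecesE)
  have sub: "C \<subseteq> X \<inter> \<gamma> -` slab x u \<mu> j" using in_components_subset[OF j] dA(1) by auto
  note ne = in_components_nonempty[OF j] and con = in_components_connected[OF j]
  obtain C' where C': "C' \<in> components (X \<inter> \<gamma> -` slab x u \<mu> j)" "C \<subseteq> C'"
    using exists_component_superset[OF sub _ con] sub ne by blast
  have CA: "C \<subseteq> A" using in_components_subset[OF j] by auto
  have "C' \<inter> A \<in> components (A \<inter> \<gamma> -` slab x u \<mu> j)"
    using C' CA ne by (intro slab_component_Int[OF X A \<gamma>]) auto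
  hence eq: "C' \<inter> A = C" using components_eq[OF _ j, of "C' \<inter> A"] C' CA ne by blast
  have "subcontinuum C A" "subcontinuum C' X"
    using subcontinuum_component_slab dX(2) dA(3) \<gamma> \<gamma>A j C'(1) by blast+
  hence le: "width u (\<gamma> ` C) \<le> width u (\<gamma> ` C')"
    using compact_image_subcontinuum \<gamma> \<gamma>A C'(2) by (intro width_mono) blast+
  have "C' \<in> pieces X \<gamma> x u \<mu>" using C'(1) w le unfolding pieces_def by force
  thus ?thesis using that eq le by blast
qed

lemma pieces_extension:
  fixes X :: "'a::metric_space set" and \<gamma> :: "'a \<Rightarrow> 'b::real_inner"
  assumes X: "dendrite X" and A: "subcontinuum A X" and \<gamma>: "continuous_on X \<gamma>" and \<mu>: "\<mu> > 0"
  obtains \<phi> where "inj_on \<phi> (pieces A \<gamma> x u \<mu>)" "\<phi> ` pieces A \<gamma> x u \<mu> \<subseteq> pieces X \<gamma> x u \<mu>"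
    "\<And>C. C \<in> pieces A \<gamma> x u \<mu> \<Longrightarrow> width u (\<gamma> ` C) \<le> width u (\<gamma> ` \<phi> C)"
    "\<And>C. C \<in> pieces A \<gamma> x u \<mu> \<Longrightarrow> \<phi> C \<inter> A = C"
proof -
  have "\<forall>C\<in>pieces A \<gamma> x u \<mu>. \<exists>C'. C' \<in> pieces X \<gamma> x u \<mu> \<and> C' \<inter> A = C \<and> width u (\<gamma> ` C) \<le> width u (\<gamma> ` C')"
    using piece_subset_piece[OF X A \<gamma> \<mu>] by metis
  then obtain \<phi> where \<phi>: "\<And>C. C \<in> pieces A \<gamma> x u \<mu> \<Longrightarrow>
      \<phi> C \<in> pieces X \<gamma> x u \<mu> \<and> \<phi> C \<inter> A = C \<and> width u (\<gamma> ` C) \<le> width u (\<gamma> ` \<phi> C)"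
    by metis
  show ?thesis
    by (rule that[of \<phi>]) (use \<phi> in \<open>auto intro!: inj_onI\<close>, metis+)
qed

lemma finitely_many_wide_pieces_dendrite:
  assumes "dendrite X" "continuous_on X \<gamma>" "\<mu> > 0"
  shows "finitely_many_wide_pieces X \<gamma> x u \<mu>"
  using finitely_many_wide_pieces_locally_connected dendriteD[OF assms(1)] assms(2,3) by blast

lemma weighted_width_subcontinuum_le:
  fixes X :: "'a::metric_space set" and \<gamma> :: "'a \<Rightarrow> 'b::real_inner"
  assumes X: "dendrite X" and A: "subcontinuum A X" and \<gamma>: "continuous_on X \<gamma>" and \<mu>: "\<mu> > 0"
  shows "weighted_width A \<gamma> x u \<mu> \<le> weighted_width X \<gamma> x u \<mu>"
proof -
  have \<gamma>A: "continuous_on A \<gamma>" using \<gamma> subcontinuumD(1)[OF A] by (rule continuous_on_subset)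
  show ?thesis
    by (rule pieces_extension[OF X A \<gamma> \<mu>, of x u],
        rule weighted_width_mono[OF finitely_many_wide_pieces_dendrite[OF dendrite_subcontinuum[OF X A] \<gamma>A \<mu>]
          finitely_many_wide_pieces_dendrite[OF X \<gamma> \<mu>]])
qed

lemma weighted_width_subcontinuum_less:
  fixes X :: "'a::metric_space set" and \<gamma> :: "'a \<Rightarrow> 'b::real_inner"
  assumes X: "dendrite X" and A: "subcontinuum A X" and \<gamma>: "continuous_on X \<gamma>" and \<mu>: "\<mu> > 0"
    and E: "E \<in> pieces X \<gamma> x u \<mu>" "E \<inter> A = {}"
  shows "weighted_width A \<gamma> x u \<mu> < weighted_width X \<gamma> x u \<mu>"
proof (rule pieces_extension[OF X A \<gamma> \<mu>, of x u])
  fix \<phi> assume \<phi>: "inj_on \<phi> (pieces A \<gamma> x u \<mu>)" "\<phi> ` pieces A \<gamma> x u \<mu> \<subseteq> pieces X \<gamma> x u \<mu>"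
    "\<And>C. C \<in> pieces A \<gamma> x u \<mu> \<Longrightarrow> width u (\<gamma> ` C) \<le> width u (\<gamma> ` \<phi> C)"
    "\<And>C. C \<in> pieces A \<gamma> x u \<mu> \<Longrightarrow> \<phi> C \<inter> A = C"
  have \<gamma>A: "continuous_on A \<gamma>" using \<gamma> subcontinuumD(1)[OF A] by (rule continuous_on_subset)
  have "E \<notin> \<phi> ` pieces A \<gamma> x u \<mu>"
  proof
    assume "E \<in> \<phi> ` pieces A \<gamma> x u \<mu>"
    then obtain C where C: "C \<in> pieces A \<gamma> x u \<mu>" "E = \<phi> C" by blast
    hence "C = {}" using \<phi>(4) E(2) by blast
    thus False using pieces_width_pos[OF C(1)] by simp
  qed
  thus ?thesis
    using weighted_width_strict_mono[OF finitely_many_wide_pieces_dendrite[OF dendrite_subcontinuum[OF X A] \<gamma>A \<mu>]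
          finitely_many_wide_pieces_dendrite[OF X \<gamma> \<mu>] \<phi>(1-3) E(1)] by blast
qed

lemma weighted_width_Un_le:
  fixes X :: "'a::metric_space set" and \<gamma> :: "'a \<Rightarrow> 'b::real_inner"
  assumes X: "dendrite X" and A: "subcontinuum A X" and B: "subcontinuum B X" and AB: "A \<union> B = X"
    and \<gamma>: "continuous_on X \<gamma>" and \<mu>: "\<mu> > 0"
  shows "weighted_width X \<gamma> x u \<mu> \<le> weighted_width A \<gamma> x u \<mu> + weighted_width B \<gamma> x u \<mu>"
proof (rule weighted_width_leI[OF finitely_many_wide_pieces_dendrite[OF X \<gamma> \<mu>]])
  note dX = dendriteD[OF X] and dA = subcontinuumD[OF A] and dB = subcontinuumD[OF B]
  fix M :: nat and c assume c: "inj_on c {..<M}" "c ` {..<M} \<subseteq> pieces X \<gamma> x u \<mu>"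
  have part: "(\<Sum>k<M. (1/2)^k * width u (\<gamma> ` (c k \<inter> Y))) \<le> weighted_width Y \<gamma> x u \<mu>"
    if Y: "subcontinuum Y X" for Y
  proof -
    define S where "S = {k\<in>{..<M}. 0 < width u (\<gamma> ` (c k \<inter> Y))}"
    have cp: "c k \<in> pieces X \<gamma> x u \<mu>" "0 < width u (\<gamma> ` (c k \<inter> Y))" if "k \<in> S" for k
      using that c(2) by (auto simp: S_def)
    have \<gamma>Y: "continuous_on Y \<gamma>" using \<gamma> subcontinuumD(1)[OF Y] by (rule continuous_on_subset)
    have "(\<Sum>k<M. (1/2)^k * width u (\<gamma> ` (c k \<inter> Y))) = (\<Sum>k\<in>S. (1/2)^k * width u (\<gamma> ` (c k \<inter> Y)))"
    proof (rule sum.mono_neutral_right)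
      show "\<forall>k\<in>{..<M} - S. (1/2)^k * width u (\<gamma> ` (c k \<inter> Y)) = 0"
      proof
        fix k assume k: "k \<in> {..<M} - S"
        hence "c k \<in> pieces X \<gamma> x u \<mu>" using c(2) by auto
        from width_nonneg[OF compact_image_piece_Int(1)[OF dX(2) \<gamma> this Y], of u]
        show "(1/2)^k * width u (\<gamma> ` (c k \<inter> Y)) = 0" using k by (auto simp: S_def)
      qed
    qed (auto simp: S_def)
    also have "\<dots> \<le> weighted_width Y \<gamma> x u \<mu>"
    proof (rule weighted_sum_le_weighted_width[OF finitely_many_wide_pieces_dendrite[OF dendrite_subcontinuum[OF X Y] \<gamma>Y \<mu>]])
      show "inj_on (\<lambda>k. c k \<inter> Y) S"
      proof (rule inj_onI)
        fix k l assume kl: "k \<in> S" "l \<in> S" "c k \<inter> Y = c l \<inter> Y"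
        have "c k = c l"
          using kl by (intro pieces_eqI[OF \<mu> cp(1)[OF kl(1)] cp(1)[OF kl(2)]
            compact_image_piece_Int(1)[OF dX(2) \<gamma> cp(1)[OF kl(1)] Y] cp(2)[OF kl(1)]]) auto
        thus "k = l" using c(1) kl by (auto simp: S_def dest: inj_onD)
      qed
      show "(\<lambda>k. c k \<inter> Y) ` S \<subseteq> pieces Y \<gamma> x u \<mu>"
        using piece_Int[OF X Y \<gamma>] cp by blast
    qed (simp add: S_def)
    finally show ?thesis .
  qed
  have "width u (\<gamma> ` c k) \<le> width u (\<gamma> ` (c k \<inter> A)) + width u (\<gamma> ` (c k \<inter> B))" if "k < M" for k
  proof -
    have ck: "c k \<in> pieces X \<gamma> x u \<mu>" using c(2) that by auto
    note cA = compact_image_piece_Int[OF dX(2) \<gamma> ck A] and cB = compact_image_piece_Int[OF dX(2) \<gamma> ck B]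
    obtain j where "c k \<in> components (X \<inter> \<gamma> -` slab x u \<mu> j)" using ck by (rule piecesE)
    hence U: "c k = (c k \<inter> A) \<union> (c k \<inter> B)" using in_components_subset AB by blast
    consider "c k \<inter> A = {}" | "c k \<inter> B = {}" | z where "z \<in> c k \<inter> A" "z \<in> c k \<inter> B"
    proof -
      have "closed (c k \<inter> A)" "closed (c k \<inter> B)"
        using cA(4) dA(4) dB(4) by (auto intro: closed_Int compact_imp_closed)
      moreover have "\<not> (\<exists>S T. closed S \<and> closed T \<and> S \<noteq> {} \<and> T \<noteq> {} \<and> S \<union> T = c k \<and> S \<inter> T = {})"
        using cA(3) connected_closed_set[OF compact_imp_closed[OF cA(4)]] by simp
      ultimately have "c k \<inter> A = {} \<or> c k \<inter> B = {} \<or> (c k \<inter> A) \<inter> (c k \<inter> B) \<noteq> {}"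
        using U by metis
      thus thesis using that by blast
    qed
    thus ?thesis
    proof cases
      case 1 thus ?thesis using U by simp
    next
      case 2 thus ?thesis using U by simp
    next
      case 3
      have "\<gamma> ` c k = \<gamma> ` (c k \<inter> A) \<union> \<gamma> ` (c k \<inter> B)" using U by blast
      thus ?thesis using width_Un_le[OF cA(1) cB(1) imageI[OF 3(1)] imageI[OF 3(2)]] by simp
    qed
  qed
  hence "(\<Sum>k<M. (1/2)^k * width u (\<gamma> ` c k)) \<le>
      (\<Sum>k<M. (1/2)^k * (width u (\<gamma> ` (c k \<inter> A)) + width u (\<gamma> ` (c k \<inter> B))))"
    by (intro sum_mono mult_left_mono) auto
  also have "\<dots> = (\<Sum>k<M. (1/2)^k * width u (\<gamma> ` (c k \<inter> A))) + (\<Sum>k<M. (1/2)^k * width u (\<gamma> ` (c k \<inter> B)))"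
    by (simp add: sum.distrib distrib_left)
  also have "\<dots> \<le> weighted_width A \<gamma> x u \<mu> + weighted_width B \<gamma> x u \<mu>"
    using part[OF A] part[OF B] by simp
  finally show "(\<Sum>k<M. (1/2)^k * width u (\<gamma> ` c k)) \<le> weighted_width A \<gamma> x u \<mu> + weighted_width B \<gamma> x u \<mu>" .
qed

lemma piece_Int_same_image:
  fixes X :: "'a::metric_space set" and \<gamma> :: "'a \<Rightarrow> 'b::real_inner"
  assumes X: "dendrite X" and A: "subcontinuum A X" and \<gamma>: "continuous_on X \<gamma>"
    and const: "\<And>D. D \<in> components (X - A) \<Longrightarrow> \<gamma> constant_on D"
    and C: "C \<in> components (X \<inter> \<gamma> -` slab x u \<mu> j)"
  shows "\<gamma> ` (C \<inter> A) = \<gamma> ` C"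
proof (intro equalityI subsetI)
  note dX = dendriteD[OF X]
  fix y assume "y \<in> \<gamma> ` C"
  then obtain z where z: "z \<in> C" "y = \<gamma> z" by blast
  show "y \<in> \<gamma> ` (C \<inter> A)"
  proof (cases "z \<in> A")
    case False
    hence "z \<in> X - A" using z in_components_subset[OF C] by auto
    then obtain D where D: "D \<in> components (X - A)" "z \<in> D" using Union_components by blast
    obtain a where a: "a \<in> A" "closure D = insert a D"
      using dendrite_complement_component[OF X A D(1)] by metis
    have DX: "closure D \<subseteq> X"
      using closure_minimal[OF _ dX(3)] in_components_subset[OF D(1)] by blast
    have cD: "\<gamma> w = \<gamma> z" if "w \<in> D" for w using const[OF D(1)] D(2) that by (metis constant_on_def)
    have cl: "\<gamma> w = \<gamma> z" if "w \<in> closure D" for w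
      by (rule continuous_constant_on_closure[OF _ cD that]) (use \<gamma> DX continuous_on_subset in blast)
    have "connected (closure D)" by (intro connected_imp_connected_closure in_components_connected[OF D(1)])
    moreover have "\<gamma> z \<in> slab x u \<mu> j" using z in_components_subset[OF C] by auto
    hence "closure D \<subseteq> X \<inter> \<gamma> -` slab x u \<mu> j" using DX cl by auto
    moreover have "z \<in> closure D" using D(2) closure_subset by blast
    ultimately have "closure D \<subseteq> C" using components_maximal[OF C] z by blast
    thus ?thesis using a cl[of a] z by (metis IntI image_eqI insertI1 subsetD)
  qed (use z in blast)
qed blast

lemma weighted_width_subcontinuum_eq:
  fixes X :: "'a::metric_space set" and \<gamma> :: "'a \<Rightarrow> 'b::real_inner"
  assumes X: "dendrite X" and A: "subcontinuum A X" and \<gamma>: "continuous_on X \<gamma>" and \<mu>: "\<mu> > 0"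
    and const: "\<And>D. D \<in> components (X - A) \<Longrightarrow> \<gamma> constant_on D"
  shows "weighted_width A \<gamma> x u \<mu> = weighted_width X \<gamma> x u \<mu>"
proof (rule antisym)
  have \<gamma>A: "continuous_on A \<gamma>" using \<gamma> subcontinuumD(1)[OF A] by (rule continuous_on_subset)
  show "weighted_width A \<gamma> x u \<mu> \<le> weighted_width X \<gamma> x u \<mu>"
    by (rule weighted_width_subcontinuum_le[OF X A \<gamma> \<mu>])
  have im: "\<gamma> ` (C \<inter> A) = \<gamma> ` C" if "C \<in> pieces X \<gamma> x u \<mu>" for C
    using that piece_Int_same_image[OF X A \<gamma> const] by (auto elim!: piecesE)
  have wp: "0 < width u (\<gamma> ` (C \<inter> A))" if "C \<in> pieces X \<gamma> x u \<mu>" for C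
    using im[OF that] pieces_width_pos[OF that] by simp
  show "weighted_width X \<gamma> x u \<mu> \<le> weighted_width A \<gamma> x u \<mu>"
  proof (rule weighted_width_mono[OF finitely_many_wide_pieces_dendrite[OF X \<gamma> \<mu>]
      finitely_many_wide_pieces_dendrite[OF dendrite_subcontinuum[OF X A] \<gamma>A \<mu>]])
    show "inj_on (\<lambda>C. C \<inter> A) (pieces X \<gamma> x u \<mu>)"
    proof (rule inj_onI)
      fix C C' assume C: "C \<in> pieces X \<gamma> x u \<mu>" "C' \<in> pieces X \<gamma> x u \<mu>" "C \<inter> A = C' \<inter> A"
      show "C = C'"
        using C by (intro pieces_eqI[OF \<mu> C(1,2)
          compact_image_piece_Int(1)[OF dendriteD(2)[OF X] \<gamma> C(1) A] wp[OF C(1)]]) auto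
    qed
    show "(\<lambda>C. C \<inter> A) ` pieces X \<gamma> x u \<mu> \<subseteq> pieces A \<gamma> x u \<mu>"
      using piece_Int[OF X A \<gamma> _ wp] by blast
    show "width u (\<gamma> ` C) \<le> width u (\<gamma> ` (C \<inter> A))" if "C \<in> pieces X \<gamma> x u \<mu>" for C
      using im[OF that] by simp
  qed
qed

lemma slab_between:
  fixes \<mu> :: real
  assumes "\<mu> > 0" "lo + 2 * \<mu> < hi"
  obtains j :: int where "lo < \<mu> * (of_int j + x)" "\<mu> * (of_int j + 1 + x) < hi"
proof -
  define j where "j = \<lfloor>lo / \<mu> - x\<rfloor> + 1"
  have "lo / \<mu> - x < of_int j" "of_int j \<le> lo / \<mu> - x + 1" unfolding j_def by linarith+
  hence "lo / \<mu> < of_int j + x" "of_int j + x \<le> lo / \<mu> + 1" by linarith+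
  hence 1: "lo < \<mu> * (of_int j + x)" and 2: "\<mu> * (of_int j + x) \<le> lo + \<mu>"
    using assms(1) by (simp_all add: field_simps)
  have "\<mu> * (of_int j + 1 + x) = \<mu> * (of_int j + x) + \<mu>" by (simp add: algebra_simps)
  thus ?thesis using that[of j] 1 2 assms by linarith
qed

lemma piece_disjoint_subcontinuum:
  fixes X :: "'a::metric_space set" and \<gamma> :: "'a \<Rightarrow> 'b::real_inner"
  assumes X: "dendrite X" and A: "subcontinuum A X" and \<gamma>: "continuous_on X \<gamma>" and \<mu>: "\<mu> > 0"
    and D: "D \<in> components (X - A)" "closure D = insert a D" "openin (top_of_set X) D" "a \<in> A" "z \<in> D"
    and far: "2 * \<mu> < \<bar>\<gamma> z \<bullet> u - \<gamma> a \<bullet> u\<bar>"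
  obtains E where "E \<in> pieces X \<gamma> x u \<mu>" "E \<inter> A = {}"
proof -
  note dX = dendriteD[OF X] and dA = subcontinuumD[OF A]
  have DX: "closure D \<subseteq> X"
    using closure_minimal[OF _ dX(3)] in_components_subset[OF D(1)] by blast
  have DA: "D \<inter> A = {}" using in_components_subset[OF D(1)] by blast
  have cl: "connected (closure D)" "continuous_on (closure D) \<gamma>"
    using in_components_connected[OF D(1)] \<gamma> DX continuous_on_subset connected_imp_connected_closure by blast+
  define lo where "lo = min (\<gamma> z \<bullet> u) (\<gamma> a \<bullet> u)"
  define hi where "hi = max (\<gamma> z \<bullet> u) (\<gamma> a \<bullet> u)"
  have "lo + 2 * \<mu> < hi" using far unfolding lo_def hi_def by linarith
  then obtain j :: int where j: "lo < \<mu> * (of_int j + x)" "\<mu> * (of_int j + 1 + x) < hi"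
    using slab_between[OF \<mu>] by metis
  define v where "v = \<mu> * (of_int j + x) + \<mu> / 2"
  have v: "\<mu> * (of_int j + x) < v" "v < \<mu> * (of_int j + 1 + x)" using \<mu> by (simp_all add: v_def algebra_simps)
  have az: "a \<in> closure D" "z \<in> closure D" using D by auto
  obtain y where y: "y \<in> closure D" "\<gamma> y \<bullet> u = v"
  proof (cases "\<gamma> z \<bullet> u \<le> \<gamma> a \<bullet> u")
    case True
    show thesis
      by (rule connected_image_value[OF cl az(2,1), of u v])
        (use True j v that in \<open>auto simp: lo_def hi_def\<close>)
  next
    case False
    show thesis
      by (rule connected_image_value[OF cl az, of u v])
        (use False j v that in \<open>auto simp: lo_def hi_def\<close>)
  qed
  have a_out: "\<gamma> a \<notin> slab x u \<mu> j" using j v by (auto simp: mem_slab_iff lo_def hi_def min_def max_def split: if_splits)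
  have y_in: "\<gamma> y \<in> slab_interior x u \<mu> j" using y v by (simp add: slab_interior_def)
  hence y_slab: "y \<in> X \<inter> \<gamma> -` slab x u \<mu> j" 
    using slab_interior_subset[of x u \<mu> j] y(1) DX by auto
  have "y \<noteq> a" using a_out y_slab by auto
  hence yD: "y \<in> D" using y(1) D(2) by blast
  define E where "E = connected_component_set (X \<inter> \<gamma> -` slab x u \<mu> j) y"
  have E: "E \<in> components (X \<inter> \<gamma> -` slab x u \<mu> j)" unfolding E_def using y_slab by (rule componentsI)
  have yE: "y \<in> E" using y_slab by (simp add: E_def)
  have aE: "a \<notin> E" using in_components_subset[OF E] a_out by auto
  note sc = subcontinuum_component_slab[OF dX(2) \<gamma> E]
  note cE = compact_image_subcontinuum[OF \<gamma> sc]
  have "0 < width u (\<gamma> ` E)"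
  proof (rule ccontr)
    assume "\<not> 0 < width u (\<gamma> ` E)"
    hence const: "\<gamma> w \<bullet> u = v" if "w \<in> E" for w
      using abs_inner_diff_le_width[OF cE(1) imageI[OF that] imageI[OF yE], of u] y(2) by simp
    have "\<exists>T. openin (top_of_set X) T \<and> w \<in> T \<and> T \<subseteq> E" if "w \<in> E" for w
    proof -
      have "\<gamma> w \<in> slab_interior x u \<mu> j" using const[OF that] v by (simp add: slab_interior_def)
      from slab_component_neighbourhood[OF dX(5) \<gamma> E that this zero_less_one]
      obtain W where "openin (top_of_set X) W" "w \<in> W" "W \<subseteq> E" by metis
      thus ?thesis by blast
    qed
    hence "openin (top_of_set X) E" using openin_subopen[of "top_of_set X" E] by blast
    moreover have "closedin (top_of_set X) E" using subcontinuumD[OF sc] by (auto intro: closed_subset)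
    ultimately have "E = X" using connected_clopen[THEN iffD1, OF dX(4)] yE by blast
    thus False using aE D(4) dA(1) by blast
  qed
  hence "E \<in> pieces X \<gamma> x u \<mu>" using E by (auto simp: pieces_def)
  moreover have "E \<subseteq> D"
  proof -
    have ED: "E \<inter> D = E \<inter> closure D" using aE D(2) by auto
    have "openin (top_of_set E) (E \<inter> D)"
      using D(3) subcontinuumD(1)[OF sc] by (auto simp: openin_open)
    moreover have "closedin (top_of_set E) (E \<inter> D)"
      unfolding ED by (simp add: closedin_closed_Int)
    ultimately have "E \<inter> D = E"
      using connected_clopen[THEN iffD1, OF subcontinuumD(5)[OF sc]] yE yD by blast
    thus ?thesis by blast
  qed
  ultimately show ?thesis using that[of E] DA by blast
qed


subsection \<open>Measurability of the weighted width\<close>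

lemma compact_imp_countable_dense:
  fixes X :: "'a::metric_space set"
  assumes "compact X"
  obtains D where "countable D" "D \<subseteq> X" "X \<subseteq> closure D"
proof -
  have "\<exists>k. finite k \<and> k \<subseteq> X \<and> X \<subseteq> (\<Union>x\<in>k. ball x (1 / Suc n))" for n
  proof -
    have "X \<subseteq> (\<Union>x\<in>X. ball x (1 / Suc n))" by force
    from compactE_image[OF assms open_ball this] show ?thesis by metis
  qed
  then obtain k where k: "\<And>n. finite (k n)" "\<And>n. k n \<subseteq> X" "\<And>n. X \<subseteq> (\<Union>x\<in>k n. ball x (1 / Suc n))"
    by metis
  show ?thesis
  proof (rule that[of "\<Union>n. k n"])
    show "countable (\<Union>n. k n)" using k(1) by (simp add: countable_finite)
    show "(\<Union>n. k n) \<subseteq> X" using k(2) by blast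
    show "X \<subseteq> closure (\<Union>n. k n)"
    proof
      fix x assume x: "x \<in> X"
      show "x \<in> closure (\<Union>n. k n)"
        unfolding closure_approachable
      proof (intro allI impI)
        fix e :: real assume "e > 0"
        then obtain n where n: "inverse (real (Suc n)) < e" using reals_Archimedean by blast
        obtain y where "y \<in> k n" "x \<in> ball y (1 / Suc n)" using k(3)[of n] x by blast
        thus "\<exists>y\<in>(\<Union>n. k n). dist y x < e"
          using n by (intro bexI[of _ y]) (auto simp: inverse_eq_divide)
      qed
    qed
  qed
qed

lemma piece_dense_points:
  fixes X :: "'a::metric_space set" and \<gamma> :: "'a \<Rightarrow> 'b::real_inner"
  assumes X: "compact X" "locally connected X" and \<gamma>: "continuous_on X \<gamma>"
    and D: "D \<subseteq> X" "X \<subseteq> closure D" and C: "C \<in> pieces X \<gamma> x u \<mu>" and e: "e > 0"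
  obtains p q j where "p \<in> D \<inter> C" "q \<in> D \<inter> C" "C \<in> components (X \<inter> \<gamma> -` slab x u \<mu> j)"
    "\<gamma> p \<in> slab_interior x u \<mu> j" "\<gamma> p \<bullet> u \<noteq> \<gamma> q \<bullet> u"
    "width u (\<gamma> ` C) - e \<le> \<bar>\<gamma> p \<bullet> u - \<gamma> q \<bullet> u\<bar>"
proof -
  obtain j where j: "C \<in> components (X \<inter> \<gamma> -` slab x u \<mu> j)" and w: "0 < width u (\<gamma> ` C)"
    using C by (rule piecesE)
  note sc = subcontinuum_component_slab[OF X(1) \<gamma> j]
  have \<gamma>C: "continuous_on C \<gamma>" using \<gamma> subcontinuumD(1)[OF sc] by (rule continuous_on_subset)
  obtain P Q where PQ: "P \<in> C" "Q \<in> C" "\<gamma> Q \<bullet> u - \<gamma> P \<bullet> u = width u (\<gamma> ` C)"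
    using width_attained[OF compact_image_subcontinuum[OF \<gamma> sc]] by blast
  define h where "h = min e (width u (\<gamma> ` C)) / 8"
  have h: "h > 0" "8 * h \<le> e" "8 * h \<le> width u (\<gamma> ` C)" using e w by (auto simp: h_def)
  have sl: "\<gamma> P \<in> slab x u \<mu> j" "\<gamma> Q \<in> slab x u \<mu> j" using PQ in_components_subset[OF j] by auto
  have near: "\<exists>p. p \<in> D \<inter> C \<and> \<gamma> p \<in> slab_interior x u \<mu> j \<and> \<bar>\<gamma> p \<bullet> u - v\<bar> < h"
    if "\<gamma> P \<bullet> u + h \<le> v" "v \<le> \<gamma> Q \<bullet> u - h" for v
  proof -
    have "\<gamma> P \<bullet> u \<le> v" "v \<le> \<gamma> Q \<bullet> u" using that h(1) by linarith+
    from connected_image_value[OF subcontinuumD(5)[OF sc] \<gamma>C PQ(1,2) this]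
    obtain z where z: "z \<in> C" "\<gamma> z \<bullet> u = v" by metis
    have "\<gamma> z \<in> slab_interior x u \<mu> j"
      using sl z that h(1) by (auto simp: slab_interior_def mem_slab_iff)
    from slab_component_neighbourhood[OF X(2) \<gamma> j z(1) this h(1)]
    obtain W where W: "openin (top_of_set X) W" "z \<in> W" "W \<subseteq> C"
      "\<And>y. y \<in> W \<Longrightarrow> \<gamma> y \<in> slab_interior x u \<mu> j \<and> \<bar>\<gamma> y \<bullet> u - \<gamma> z \<bullet> u\<bar> < h" by metis
    obtain T where T: "open T" "W = X \<inter> T" using W(1) by (auto simp: openin_open)
    have "z \<in> closure D" "z \<in> T" using W(2) T(2) D(2) by auto
    hence "D \<inter> T \<noteq> {}" using T(1) open_Int_closure_eq_empty[of T D] by blast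
    then obtain p where "p \<in> D" "p \<in> W" using T(2) D(1) by blast
    thus ?thesis using W(3,4) z(2) by auto
  qed
  obtain p where p: "p \<in> D \<inter> C" "\<gamma> p \<in> slab_interior x u \<mu> j" "\<bar>\<gamma> p \<bullet> u - (\<gamma> P \<bullet> u + h)\<bar> < h"
    using near[of "\<gamma> P \<bullet> u + h"] PQ(3) h by auto
  obtain q where q: "q \<in> D \<inter> C" "\<bar>\<gamma> q \<bullet> u - (\<gamma> Q \<bullet> u - h)\<bar> < h"
    using near[of "\<gamma> Q \<bullet> u - h"] PQ(3) h by auto
  have "\<gamma> q \<bullet> u - \<gamma> p \<bullet> u \<ge> width u (\<gamma> ` C) - 4 * h" using p(3) q(2) PQ(3) by linarith
  hence "\<gamma> p \<bullet> u \<noteq> \<gamma> q \<bullet> u" "width u (\<gamma> ` C) - e \<le> \<bar>\<gamma> p \<bullet> u - \<gamma> q \<bullet> u\<bar>" using h by linarith+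
  thus ?thesis using that p(1,2) q(1) j by blast
qed

definition same_component ::
    "'a::metric_space set \<Rightarrow> ('a \<Rightarrow> 'b::real_inner) \<Rightarrow> real \<Rightarrow> 'b \<Rightarrow> real \<Rightarrow> 'a \<Rightarrow> 'a \<Rightarrow> bool" where
  "same_component X \<gamma> x u \<mu> p q \<longleftrightarrow>
     (\<exists>j. \<exists>C \<in> components (X \<inter> \<gamma> -` slab x u \<mu> j). p \<in> C \<and> q \<in> C)"

text \<open>By unicoherence a component contains two points iff it contains the arc between them, so the
  condition involves only the countably many rational points of one arc.\<close>

lemma same_component_iff_arc:
  fixes X :: "'a::metric_space set" and \<gamma> :: "'a \<Rightarrow> 'b::real_inner"
  assumes X: "dendrite X" and \<gamma>: "continuous_on X \<gamma>"
    and g: "path g" "path_image g \<subseteq> X" "pathstart g = p" "pathfinish g = q"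
      "\<And>C. subcontinuum C X \<Longrightarrow> p \<in> C \<Longrightarrow> q \<in> C \<Longrightarrow> path_image g \<subseteq> C"
  shows "same_component X \<gamma> x u \<mu> p q \<longleftrightarrow>
    (\<exists>j. \<forall>r::rat. real_of_rat r \<in> {0..1} \<longrightarrow> \<gamma> (g (real_of_rat r)) \<in> slab x u \<mu> j)"
proof
  assume "same_component X \<gamma> x u \<mu> p q"
  then obtain j C where C: "C \<in> components (X \<inter> \<gamma> -` slab x u \<mu> j)" "p \<in> C" "q \<in> C"
    by (auto simp: same_component_def)
  have "path_image g \<subseteq> C"
    by (rule g(5)[OF subcontinuum_component_slab[OF dendriteD(2)[OF X] \<gamma> C(1)] C(2,3)])
  hence "path_image g \<subseteq> \<gamma> -` slab x u \<mu> j" using in_components_subset[OF C(1)] by blast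
  hence "\<gamma> (g t) \<in> slab x u \<mu> j" if "t \<in> {0..1}" for t
    using that unfolding path_image_def by blast
  thus "\<exists>j. \<forall>r::rat. real_of_rat r \<in> {0..1} \<longrightarrow> \<gamma> (g (real_of_rat r)) \<in> slab x u \<mu> j" by blast
next
  assume "\<exists>j. \<forall>r::rat. real_of_rat r \<in> {0..1} \<longrightarrow> \<gamma> (g (real_of_rat r)) \<in> slab x u \<mu> j"
  then obtain j where j: "\<And>r::rat. real_of_rat r \<in> {0..1} \<Longrightarrow> \<gamma> (g (real_of_rat r)) \<in> slab x u \<mu> j" by blast
  have cont: "continuous_on {0..1} (\<lambda>t. \<gamma> (g t))"
    using g(1,2) unfolding path_def path_image_def
    by (intro continuous_on_compose2[OF \<gamma>])
  have "path_image g \<subseteq> X \<inter> \<gamma> -` slab x u \<mu> j"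
  proof -
    define T where "T = {0..1} \<inter> range (of_rat :: rat \<Rightarrow> real)"
    have "{0..1} \<subseteq> closure T"
    proof
      fix t :: real assume t: "t \<in> {0..1}"
      show "t \<in> closure T"
      proof (cases "t = 1")
        case True
        have "1 \<in> T" using rangeI[of "of_rat :: rat \<Rightarrow> real" 1] by (simp add: T_def)
        thus ?thesis using True closure_subset by blast
      next
        case False
        show ?thesis
          unfolding closure_approachable
        proof (intro allI impI)
          fix e :: real assume "e > 0"
          hence "t < min 1 (t + e)" using t False by auto
          then obtain r where "t < real_of_rat r" "real_of_rat r < min 1 (t + e)"
            using of_rat_dense by blast
          moreover from this have "real_of_rat r \<in> {0..1}"
            using t unfolding atLeastAtMost_iff min_less_iff_conj by linarith
          ultimately show "\<exists>y\<in>T. dist y t < e"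
            by (intro bexI[of _ "real_of_rat r"]) (auto simp: T_def dist_real_def simp del: atLeastAtMost_iff)
        qed
      qed
    qed
    hence "closure T = {0..1}" using closure_minimal[of T "{0..1}"] by (auto simp: T_def)
    moreover have "(\<lambda>t. \<gamma> (g t)) ` closure T \<subseteq> slab x u \<mu> j"
      using cont j calculation by (intro image_closure_subset closed_slab) (auto simp: T_def)
    ultimately show ?thesis using g(2) by (auto simp: path_image_def)
  qed
  moreover have "connected (path_image g)" using g(1) by (rule connected_path_image)
  moreover have "p \<in> path_image g" "q \<in> path_image g" using g(3,4) by auto
  ultimately obtain C where "C \<in> components (X \<inter> \<gamma> -` slab x u \<mu> j)" "path_image g \<subseteq> C"
    using exists_component_superset[of "path_image g" "X \<inter> \<gamma> -` slab x u \<mu> j"] by blast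
  thus "same_component X \<gamma> x u \<mu> p q"
    using \<open>p \<in> path_image g\<close> \<open>q \<in> path_image g\<close> unfolding same_component_def by blast
qed

lemma same_component_measurable:
  fixes X :: "'a::metric_space set" and \<gamma> :: "'a \<Rightarrow> 'b::euclidean_space"
  assumes X: "dendrite X" and \<gamma>: "continuous_on X \<gamma>" and pq: "p \<in> X" "q \<in> X"
  shows "Measurable.pred (borel \<Otimes>\<^sub>M borel \<Otimes>\<^sub>M borel) (\<lambda>(\<mu>, u, x). same_component X \<gamma> x u \<mu> p q)"
proof -
  obtain g where g: "path g" "path_image g \<subseteq> X" "pathstart g = p" "pathfinish g = q"
    "\<And>C. subcontinuum C X \<Longrightarrow> p \<in> C \<Longrightarrow> q \<in> C \<Longrightarrow> path_image g \<subseteq> C"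
    using dendrite_arc_hull[OF X pq] by metis
  have "same_component X \<gamma> x u \<mu> p q \<longleftrightarrow>
    (\<exists>j::int. \<forall>r::rat. real_of_rat r \<in> {0..1} \<longrightarrow> \<mu> * (of_int j + x) \<le> \<gamma> (g (real_of_rat r)) \<bullet> u \<and>
      \<gamma> (g (real_of_rat r)) \<bullet> u \<le> \<mu> * (of_int j + 1 + x))" for x u \<mu>
    using same_component_iff_arc[OF X \<gamma> g, of x u \<mu>] by (simp only: mem_slab_iff)
  thus ?thesis unfolding case_prod_beta by (simp only:) measurable
qed

text \<open>For each list \<open>l\<close> this is a Borel function of \<open>(\<mu>, u, x)\<close>, and the weighted width is its supremum
  over the countably many lists with entries in a countable dense set.\<close>

definition list_width ::
    "'a::metric_space set \<Rightarrow> ('a \<Rightarrow> 'b::real_inner) \<Rightarrow> real \<Rightarrow> 'b \<Rightarrow> real \<Rightarrow> ('a \<times> 'a) list \<Rightarrow> real" where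
  "list_width X \<gamma> x u \<mu> l =
     (if (\<forall>k<length l. same_component X \<gamma> x u \<mu> (fst (l ! k)) (snd (l ! k)) \<and>
            \<gamma> (fst (l ! k)) \<bullet> u \<noteq> \<gamma> (snd (l ! k)) \<bullet> u) \<and>
         (\<forall>k<length l. \<forall>m<k. \<not> same_component X \<gamma> x u \<mu> (fst (l ! k)) (fst (l ! m)))
      then \<Sum>k<length l. (1/2)^k * \<bar>\<gamma> (fst (l ! k)) \<bullet> u - \<gamma> (snd (l ! k)) \<bullet> u\<bar> else 0)"

lemma list_width_measurable:
  fixes X :: "'a::metric_space set" and \<gamma> :: "'a \<Rightarrow> 'b::euclidean_space"
  assumes X: "dendrite X" and \<gamma>: "continuous_on X \<gamma>" and l: "set l \<subseteq> X \<times> X"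
  shows "(\<lambda>(\<mu>, u, x). list_width X \<gamma> x u \<mu> l) \<in> borel_measurable (borel \<Otimes>\<^sub>M borel \<Otimes>\<^sub>M borel)"
proof -
  have lX: "fst (l ! k) \<in> X" "snd (l ! k) \<in> X" if "k < length l" for k
    using subsetD[OF l nth_mem[OF that]] by (auto simp: mem_Times_iff)
  have S: "Measurable.pred (borel \<Otimes>\<^sub>M borel \<Otimes>\<^sub>M borel)
      (\<lambda>y. same_component X \<gamma> (snd (snd y)) (fst (snd y)) (fst y) p q)"
    if "p \<in> X" "q \<in> X" for p q
    using same_component_measurable[OF X \<gamma> that] unfolding case_prod_beta .
  have [measurable]: "Measurable.pred (borel \<Otimes>\<^sub>M borel \<Otimes>\<^sub>M borel)
      (\<lambda>y. \<forall>k\<in>{..<length l}. same_component X \<gamma> (snd (snd y)) (fst (snd y)) (fst y) (fst (l ! k)) (snd (l ! k)) \<and>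
            \<gamma> (fst (l ! k)) \<bullet> fst (snd y) \<noteq> \<gamma> (snd (l ! k)) \<bullet> fst (snd y))"
    by (intro pred_intros_finite pred_intros_logic S lX) (auto intro!: measurable)
  have [measurable]: "Measurable.pred (borel \<Otimes>\<^sub>M borel \<Otimes>\<^sub>M borel)
      (\<lambda>y. \<forall>k\<in>{..<length l}. \<forall>m\<in>{..<k}. \<not> same_component X \<gamma> (snd (snd y)) (fst (snd y)) (fst y) (fst (l ! k)) (fst (l ! m)))"
    by (intro pred_intros_finite pred_intros_logic S lX) auto
  show ?thesis unfolding list_width_def case_prod_beta Ball_def[symmetric] lessThan_iff[symmetric] by measurable
qed

lemma list_width_le_weighted_width:
  fixes X :: "'a::metric_space set" and \<gamma> :: "'a \<Rightarrow> 'b::real_inner"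
  assumes X: "dendrite X" and \<gamma>: "continuous_on X \<gamma>" and \<mu>: "\<mu> > 0"
  shows "list_width X \<gamma> x u \<mu> l \<le> weighted_width X \<gamma> x u \<mu>"
proof (cases "(\<forall>k<length l. same_component X \<gamma> x u \<mu> (fst (l ! k)) (snd (l ! k)) \<and>
            \<gamma> (fst (l ! k)) \<bullet> u \<noteq> \<gamma> (snd (l ! k)) \<bullet> u) \<and>
         (\<forall>k<length l. \<forall>m<k. \<not> same_component X \<gamma> x u \<mu> (fst (l ! k)) (fst (l ! m)))")
  case True
  note fin = finitely_many_wide_pieces_dendrite[OF X \<gamma> \<mu>]
  define p where "p k = fst (l ! k)" for k
  define q where "q k = snd (l ! k)" for k
  have "\<exists>C j. C \<in> components (X \<inter> \<gamma> -` slab x u \<mu> j) \<and> p k \<in> C \<and> q k \<in> C" if "k < length l" for k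
    using True that unfolding same_component_def p_def q_def by blast
  then obtain C j where C: "\<And>k. k < length l \<Longrightarrow> C k \<in> components (X \<inter> \<gamma> -` slab x u \<mu> (j k))"
    "\<And>k. k < length l \<Longrightarrow> p k \<in> C k" "\<And>k. k < length l \<Longrightarrow> q k \<in> C k" by metis
  have le: "\<bar>\<gamma> (p k) \<bullet> u - \<gamma> (q k) \<bullet> u\<bar> \<le> width u (\<gamma> ` C k)" if "k < length l" for k
    using subcontinuum_component_slab[OF dendriteD(2)[OF X] \<gamma> C(1)[OF that]] C(2,3)[OF that]
    by (intro abs_inner_diff_le_width compact_image_subcontinuum[OF \<gamma>]) auto
  have "list_width X \<gamma> x u \<mu> l = (\<Sum>k<length l. (1/2)^k * \<bar>\<gamma> (p k) \<bullet> u - \<gamma> (q k) \<bullet> u\<bar>)"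
    using True by (simp add: list_width_def p_def q_def)
  also have "\<dots> \<le> (\<Sum>k<length l. (1/2)^k * width u (\<gamma> ` C k))"
    using le by (intro sum_mono mult_left_mono) auto
  also have "\<dots> \<le> weighted_width X \<gamma> x u \<mu>"
  proof (rule weighted_sum_le_weighted_width[OF fin])
    have "C k \<noteq> C m" if "k < length l" "m < k" for k m
    proof
      assume "C k = C m"
      hence "same_component X \<gamma> x u \<mu> (p k) (p m)"
        using that C(1,2)[of k] C(2)[of m] unfolding same_component_def by auto
      thus False using True that by (auto simp: p_def)
    qed
    thus "inj_on C {..<length l}"
      by (intro inj_onI) (metis lessThan_iff linorder_neqE_nat)
    show "C ` {..<length l} \<subseteq> pieces X \<gamma> x u \<mu>"
    proof
      fix E assume "E \<in> C ` {..<length l}"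
      then obtain k where k: "k < length l" "E = C k" by auto
      have "\<gamma> (p k) \<bullet> u \<noteq> \<gamma> (q k) \<bullet> u" using True k by (simp add: p_def q_def)
      hence "0 < width u (\<gamma> ` C k)" using le[OF k(1)] by linarith
      thus "E \<in> pieces X \<gamma> x u \<mu>" using k C(1) unfolding pieces_def by blast
    qed
  qed simp
  finally show ?thesis .
next
  case False
  hence "list_width X \<gamma> x u \<mu> l = 0" unfolding list_width_def by (rule if_not_P)
  thus ?thesis using weighted_width_nonneg[OF finitely_many_wide_pieces_dendrite[OF X \<gamma> \<mu>]] by simp
qed

lemma sum_half_powers_le: "(\<Sum>k<M. (1/2::real)^k) \<le> 2"
proof -
  have "(\<Sum>k<M. (1/2::real)^k) = 2 - 2 * (1/2)^M" by (induction M) auto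
  thus ?thesis by simp
qed

lemma weighted_width_le_list_width:
  fixes X :: "'a::metric_space set" and \<gamma> :: "'a \<Rightarrow> 'b::real_inner"
  assumes X: "dendrite X" and \<gamma>: "continuous_on X \<gamma>" and \<mu>: "\<mu> > 0" and D: "D \<subseteq> X" "X \<subseteq> closure D"
    and b: "\<And>l. set l \<subseteq> D \<times> D \<Longrightarrow> list_width X \<gamma> x u \<mu> l \<le> b"
  shows "weighted_width X \<gamma> x u \<mu> \<le> b"
proof (rule weighted_width_leI[OF finitely_many_wide_pieces_dendrite[OF X \<gamma> \<mu>]])
  note dX = dendriteD[OF X]
  fix M :: nat and c assume c: "inj_on c {..<M}" "c ` {..<M} \<subseteq> pieces X \<gamma> x u \<mu>"
  show "(\<Sum>k<M. (1/2)^k * width u (\<gamma> ` c k)) \<le> b"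
  proof (rule field_le_epsilon)
    fix e :: real assume e: "e > 0"
    hence e2: "e / 2 > 0" by simp
    define P where "P k p q j \<longleftrightarrow> p \<in> D \<inter> c k \<and> q \<in> D \<inter> c k \<and>
      c k \<in> components (X \<inter> \<gamma> -` slab x u \<mu> j) \<and> \<gamma> p \<in> slab_interior x u \<mu> j \<and>
      \<gamma> p \<bullet> u \<noteq> \<gamma> q \<bullet> u \<and> width u (\<gamma> ` c k) - e/2 \<le> \<bar>\<gamma> p \<bullet> u - \<gamma> q \<bullet> u\<bar>" for k p q j
    have "\<exists>p q j. P k p q j" if "k < M" for k
    proof -
      have "c k \<in> pieces X \<gamma> x u \<mu>" using c(2) that by auto
      from piece_dense_points[OF dX(2,5) \<gamma> D this e2] show ?thesis unfolding P_def by metis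
    qed
    then obtain p q j where "\<And>k. k < M \<Longrightarrow> P k (p k) (q k) (j k)" by metis
    hence pq: "\<And>k. k < M \<Longrightarrow> p k \<in> D \<inter> c k" "\<And>k. k < M \<Longrightarrow> q k \<in> D \<inter> c k"
      "\<And>k. k < M \<Longrightarrow> c k \<in> components (X \<inter> \<gamma> -` slab x u \<mu> (j k))"
      "\<And>k. k < M \<Longrightarrow> \<gamma> (p k) \<in> slab_interior x u \<mu> (j k)"
      "\<And>k. k < M \<Longrightarrow> \<gamma> (p k) \<bullet> u \<noteq> \<gamma> (q k) \<bullet> u"
      "\<And>k. k < M \<Longrightarrow> width u (\<gamma> ` c k) - e/2 \<le> \<bar>\<gamma> (p k) \<bullet> u - \<gamma> (q k) \<bullet> u\<bar>"
      unfolding P_def by simp_all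
    define l where "l = map (\<lambda>k. (p k, q k)) [0..<M]"
    have len: "length l = M" and nth: "\<And>k. k < M \<Longrightarrow> l ! k = (p k, q k)" by (simp_all add: l_def)
    have "set l \<subseteq> D \<times> D" using pq(1,2) by (auto simp: l_def)
    have eqc: "c k = K" if "k < M" "K \<in> components (X \<inter> \<gamma> -` slab x u \<mu> i)" "p k \<in> K" for k K i
    proof -
      have "\<gamma> (p k) \<in> slab x u \<mu> i" using in_components_subset[OF that(2)] that(3) by auto
      hence "j k = i" using slab_interior_index_unique[OF \<mu> pq(4)[OF that(1)]] by simp
      thus ?thesis using components_eq[OF pq(3)[OF that(1)], of K] that pq(1)[OF that(1)] by blast
    qed
    have "list_width X \<gamma> x u \<mu> l = (\<Sum>k<M. (1/2)^k * \<bar>\<gamma> (p k) \<bullet> u - \<gamma> (q k) \<bullet> u\<bar>)"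
    proof -
      have "same_component X \<gamma> x u \<mu> (p k) (q k)" if "k < M" for k
        using pq(1-3)[OF that] unfolding same_component_def by blast
      moreover have "\<not> same_component X \<gamma> x u \<mu> (p k) (p m)" if "k < M" "m < k" for k m
      proof
        assume "same_component X \<gamma> x u \<mu> (p k) (p m)"
        then obtain i K where "K \<in> components (X \<inter> \<gamma> -` slab x u \<mu> i)" "p k \<in> K" "p m \<in> K"
          unfolding same_component_def by blast
        hence "c k = c m" using eqc[of k K i] eqc[of m K i] that by simp
        thus False using c(1) that by (auto dest: inj_onD)
      qed
      ultimately show ?thesis unfolding list_width_def len using pq(5) by (auto simp: nth)
    qed
    hence 1: "(\<Sum>k<M. (1/2)^k * \<bar>\<gamma> (p k) \<bullet> u - \<gamma> (q k) \<bullet> u\<bar>) \<le> b"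
      using b[OF \<open>set l \<subseteq> D \<times> D\<close>] by simp
    have "(\<Sum>k<M. (1/2)^k * width u (\<gamma> ` c k)) \<le> (\<Sum>k<M. (1/2)^k * (\<bar>\<gamma> (p k) \<bullet> u - \<gamma> (q k) \<bullet> u\<bar> + e/2))"
      using pq(6) by (intro sum_mono mult_left_mono) (auto simp: algebra_simps)
    also have "\<dots> = (\<Sum>k<M. (1/2)^k * \<bar>\<gamma> (p k) \<bullet> u - \<gamma> (q k) \<bullet> u\<bar>) + (\<Sum>k<M. (1/2)^k) * (e/2)"
      by (simp add: distrib_left sum.distrib sum_distrib_right)
    also have "(\<Sum>k<M. (1/2)^k) * (e/2) \<le> 2 * (e/2)"
      using e by (intro mult_right_mono sum_half_powers_le) simp
    finally show "(\<Sum>k<M. (1/2)^k * width u (\<gamma> ` c k)) \<le> b + e" using 1 by linarith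
  qed
qed

lemma weighted_width_le:
  fixes X :: "'a::metric_space set" and \<gamma> :: "'a \<Rightarrow> 'b::real_inner"
  assumes X: "dendrite X" and \<gamma>: "continuous_on X \<gamma>" and \<mu>: "\<mu> > 0"
  shows "weighted_width X \<gamma> x u \<mu> \<le> 2 * \<mu>"
proof (rule weighted_width_leI[OF finitely_many_wide_pieces_dendrite[OF X \<gamma> \<mu>]])
  fix M :: nat and c assume c: "inj_on c {..<M}" "c ` {..<M} \<subseteq> pieces X \<gamma> x u \<mu>"
  have "width u (\<gamma> ` C) \<le> \<mu>" if C: "C \<in> pieces X \<gamma> x u \<mu>" for C
  proof -
    obtain j where j: "C \<in> components (X \<inter> \<gamma> -` slab x u \<mu> j)" using C by (rule piecesE)
    note sc = subcontinuum_component_slab[OF dendriteD(2)[OF X] \<gamma> j]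
    show ?thesis
    proof (rule width_leI[OF compact_image_subcontinuum(1)[OF \<gamma> sc]])
      fix p q assume "p \<in> \<gamma> ` C" "q \<in> \<gamma> ` C"
      hence "p \<in> slab x u \<mu> j" "q \<in> slab x u \<mu> j" using in_components_subset[OF j] by auto
      thus "q \<bullet> u - p \<bullet> u \<le> \<mu>" by (auto simp: mem_slab_iff algebra_simps)
    qed (use \<mu> in simp)
  qed
  hence "(\<Sum>k<M. (1/2)^k * width u (\<gamma> ` c k)) \<le> (\<Sum>k<M. (1/2)^k * \<mu>)"
    using c by (intro sum_mono mult_left_mono) auto
  also have "\<dots> = (\<Sum>k<M. (1/2)^k) * \<mu>" by (simp add: sum_distrib_right)
  also have "\<dots> \<le> 2 * \<mu>"
    using \<mu> by (intro mult_right_mono sum_half_powers_le) simp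
  finally show "(\<Sum>k<M. (1/2)^k * width u (\<gamma> ` c k)) \<le> 2 * \<mu>" .
qed

text \<open>The integrals in \<open>len\<close> are only lower integrals unless the integrand is measurable; additivity and
  the strict inequality rest on the following fact.\<close>

lemma weighted_width_measurable:
  fixes X :: "'a::metric_space set" and \<gamma> :: "'a \<Rightarrow> 'b::euclidean_space"
  assumes X: "dendrite X" and \<gamma>: "continuous_on X \<gamma>"
  obtains h :: "real \<times> 'b \<times> real \<Rightarrow> ennreal" where
    "h \<in> borel_measurable (borel \<Otimes>\<^sub>M borel \<Otimes>\<^sub>M borel)"
    "\<And>\<mu> u x. \<mu> > 0 \<Longrightarrow> h (\<mu>, u, x) = ennreal (weighted_width X \<gamma> x u \<mu>)"
proof -
  obtain D where D: "countable D" "D \<subseteq> X" "X \<subseteq> closure D"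
    using compact_imp_countable_dense[OF dendriteD(2)[OF X]] by metis
  define L where "L = lists (D \<times> D)"
  have cL: "countable L" unfolding L_def using D(1) by (intro countable_lists countable_SIGMA) auto
  define h where "h = (\<lambda>y. SUP l\<in>L. ennreal (case y of (\<mu>, u, x) \<Rightarrow> list_width X \<gamma> x u \<mu> l))"
  show ?thesis
  proof (rule that[of h])
    show "h \<in> borel_measurable (borel \<Otimes>\<^sub>M borel \<Otimes>\<^sub>M borel)"
      unfolding h_def
    proof (rule borel_measurable_SUP[OF cL])
      fix l assume "l \<in> L"
      hence "set l \<subseteq> X \<times> X" using D(2) by (auto simp: L_def)
      from list_width_measurable[OF X \<gamma> this]
      show "(\<lambda>y. ennreal (case y of (\<mu>, u, x) \<Rightarrow> list_width X \<gamma> x u \<mu> l)) \<in>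
          borel_measurable (borel \<Otimes>\<^sub>M borel \<Otimes>\<^sub>M borel)"
        by (rule measurable_compose) simp
    qed
    fix \<mu> :: real and u :: 'b and x :: real
    assume \<mu>: "\<mu> > 0"
    show "h (\<mu>, u, x) = ennreal (weighted_width X \<gamma> x u \<mu>)"
    proof (rule antisym)
      show le: "h (\<mu>, u, x) \<le> ennreal (weighted_width X \<gamma> x u \<mu>)"
        unfolding h_def by (auto intro!: SUP_least ennreal_leI list_width_le_weighted_width[OF X \<gamma> \<mu>])
      show "ennreal (weighted_width X \<gamma> x u \<mu>) \<le> h (\<mu>, u, x)"
      proof (cases "h (\<mu>, u, x)")
        case (real b)
        have "weighted_width X \<gamma> x u \<mu> \<le> b"
        proof (rule weighted_width_le_list_width[OF X \<gamma> \<mu> D(2,3)])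
          fix l assume "set l \<subseteq> D \<times> D"
          hence "l \<in> L" by (auto simp: L_def)
          hence "ennreal (list_width X \<gamma> x u \<mu> l) \<le> h (\<mu>, u, x)"
            unfolding h_def by (auto intro: SUP_upper2)
          thus "list_width X \<gamma> x u \<mu> l \<le> b" using real by simp
        qed
        thus ?thesis using real by (simp add: ennreal_leI)
      qed simp
    qed
  qed
qed


subsection \<open>Integration\<close>

lemma AE_le_if_nn_integral_le:
  assumes "f \<in> borel_measurable M" "g \<in> borel_measurable M"
    and "\<And>x. f x \<le> g x" "(\<integral>\<^sup>+x. f x \<partial>M) \<noteq> \<infinity>" "(\<integral>\<^sup>+x. g x \<partial>M) \<le> (\<integral>\<^sup>+x. f x \<partial>M)"
  shows "AE x in M. g x \<le> f x"
  using nn_integral_less[OF assms(1,2,4)] assms(3,5) by (metis AE_I2 leD)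

lemma AE_sphere_measure_inner_nonzero:
  fixes v :: "'b::euclidean_space"
  assumes "v \<noteq> 0"
  shows "AE u in sphere_measure. v \<bullet> u \<noteq> 0"
proof -
  have "negligible {x. v \<bullet> x = 0}" using assms by (intro negligible_hyperplane) simp
  moreover have [measurable]: "{x. v \<bullet> x = 0} \<in> sets borel" by simp
  ultimately have "{x. v \<bullet> x = 0} \<in> null_sets lborel"
    unfolding negligible_iff_null_sets null_sets_completion_iff2 by (auto intro: null_sets_subset)
  hence "AE x in lborel. v \<bullet> x \<noteq> 0" by (auto dest: AE_not_in)
  hence "AE x in lborel. v \<bullet> sgn x \<noteq> 0"
    using AE_lborel_singleton[of "0::'b"] by eventually_elim (simp add: sgn_div_norm)
  hence "AE x in uniform_measure lborel (cball 0 1). v \<bullet> sgn x \<noteq> 0"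
    by (intro AE_uniform_measureI) auto
  thus ?thesis unfolding sphere_measure_def by (subst AE_distr_iff) auto
qed

lemma AE_sphere_measure_sphere: "AE u in (sphere_measure :: 'b::euclidean_space measure). u \<in> sphere 0 1"
proof -
  have "AE x in lborel. sgn x \<in> sphere (0::'b) 1"
    using AE_lborel_singleton[of "0::'b"] by eventually_elim (simp add: norm_sgn)
  hence "AE x in uniform_measure lborel (cball 0 1). sgn x \<in> sphere (0::'b) 1"
    by (intro AE_uniform_measureI) auto
  thus ?thesis unfolding sphere_measure_def by (subst AE_distr_iff) auto
qed

lemma finite_measure_sphere_measure: "finite_measure (sphere_measure :: 'b::euclidean_space measure)"
proof
  have "space (sphere_measure :: 'b measure) = UNIV"
    using sets_eq_imp_space_eq[OF sets_sphere_measure] by simp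
  thus "emeasure sphere_measure (space (sphere_measure :: 'b measure)) \<noteq> \<infinity>"
    by (simp add: emeasure_sphere_measure_UNIV)
qed

lemma AE_lborel_obtains_small:
  assumes "AE t in lborel. t \<in> {0<..1::real} \<longrightarrow> P t" "e > 0"
  obtains t where "0 < t" "t \<le> 1" "t < e" "P t"
proof (rule ccontr)
  assume "\<not> thesis"
  hence no: "0 < t \<Longrightarrow> t \<le> 1 \<Longrightarrow> t < e \<Longrightarrow> \<not> P t" for t using that by blast
  define m where "m = min 1 (e/2)"
  have m: "0 < m" "m \<le> 1" "m < e" using assms(2) by (auto simp: m_def)
  have "AE t in lborel. t \<notin> {0<..m}"
    using assms(1) by eventually_elim (use no m in force)
  hence "{0<..m} \<in> null_sets lborel"
    by (subst AE_iff_null_sets) auto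
  hence "emeasure lborel {0<..m} = 0" by auto
  thus False using m by simp
qed

lemma not_AE_not_in_Icc: "\<not> (AE x in lborel. x \<notin> {0..1::real})"
proof
  assume "AE x in lborel. x \<notin> {0..1::real}"
  hence "{0..1::real} \<in> null_sets lborel" by (subst AE_iff_null_sets) auto
  hence "emeasure lborel {0..1::real} = 0" by auto
  thus False by simp
qed

lemma sphere_in_borel [measurable]: "sphere (a :: 'b::euclidean_space) r \<in> sets borel"
  by (intro borel_closed closed_sphere)

definition height_integral ::
    "(real \<times> 'b::euclidean_space \<times> real \<Rightarrow> ennreal) \<Rightarrow> real \<Rightarrow> 'b \<Rightarrow> ennreal" where
  "height_integral h \<mu> u = (\<integral>\<^sup>+x. h (\<mu>, u, x) * indicator {0..1} x \<partial>lborel)"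

definition sphere_integral :: "(real \<times> 'b::euclidean_space \<times> real \<Rightarrow> ennreal) \<Rightarrow> real \<Rightarrow> ennreal" where
  "sphere_integral h \<mu> = (\<integral>\<^sup>+u. height_integral h \<mu> u * indicator (sphere 0 1) u
     \<partial>sphere_measure)"

definition total_integral :: "(real \<times> 'b::euclidean_space \<times> real \<Rightarrow> ennreal) \<Rightarrow> ennreal" where
  "total_integral h = (\<integral>\<^sup>+\<mu>. sphere_integral h \<mu> * indicator {0<..1} \<mu> \<partial>lborel)"

context
  fixes h :: "real \<times> 'b::euclidean_space \<times> real \<Rightarrow> ennreal"
  assumes h [measurable]: "h \<in> borel_measurable (borel \<Otimes>\<^sub>M borel \<Otimes>\<^sub>M borel)"
begin

lemma height_section_measurable [measurable]:
  "(\<lambda>x. h (\<mu>, u, x)) \<in> borel_measurable borel"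
  by (rule measurable_compose[OF _ h]) measurable

lemma height_integral_measurable2:
  "(\<lambda>(\<mu>, u). height_integral h \<mu> u) \<in> borel_measurable (borel \<Otimes>\<^sub>M borel)"
proof -
  have "(\<lambda>(y, x). h (fst y, snd y, x) * indicator {0..1} x) \<in>
      borel_measurable ((borel \<Otimes>\<^sub>M borel) \<Otimes>\<^sub>M lborel)"
    by measurable
  from lborel.borel_measurable_nn_integral[OF this] show ?thesis
    by (simp add: height_integral_def case_prod_beta')
qed

lemma height_integral_measurable [measurable]:
  "height_integral h \<mu> \<in> borel_measurable borel"
proof -
  have "(\<lambda>u. case (\<mu>, u) of (\<mu>, u) \<Rightarrow> height_integral h \<mu> u) \<in> borel_measurable borel"
    by (rule measurable_compose[OF _ height_integral_measurable2]) measurable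
  thus ?thesis by simp
qed

lemma height_integral_sphere_measurable:
  "(\<lambda>u. height_integral h \<mu> u * indicator (sphere 0 1) u) \<in> borel_measurable sphere_measure"
  unfolding measurable_cong_sets[OF sets_sphere_measure refl] by measurable

lemma sphere_integral_measurable [measurable]: "sphere_integral h \<in> borel_measurable borel"
proof -
  interpret finite_measure "sphere_measure :: 'b measure" by (rule finite_measure_sphere_measure)
  note [measurable] = height_integral_measurable2
  have "(\<lambda>(\<mu>, u). (case (\<mu>, u) of (\<mu>, u) \<Rightarrow> height_integral h \<mu> u) * indicator (sphere 0 1) u) \<in>
      borel_measurable (borel \<Otimes>\<^sub>M (sphere_measure :: 'b measure))"
    by measurable
  from borel_measurable_nn_integral[OF this] show ?thesis
    by (simp add: sphere_integral_def[abs_def] case_prod_beta')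
qed

end

lemma total_integral_add:
  fixes h k :: "real \<times> 'b::euclidean_space \<times> real \<Rightarrow> ennreal"
  assumes h: "h \<in> borel_measurable (borel \<Otimes>\<^sub>M borel \<Otimes>\<^sub>M borel)"
    and k: "k \<in> borel_measurable (borel \<Otimes>\<^sub>M borel \<Otimes>\<^sub>M borel)"
  shows "total_integral (\<lambda>y. h y + k y) = total_integral h + total_integral k"
proof -
  note [measurable] = height_section_measurable[OF h] height_section_measurable[OF k]
    height_integral_measurable[OF h] height_integral_measurable[OF k]
    sphere_integral_measurable[OF h] sphere_integral_measurable[OF k]
  have 1: "height_integral (\<lambda>y. h y + k y) \<mu> u = height_integral h \<mu> u + height_integral k \<mu> u" for \<mu> u
    unfolding height_integral_def distrib_right by (rule nn_integral_add) measurable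
  have 2: "sphere_integral (\<lambda>y. h y + k y) \<mu> = sphere_integral h \<mu> + sphere_integral k \<mu>" for \<mu>
    unfolding sphere_integral_def 1 distrib_right
    by (rule nn_integral_add; rule height_integral_sphere_measurable; fact)
  show ?thesis
    unfolding total_integral_def 2 distrib_right by (rule nn_integral_add) measurable
qed

lemma total_integral_mono:
  assumes "\<And>\<mu> u x. 0 < \<mu> \<Longrightarrow> h (\<mu>, u, x) \<le> k (\<mu>, u, x)"
  shows "total_integral h \<le> total_integral k"
  unfolding total_integral_def sphere_integral_def height_integral_def
  using assms by (intro nn_integral_mono) (auto simp: indicator_def intro!: nn_integral_mono)

lemma len_eq_total_integral:
  assumes "\<And>\<mu> u x. 0 < \<mu> \<Longrightarrow> h (\<mu>, u, x) = ennreal (weighted_width X \<gamma> x u \<mu>)"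
  shows "len X \<gamma> = total_integral h"
  unfolding len_def total_integral_def sphere_integral_def height_integral_def
  using assms by (intro nn_integral_cong) (auto simp: indicator_def intro!: nn_integral_cong)

lemma len_mono:
  assumes "\<And>\<mu> u x. 0 < \<mu> \<Longrightarrow> weighted_width A \<gamma> x u \<mu> \<le> weighted_width X \<gamma> x u \<mu>"
  shows "len A \<gamma> \<le> len X \<gamma>"
  unfolding len_def
  using assms by (intro nn_integral_mono) (auto simp: indicator_def intro!: nn_integral_mono ennreal_leI)

lemma height_integral_le:
  assumes "\<And>x. h (\<mu>, u, x) \<le> c"
  shows "height_integral h \<mu> u \<le> c"
proof -
  have "height_integral h \<mu> u \<le> (\<integral>\<^sup>+x. c * indicator {0..1} x \<partial>(lborel :: real measure))"
    unfolding height_integral_def using assms by (intro nn_integral_mono mult_right_mono) auto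
  thus ?thesis by (simp add: nn_integral_cmult_indicator)
qed

lemma sphere_integral_le:
  fixes h :: "real \<times> 'b::euclidean_space \<times> real \<Rightarrow> ennreal"
  assumes "\<And>u x. h (\<mu>, u, x) \<le> c"
  shows "sphere_integral h \<mu> \<le> c"
proof -
  have "sphere_integral h \<mu> \<le> (\<integral>\<^sup>+u. c * indicator (sphere 0 1) u \<partial>(sphere_measure :: 'b measure))"
    unfolding sphere_integral_def using assms by (intro nn_integral_mono mult_right_mono height_integral_le) auto
  thus ?thesis by (simp add: nn_integral_cmult_indicator emeasure_sphere_measure_sphere)
qed

lemma total_integral_le:
  assumes "\<And>\<mu> u x. 0 < \<mu> \<Longrightarrow> \<mu> \<le> 1 \<Longrightarrow> h (\<mu>, u, x) \<le> c"
  shows "total_integral h \<le> c"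
proof -
  have "total_integral h \<le> (\<integral>\<^sup>+\<mu>. c * indicator {0<..1} \<mu> \<partial>(lborel :: real measure))"
    unfolding total_integral_def using assms
    by (intro nn_integral_mono) (auto simp: indicator_def intro!: sphere_integral_le)
  thus ?thesis by (simp add: nn_integral_cmult_indicator)
qed

lemma total_integral_eq_imp:
  fixes h k :: "real \<times> 'b::euclidean_space \<times> real \<Rightarrow> ennreal"
  assumes h: "h \<in> borel_measurable (borel \<Otimes>\<^sub>M borel \<Otimes>\<^sub>M borel)"
    and k: "k \<in> borel_measurable (borel \<Otimes>\<^sub>M borel \<Otimes>\<^sub>M borel)"
    and le: "\<And>\<mu> u x. 0 < \<mu> \<Longrightarrow> h (\<mu>, u, x) \<le> k (\<mu>, u, x)"
    and fin: "\<And>\<mu> u x. 0 < \<mu> \<Longrightarrow> \<mu> \<le> 1 \<Longrightarrow> h (\<mu>, u, x) \<le> 2"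
    and eq: "total_integral h = total_integral k" and e: "e > 0"
  obtains \<mu> where "0 < \<mu>" "\<mu> < e" "AE u in sphere_measure. \<exists>x. k (\<mu>, u, x) \<le> h (\<mu>, u, x)"
proof -
  note [measurable] = height_section_measurable[OF h] height_section_measurable[OF k]
    height_integral_measurable[OF h] height_integral_measurable[OF k]
    sphere_integral_measurable[OF h] sphere_integral_measurable[OF k]
  have leh: "height_integral h \<mu> u \<le> height_integral k \<mu> u" if "0 < \<mu>" for \<mu> u
    unfolding height_integral_def using le[OF that] by (intro nn_integral_mono mult_right_mono) auto
  have les: "sphere_integral h \<mu> \<le> sphere_integral k \<mu>" if "0 < \<mu>" for \<mu>
    unfolding sphere_integral_def using leh[OF that] by (intro nn_integral_mono mult_right_mono) auto
  have nf: "a \<noteq> \<infinity>" if "a \<le> (2::ennreal)" for a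
    using that by (metis ennreal_numeral ennreal_less_top infinity_ennreal_def leD)
  have "AE \<mu> in lborel. sphere_integral k \<mu> * indicator {0<..1} \<mu> \<le> sphere_integral h \<mu> * indicator {0<..1} \<mu>"
  proof (rule AE_le_if_nn_integral_le)
    show "sphere_integral h \<mu> * indicator {0<..1} \<mu> \<le> sphere_integral k \<mu> * indicator {0<..1} \<mu>" for \<mu>
      using les by (auto simp: indicator_def)
    show "(\<integral>\<^sup>+\<mu>. sphere_integral h \<mu> * indicator {0<..1} \<mu> \<partial>lborel) \<noteq> \<infinity>"
      using nf[OF total_integral_le[where h = h and c = 2, OF fin]] by (simp add: total_integral_def)
    show "(\<integral>\<^sup>+\<mu>. sphere_integral k \<mu> * indicator {0<..1} \<mu> \<partial>lborel) \<le>
        (\<integral>\<^sup>+\<mu>. sphere_integral h \<mu> * indicator {0<..1} \<mu> \<partial>lborel)"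
      using eq by (simp add: total_integral_def)
  qed measurable
  hence "AE \<mu> in lborel. \<mu> \<in> {0<..1} \<longrightarrow> sphere_integral k \<mu> \<le> sphere_integral h \<mu>"
    by eventually_elim (auto simp: indicator_def)
  from AE_lborel_obtains_small[OF this e] obtain \<mu> where \<mu>: "0 < \<mu>" "\<mu> \<le> 1" "\<mu> < e" "sphere_integral k \<mu> \<le> sphere_integral h \<mu>"
    by metis
  have "AE u in sphere_measure. height_integral k \<mu> u * indicator (sphere 0 1) u \<le>
      height_integral h \<mu> u * indicator (sphere 0 1) u"
  proof (rule AE_le_if_nn_integral_le)
    show "height_integral h \<mu> u * indicator (sphere 0 1) u \<le> height_integral k \<mu> u * indicator (sphere 0 1) u" for u
      using leh[OF \<mu>(1)] by (auto simp: indicator_def)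
    show "(\<integral>\<^sup>+u. height_integral h \<mu> u * indicator (sphere 0 1) u \<partial>sphere_measure) \<noteq> \<infinity>"
      using nf[OF sphere_integral_le[where h = h and \<mu> = \<mu> and c = 2, OF fin[OF \<mu>(1,2)]]] by (simp add: sphere_integral_def)
    show "(\<integral>\<^sup>+u. height_integral k \<mu> u * indicator (sphere 0 1) u \<partial>sphere_measure) \<le>
        (\<integral>\<^sup>+u. height_integral h \<mu> u * indicator (sphere 0 1) u \<partial>sphere_measure)"
      using \<mu>(4) by (simp add: sphere_integral_def)
  qed (rule height_integral_sphere_measurable, fact)+
  hence "AE u in sphere_measure. height_integral k \<mu> u \<le> height_integral h \<mu> u"
    using AE_sphere_measure_sphere by eventually_elim (auto simp: indicator_def)
  hence "AE u in sphere_measure. \<exists>x. k (\<mu>, u, x) \<le> h (\<mu>, u, x)"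
  proof eventually_elim
    case (elim u)
    have "AE x in lborel. k (\<mu>, u, x) * indicator {0..1} x \<le> h (\<mu>, u, x) * indicator {0..1} x"
    proof (rule AE_le_if_nn_integral_le)
      show "h (\<mu>, u, x) * indicator {0..1} x \<le> k (\<mu>, u, x) * indicator {0..1} x" for x
        using le[OF \<mu>(1)] by (auto simp: indicator_def)
      show "(\<integral>\<^sup>+x. h (\<mu>, u, x) * indicator {0..1} x \<partial>lborel) \<noteq> \<infinity>"
        using nf[OF height_integral_le[where h = h and \<mu> = \<mu> and u = u and c = 2, OF fin[OF \<mu>(1,2)]]] by (simp add: height_integral_def)
      show "(\<integral>\<^sup>+x. k (\<mu>, u, x) * indicator {0..1} x \<partial>lborel) \<le> (\<integral>\<^sup>+x. h (\<mu>, u, x) * indicator {0..1} x \<partial>lborel)"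
        using elim by (simp add: height_integral_def)
    qed measurable
    show ?case
    proof (rule ccontr)
      assume "\<nexists>x. k (\<mu>, u, x) \<le> h (\<mu>, u, x)"
      hence "AE x in lborel. x \<notin> {0..1::real}"
        using \<open>AE x in lborel. k (\<mu>, u, x) * indicator {0..1} x \<le> h (\<mu>, u, x) * indicator {0..1} x\<close>
        by (auto elim!: eventually_mono simp: indicator_def)
      thus False using not_AE_not_in_Icc by blast
    qed
  qed
  thus ?thesis using that \<mu> by blast
qed

lemma AE_inner_zero_absurd:
  fixes v :: "'b::euclidean_space"
  assumes "v \<noteq> 0" "\<And>e. e > 0 \<Longrightarrow> \<exists>\<mu>. 0 < \<mu> \<and> \<mu> < e \<and> (AE u in sphere_measure. \<bar>v \<bullet> u\<bar> \<le> 2 * \<mu>)"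
  shows False
proof -
  have "AE u in sphere_measure. \<bar>v \<bullet> u\<bar> \<le> 2 * (1 / real (Suc n))" for n
  proof -
    obtain \<mu> where "\<mu> < 1 / real (Suc n)" "AE u in sphere_measure. \<bar>v \<bullet> u\<bar> \<le> 2 * \<mu>"
      using assms(2)[of "1 / real (Suc n)"] by auto
    thus ?thesis by (elim eventually_mono) auto
  qed
  hence "AE u in sphere_measure. \<forall>n. \<bar>v \<bullet> u\<bar> \<le> 2 * (1 / real (Suc n))" by (simp add: AE_all_countable)
  hence "AE u in (sphere_measure :: 'b measure). False"
    using AE_sphere_measure_inner_nonzero[OF assms(1)]
  proof eventually_elim
    case (elim u)
    hence "0 < \<bar>v \<bullet> u\<bar> / 2" by simp
    then obtain n where "inverse (real (Suc n)) < \<bar>v \<bullet> u\<bar> / 2" using reals_Archimedean by blast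
    thus False using elim(1) by (auto simp: inverse_eq_divide dest: spec[of _ n])
  qed
  hence "emeasure sphere_measure (space (sphere_measure :: 'b measure)) = 0"
    unfolding ae_filter_eq_bot_iff[symmetric] trivial_limit_def .
  moreover have "space (sphere_measure :: 'b measure) = UNIV"
    using sets_eq_imp_space_eq[OF sets_sphere_measure] by simp
  ultimately show False by (simp add: emeasure_sphere_measure_UNIV)
qed

lemma len_subcontinuum_eq_imp_constant:
  fixes X :: "'a::metric_space set" and \<gamma> :: "'a \<Rightarrow> 'b::euclidean_space"
  assumes X: "dendrite X" and \<gamma>: "continuous_on X \<gamma>" and A: "subcontinuum A X"
    and eq: "len A \<gamma> = len X \<gamma>" and D: "D \<in> components (X - A)"
  shows "\<gamma> constant_on D"
proof (rule ccontr)
  assume nc: "\<not> \<gamma> constant_on D"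
  have \<gamma>A: "continuous_on A \<gamma>" using \<gamma> subcontinuumD(1)[OF A] by (rule continuous_on_subset)
  note dA = dendrite_subcontinuum[OF X A]
  obtain a where a: "a \<in> A" "closure D = insert a D" "openin (top_of_set X) D"
    using dendrite_complement_component[OF X A D] by metis
  obtain z where z: "z \<in> D" "\<gamma> z \<noteq> \<gamma> a" using nc unfolding constant_on_def by metis
  define v where "v = \<gamma> z - \<gamma> a"
  have less: "weighted_width A \<gamma> x u \<mu> < weighted_width X \<gamma> x u \<mu>"
    if "0 < \<mu>" "2 * \<mu> < \<bar>v \<bullet> u\<bar>" for \<mu> u x
  proof -
    have "2 * \<mu> < \<bar>\<gamma> z \<bullet> u - \<gamma> a \<bullet> u\<bar>" using that(2) by (simp add: v_def inner_diff_left)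
    from piece_disjoint_subcontinuum[OF X A \<gamma> that(1) D a(2,3,1) z(1) this, of x]
    obtain E where "E \<in> pieces X \<gamma> x u \<mu>" "E \<inter> A = {}" by metis
    thus ?thesis by (rule weighted_width_subcontinuum_less[OF X A \<gamma> that(1)])
  qed
  obtain h where h: "h \<in> borel_measurable (borel \<Otimes>\<^sub>M borel \<Otimes>\<^sub>M borel)"
    "\<And>\<mu> u x. \<mu> > 0 \<Longrightarrow> h (\<mu>, u, x) = ennreal (weighted_width A \<gamma> x u \<mu>)"
    using weighted_width_measurable[OF dA \<gamma>A] by metis
  obtain k where k: "k \<in> borel_measurable (borel \<Otimes>\<^sub>M borel \<Otimes>\<^sub>M borel)"
    "\<And>\<mu> u x. \<mu> > 0 \<Longrightarrow> k (\<mu>, u, x) = ennreal (weighted_width X \<gamma> x u \<mu>)"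
    using weighted_width_measurable[OF X \<gamma>] by metis
  have le: "h (\<mu>, u, x) \<le> k (\<mu>, u, x)" if "0 < \<mu>" for \<mu> u x
    using that weighted_width_subcontinuum_le[OF X A \<gamma> that] by (simp add: h k ennreal_leI)
  have fin: "h (\<mu>, u, x) \<le> 2" if "0 < \<mu>" "\<mu> \<le> 1" for \<mu> u x
  proof -
    have "weighted_width A \<gamma> x u \<mu> \<le> 2"
      using weighted_width_le[OF dA \<gamma>A that(1), of x u] that(2) by simp
    thus ?thesis using ennreal_leI[of _ 2] by (simp add: h(2)[OF that(1)])
  qed
  have eq': "total_integral h = total_integral k"
    using eq len_eq_total_integral[OF h(2)] len_eq_total_integral[OF k(2)] by simp
  show False
  proof (rule AE_inner_zero_absurd)
    show "v \<noteq> 0" using z by (simp add: v_def)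
    fix e :: real assume "e > 0"
    show "\<exists>\<mu>. 0 < \<mu> \<and> \<mu> < e \<and> (AE u in sphere_measure. \<bar>v \<bullet> u\<bar> \<le> 2 * \<mu>)"
    proof (rule total_integral_eq_imp[where h = h and k = k and e = e])
      fix \<mu> assume \<mu>: "0 < \<mu>" "\<mu> < e" "AE u in sphere_measure. \<exists>x. k (\<mu>, u, x) \<le> h (\<mu>, u, x)"
      have "AE u in sphere_measure. \<bar>v \<bullet> u\<bar> \<le> 2 * \<mu>"
        using \<mu>(3)
      proof eventually_elim
        case (elim u)
        then obtain x where "k (\<mu>, u, x) \<le> h (\<mu>, u, x)" by blast
        hence "weighted_width X \<gamma> x u \<mu> \<le> weighted_width A \<gamma> x u \<mu>"
          using weighted_width_nonneg[OF finitely_many_wide_pieces_dendrite[OF dA \<gamma>A \<mu>(1)]]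
          by (simp add: h(2)[OF \<mu>(1)] k(2)[OF \<mu>(1)] ennreal_le_iff)
        thus ?case using less[OF \<mu>(1), of u x] by linarith
      qed
      thus "\<exists>\<mu>. 0 < \<mu> \<and> \<mu> < e \<and> (AE u in sphere_measure. \<bar>v \<bullet> u\<bar> \<le> 2 * \<mu>)" using \<mu> by blast
    qed (use h(1) k(1) le fin eq' \<open>e > 0\<close> in auto)
  qed
qed

lemma len_Un_le:
  fixes X :: "'a::metric_space set" and \<gamma> :: "'a \<Rightarrow> 'b::euclidean_space"
  assumes X: "dendrite X" and \<gamma>: "continuous_on X \<gamma>"
    and A: "subcontinuum A X" and B: "subcontinuum B X" and AB: "A \<union> B = X"
  shows "len X \<gamma> \<le> len A \<gamma> + len B \<gamma>"
proof -
  have \<gamma>A: "continuous_on A \<gamma>" and \<gamma>B: "continuous_on B \<gamma>"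
    using \<gamma> subcontinuumD(1)[OF A] subcontinuumD(1)[OF B] continuous_on_subset by blast+
  obtain h where h: "h \<in> borel_measurable (borel \<Otimes>\<^sub>M borel \<Otimes>\<^sub>M borel)"
    "\<And>\<mu> u x. \<mu> > 0 \<Longrightarrow> h (\<mu>, u, x) = ennreal (weighted_width A \<gamma> x u \<mu>)"
    using weighted_width_measurable[OF dendrite_subcontinuum[OF X A] \<gamma>A] by metis
  obtain k where k: "k \<in> borel_measurable (borel \<Otimes>\<^sub>M borel \<Otimes>\<^sub>M borel)"
    "\<And>\<mu> u x. \<mu> > 0 \<Longrightarrow> k (\<mu>, u, x) = ennreal (weighted_width B \<gamma> x u \<mu>)"
    using weighted_width_measurable[OF dendrite_subcontinuum[OF X B] \<gamma>B] by metis
  define l where "l = (\<lambda>(\<mu>, u, x). ennreal (weighted_width X \<gamma> x u \<mu>))"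
  have "len X \<gamma> = total_integral l" by (rule len_eq_total_integral) (simp add: l_def)
  also have "\<dots> \<le> total_integral (\<lambda>y. h y + k y)"
  proof (rule total_integral_mono)
    fix \<mu> :: real and u x assume \<mu>: "0 < \<mu>"
    have "ennreal (weighted_width X \<gamma> x u \<mu>) \<le> ennreal (weighted_width A \<gamma> x u \<mu> + weighted_width B \<gamma> x u \<mu>)"
      by (intro ennreal_leI weighted_width_Un_le[OF X A B AB \<gamma> \<mu>])
    also have "\<dots> = h (\<mu>, u, x) + k (\<mu>, u, x)"
      using weighted_width_nonneg[OF finitely_many_wide_pieces_dendrite[OF dendrite_subcontinuum[OF X A] \<gamma>A \<mu>]]
        weighted_width_nonneg[OF finitely_many_wide_pieces_dendrite[OF dendrite_subcontinuum[OF X B] \<gamma>B \<mu>]]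
      by (simp add: h(2)[OF \<mu>] k(2)[OF \<mu>])
    finally show "l (\<mu>, u, x) \<le> h (\<mu>, u, x) + k (\<mu>, u, x)" by (simp add: l_def)
  qed
  also have "\<dots> = len A \<gamma> + len B \<gamma>"
    using total_integral_add[OF h(1) k(1)] len_eq_total_integral[OF h(2)] len_eq_total_integral[OF k(2)] by simp
  finally show ?thesis .
qed

theorem proposition5:
  fixes X :: "'a::metric_space set" and \<gamma> :: "'a \<Rightarrow> real ^ 'n"
  assumes "CARD('n) \<ge> 2"
    and "dendrite X"
    and "continuous_on X \<gamma>"
  shows "(\<forall>A. subcontinuum A X \<longrightarrow>
            len A \<gamma> \<le> len X \<gamma> \<and>
            (len A \<gamma> = len X \<gamma> \<longleftrightarrow> (\<forall>D \<in> components (X - A). \<gamma> constant_on D))) \<and>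
         (\<forall>A B. subcontinuum A X \<and> subcontinuum B X \<and> A \<union> B = X \<longrightarrow>
            len X \<gamma> \<le> len A \<gamma> + len B \<gamma>)"
proof (intro conjI allI impI)
  note X = assms(2) and \<gamma> = assms(3)
  fix A assume A: "subcontinuum A X"
  show "len A \<gamma> \<le> len X \<gamma>"
    by (rule len_mono) (rule weighted_width_subcontinuum_le[OF X A \<gamma>])
  show "len A \<gamma> = len X \<gamma> \<longleftrightarrow> (\<forall>D \<in> components (X - A). \<gamma> constant_on D)"
  proof
    assume "len A \<gamma> = len X \<gamma>"
    thus "\<forall>D \<in> components (X - A). \<gamma> constant_on D"
      using len_subcontinuum_eq_imp_constant[OF X \<gamma> A] by blast
  next
    assume const: "\<forall>D \<in> components (X - A). \<gamma> constant_on D"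
    have "weighted_width A \<gamma> x u \<mu> = weighted_width X \<gamma> x u \<mu>" if "0 < \<mu>" for x u \<mu>
      by (rule weighted_width_subcontinuum_eq[OF X A \<gamma> that]) (use const in blast)
    thus "len A \<gamma> = len X \<gamma>" by (intro antisym len_mono) auto
  qed
next
  fix A B assume "subcontinuum A X \<and> subcontinuum B X \<and> A \<union> B = X"
  thus "len X \<gamma> \<le> len A \<gamma> + len B \<gamma>" using len_Un_le[OF assms(2,3)] by blast
qed

end
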